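(* Let $p$ be a prime, let $u \ge 0$ be an integer, and let $\alpha_n(1), \alpha_n(2), \ldots, \alpha_n(n+u) \in (0, 1/2]$ for every integer $n \ge 1$. Assume that for every $\epsilon>0$, $$\lim_{n \to \infty} \sum_{i=1}^{n+u} \exp \left( - \epsilon\, \alpha_n(i)\, n \right) = 0.$$ For each $n \ge 1$, let $A(n)$ be a random $n \times (n+u)$ matrix over $\mathbb{Z}_p$ with independent entries such that the $i$-th column is $\alpha_n(i)$-balanced for every $1 \le i \le n+u$. Then for every finite abelian $p$-group $H$, $$\lim_{n \to \infty} \mathbb{P}(\mathrm{cok}(A(n)) \cong H) = \frac{1}{|H|^u\, |\mathrm{Aut}(H)|} \prod_{i=1}^{\infty} (1-p^{-i-u}).$$
   Context: $\mathbb{Z}_p$ is the ring of $p$-adic integers. For an $n \times (n+u)$ matrix $A$ over $\mathbb{Z}_p$, regarded as a linear map $\mathbb{Z}_p^{n+u} \to \mathbb{Z}_p^n$, $\mathrm{cok}(A) = \mathbb{Z}_p^n / A\,\mathbb{Z}_p^{n+u}$ is its cokernel. $\mathrm{Aut}(H)$ is the automorphism group of $H$. For $\alpha \in (0,1/2]$, a random variable $y$ with values in $\mathbb{Z}_p$ is $\alpha$-balanced if $\mathbb{P}(y \equiv r \pmod{p}) \le 1-\alpha$ for every $r \in \mathbb{Z}_p/p\mathbb{Z}_p$. A random vector over $\mathbb{Z}_p$ is $\alpha$-balanced if its entries are independent and each entry is $\alpha$-balanced (the entries need not be identically distributed). *)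

theory Defs
  imports
    "HOL-Probability.Probability"
    "HOL-Algebra.QuotRing"
    "HOL-Algebra.Product_Groups"
    "HOL-Algebra.Bij"
begin

text \<open>
  A \<open>p\<close>-adic integer is a coherent sequence of residues: \<open>Zp p\<close> is the inverse limit of
  the rings \<open>\<int>/p\<^sup>k\<int>\<close>, where the residue modulo \<open>p\<^sup>k\<close> is represented by
  an integer in \<open>{0..<p\<^sup>k}\<close>.
\<close>

type_synonym padic = "nat \<Rightarrow> int"

definition Zp :: "nat \<Rightarrow> padic ring" where
  "Zp p =
    \<lparr>carrier = {x. \<forall>k. x k \<in> {0..<int p ^ k} \<and> x (Suc k) mod int p ^ k = x k},
     mult = (\<lambda>x y k. (x k * y k) mod int p ^ k),
     one = (\<lambda>k. 1 mod int p ^ k),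
     zero = (\<lambda>k. 0),
     add = (\<lambda>x y k. (x k + y k) mod int p ^ k)\<rparr>"

lemma Zp_cring:
  assumes "p > 0"
  shows "cring (Zp p)"
proof (rule cringI)
  have pk: "int p ^ k > 0" for k using assms by simp
  have md: "(a mod int p ^ Suc k) mod int p ^ k = a mod int p ^ k" for a k
    by (simp add: mod_mod_cancel)
  show "abelian_group (Zp p)"
  proof (rule abelian_groupI)
    fix x assume x: "x \<in> carrier (Zp p)"
    let ?y = "\<lambda>k. (- x k) mod int p ^ k"
    have "?y \<in> carrier (Zp p)"
      using x pk md by (auto simp: Zp_def simp del: power_Suc) (metis mod_minus_eq)
    moreover have "?y \<oplus>\<^bsub>Zp p\<^esub> x = \<zero>\<^bsub>Zp p\<^esub>"
      by (auto simp: Zp_def mod_simps)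
    ultimately show "\<exists>y\<in>carrier (Zp p). y \<oplus>\<^bsub>Zp p\<^esub> x = \<zero>\<^bsub>Zp p\<^esub>" by blast
  next
    fix x y assume "x \<in> carrier (Zp p)" "y \<in> carrier (Zp p)"
    then show "x \<oplus>\<^bsub>Zp p\<^esub> y \<in> carrier (Zp p)"
      using pk md by (auto simp: Zp_def simp del: power_Suc) (metis mod_add_eq)
  qed (use pk in \<open>auto simp: Zp_def mod_simps add_ac\<close>)
  show "comm_monoid (Zp p)"
  proof (rule comm_monoidI)
    fix x y assume "x \<in> carrier (Zp p)" "y \<in> carrier (Zp p)"
    then show "x \<otimes>\<^bsub>Zp p\<^esub> y \<in> carrier (Zp p)"
      using pk md by (auto simp: Zp_def simp del: power_Suc) (metis mod_mult_eq)
  qed (use pk md in \<open>auto simp: Zp_def mod_simps mult_ac simp del: power_Suc\<close>)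
qed (auto simp: Zp_def mod_simps algebra_simps)

text \<open>
  The Borel \<open>\<sigma>\<close>-algebra of the \<open>p\<close>-adic topology: the residue classes modulo the
  powers of \<open>p\<close> form a countable basis of that topology.
\<close>

definition Zp_borel :: "nat \<Rightarrow> padic measure" where
  "Zp_borel p = sigma (carrier (Zp p)) {{x \<in> carrier (Zp p). x k = r} | k r. True}"

definition Zp_mod_p :: "nat \<Rightarrow> padic set ring" where
  "Zp_mod_p p = Zp p Quot (PIdl\<^bsub>Zp p\<^esub> ([p] \<cdot>\<^bsub>Zp p\<^esub> \<one>\<^bsub>Zp p\<^esub>))"

definition balanced :: "nat \<Rightarrow> 'a measure \<Rightarrow> real \<Rightarrow> ('a \<Rightarrow> padic) \<Rightarrow> bool" where
  "balanced p M \<alpha> y \<longleftrightarrow>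
     y \<in> measurable M (Zp_borel p) \<and>
     (\<forall>C \<in> carrier (Zp_mod_p p). measure M {\<omega> \<in> space M. y \<omega> \<in> C} \<le> 1 - \<alpha>)"

definition balanced_vector ::
    "nat \<Rightarrow> 'a measure \<Rightarrow> real \<Rightarrow> 'i set \<Rightarrow> ('i \<Rightarrow> 'a \<Rightarrow> padic) \<Rightarrow> bool" where
  "balanced_vector p M \<alpha> I y \<longleftrightarrow>
     prob_space.indep_vars M (\<lambda>_. Zp_borel p) y I \<and> (\<forall>i\<in>I. balanced p M \<alpha> (y i))"

text \<open>
  Vectors are indexed by \<open>{1..n}\<close>; \<open>B i j\<close> is the entry of the matrix \<open>B\<close> in row \<open>i\<close>
  and column \<open>j\<close>.
\<close>

definition Zp_vec :: "nat \<Rightarrow> nat \<Rightarrow> (nat \<Rightarrow> padic) monoid" where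
  "Zp_vec p n = product_group {1..n} (\<lambda>_. add_monoid (Zp p))"

definition mat_apply ::
    "nat \<Rightarrow> nat \<Rightarrow> nat \<Rightarrow> (nat \<Rightarrow> nat \<Rightarrow> padic) \<Rightarrow> (nat \<Rightarrow> padic) \<Rightarrow> (nat \<Rightarrow> padic)" where
  "mat_apply p n m B x =
     (\<lambda>i\<in>{1..n}. \<Oplus>\<^bsub>Zp p\<^esub>j\<in>{1..m}. B i j \<otimes>\<^bsub>Zp p\<^esub> x j)"

definition cok ::
    "nat \<Rightarrow> nat \<Rightarrow> nat \<Rightarrow> (nat \<Rightarrow> nat \<Rightarrow> padic) \<Rightarrow> (nat \<Rightarrow> padic) set monoid" where
  "cok p n m B = Zp_vec p n Mod (mat_apply p n m B ` carrier (Zp_vec p m))"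

end

theory Submission
  imports Defs "HOL-Algebra.Multiplicative_Group"
begin

text \<open>
  Choose \<open>k\<close> such that \<open>p\<^sup>k\<^sup>-\<^sup>1\<close> annihilates \<open>H\<close>, put \<open>q = p\<^sup>k\<close>, and let \<open>S\<close> be the subgroup of
  \<open>V = (\<int>/q)\<^sup>n\<close> generated by the columns of the random matrix modulo \<open>q\<close>. By Nakayama's lemma the cokernel is
  isomorphic to \<open>H\<close> if and only if \<open>S\<close> is the kernel of a surjection from \<open>V\<close> to \<open>H\<close> (\<open>cok_iso_iff\<close>). The number of
  these kernels \<open>K\<close> is the number of generating \<open>n\<close>-tuples of \<open>H\<close> divided by the number of automorphisms, hence
  asymptotically \<open>|H|\<^sup>n / |Aut H|\<close> (\<open>card_gens_eq\<close>, \<open>card_gens_asymptotics\<close>), and the probability in question is the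
  sum of \<open>P(S = K)\<close> over all \<open>K\<close>.

  For fixed \<open>K\<close>, equality \<open>S = K\<close> means that the columns lie in \<open>K\<close> and span \<open>K / p K\<close>, a vector space of dimension
  \<open>n\<close> over \<open>F\<^sub>p\<close>. If the span has codimension \<open>r\<close>, the number of subgroups \<open>M\<close> of index \<open>p\<^sup>d\<close> between \<open>p K\<close> and \<open>K\<close>
  that contain all columns is a Gaussian binomial coefficient in \<open>r\<close> and \<open>d\<close>. Their alternating sum with
  coefficients \<open>(-1)\<^sup>d p\<^bsup>d(d-1)/2\<^esup>\<close>, truncated at \<open>D\<close>, is \<open>1\<close> for \<open>r = 0\<close> and otherwise has the sign of \<open>(-1)\<^sup>D\<close>
  (\<open>bonferroni_generation\<close>). So the probability is enclosed between finite alternating sums of the expected numbers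
  of pairs \<open>(K, M)\<close> for which all columns lie in \<open>M\<close>, and it suffices to find the limit of each of these numbers.

  Here \<open>M\<close> has index \<open>N = |H| p\<^sup>d\<close> in \<open>V\<close>. Uniform columns would all lie in \<open>M\<close> with probability \<open>1 / N\<^sup>n\<^sup>+\<^sup>u\<close>. For
  balanced columns the deviation from this value, summed over all \<open>M\<close> of index \<open>N\<close>, tends to \<open>0\<close>
  (\<open>lattice_mass_l1_tendsto_0\<close>). To see this, write \<open>M\<close> as the set of relations of a tuple \<open>g\<close> generating a group of
  order \<open>N\<close>, and look at the group elements that occur in a positive proportion of the entries of \<open>g\<close>. If they
  generate the group, Fourier analysis modulo \<open>q\<close> shows that the random combination \<open>\<Sum> x\<^sub>i g\<^sub>i\<close> is uniform up to a
  factor \<open>1 + O(exp (- c \<alpha> n))\<close>, and by hypothesis these errors have a small sum over all columns. Otherwise they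
  generate a proper subgroup \<open>B\<close>, and only few entries of \<open>g\<close>, say \<open>m\<close>, lie outside \<open>B\<close>. Their contribution falls
  into \<open>B\<close> with probability at most \<open>exp (- c min (\<alpha> m) 1)\<close>. The hypothesis on the \<open>\<alpha>\<close>, combined with the convexity
  of the exponential function, makes the product of these bounds over all columns outweigh the number of such
  tuples (\<open>small_support_sum_tendsto_0\<close>).

  The expected number of pairs therefore converges to an explicit value, and the resulting alternating
  series is the expansion of the product \<open>\<Prod> (1 - p\<^sup>-\<^sup>i\<^sup>-\<^sup>u)\<close> due to Euler (\<open>euler_product\<close>).
\<close>

section \<open>Sums over small supports\<close>

lemma exp_series_term_le: "real m ^ m / fact m \<le> exp (real m)"
proof -
  have "(\<lambda>k. real m ^ k /\<^sub>R fact k) sums exp (real m)" by (rule exp_converges)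
  then have "sum (\<lambda>k. real m ^ k /\<^sub>R fact k) {m} \<le> exp (real m)"
    by (intro sum_le_suminf[THEN order_trans])
       (auto simp: sums_iff)
  then show ?thesis by (simp add: field_simps)
qed

lemma binomial_le_exp_power:
  assumes "1 \<le> m" "m \<le> n"
  shows "real (n choose m) \<le> (exp 1 * real n / real m) ^ m"
proof -
  have "real (n choose m) * fact m \<le> real n ^ m"
  proof -
    have "(n choose m) * fact m \<le> n ^ m"
      using binomial_fact_lemma[OF assms(2)] binomial_fact_pow by blast
    then have "real ((n choose m) * fact m) \<le> real (n ^ m)" by (simp only: of_nat_le_iff)
    then show ?thesis by simp
  qed
  then have "real (n choose m) \<le> real n ^ m / fact m" by (simp add: field_simps)
  also have "\<dots> = (real n / real m) ^ m * (real m ^ m / fact m)"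
    using assms by (simp add: power_divide)
  also have "\<dots> \<le> (real n / real m) ^ m * exp (real m)"
    by (intro mult_left_mono exp_series_term_le) auto
  also have "\<dots> = (exp 1 * real n / real m) ^ m"
    by (simp add: power_mult_distrib power_divide exp_of_nat_mult[of m 1, simplified])
  finally show ?thesis .
qed

lemma exp_average_le:
  fixes y :: "nat \<Rightarrow> real"
  assumes "finite I" "I \<noteq> {}"
  shows "exp (- (\<Sum>j\<in>I. y j) / real (card I)) \<le> (\<Sum>j\<in>I. exp (- y j)) / real (card I)"
proof -
  have c: "real (card I) > 0" using assms by (simp add: card_gt_0_iff)
  have "exp (\<Sum>j\<in>I. (1 / real (card I)) *\<^sub>R (- y j)) \<le> (\<Sum>j\<in>I. (1 / real (card I)) * exp (- y j))"
    using c assms by (intro convex_on_sum[OF _ _ exp_convex]) auto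
  then show ?thesis by (simp add: sum_divide_distrib sum_negf)
qed

text \<open>
  The exponent is a sum of \<open>n + u\<close> terms, so convexity of \<open>exp\<close> (the inequality between geometric and
  arithmetic mean) turns the product of \<open>n + u\<close> exponentials into a power of their average. Since
  \<open>min (a m) 1\<close> is one of \<open>a m\<close> and \<open>1\<close>, the average is controlled by \<open>exp (- c n / m)\<close> and by
  \<open>\<Sum>\<^sub>j exp (- c a\<^sub>j n)\<close>, the quantity that the hypothesis of the limit theorem makes small.
\<close>

lemma small_support_bound:
  fixes a :: "nat \<Rightarrow> real"
  assumes c: "c > 0" and m: "1 \<le> m" and n: "n \<ge> 1" and a: "\<And>j. j \<in> {1..n+u} \<Longrightarrow> a j \<ge> 0"
  shows "exp (- c * (\<Sum>j=1..n+u. min (a j * real m) 1))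
    \<le> ((\<Sum>j=1..n+u. exp (- c * a j * real n)) / real n + exp (- c * real n / real m)) ^ m"
proof -
  let ?I = "{1..n+u}" and ?N = "real (n + u)"
  let ?y = "\<lambda>j. c * min (a j * real m) 1"
  let ?T = "\<Sum>j=1..n+u. exp (- c * a j * real n)"
  \<comment> \<open>the scaling by \<open>n / m\<close> turns the first alternative of the minimum into the exponent \<open>c a\<^sub>j n\<close>\<close>
  define y where "y j = c * min (a j * real m) 1 * real n / real m" for j
  have y0: "j \<in> ?I \<Longrightarrow> y j \<ge> 0" for j using a[of j] c by (simp add: y_def)
  have "exp (- (\<Sum>j\<in>?I. y j) / ?N) \<le> (\<Sum>j\<in>?I. exp (- y j)) / ?N"
    using exp_average_le[of ?I y] n by simp
  also have "(\<Sum>j\<in>?I. exp (- y j)) \<le> (\<Sum>j\<in>?I. exp (- c * a j * real n) + exp (- c * real n / real m))"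
  proof (rule sum_mono)
    fix j assume "j \<in> ?I"
    show "exp (- y j) \<le> exp (- c * a j * real n) + exp (- c * real n / real m)"
    proof (cases "a j * real m \<le> 1")
      case True
      then have "y j = c * a j * real n" using m by (simp add: y_def)
      then show ?thesis by simp
    next
      case False
      then have "y j = c * real n / real m" using m by (simp add: y_def)
      then show ?thesis by simp
    qed
  qed
  also have "(\<Sum>j\<in>?I. exp (- c * a j * real n) + exp (- c * real n / real m))
      = ?T + ?N * exp (- c * real n / real m)" by (simp add: sum.distrib)
  finally have 1: "exp (- (\<Sum>j\<in>?I. y j) / ?N) \<le> (?T + ?N * exp (- c * real n / real m)) / ?N"
    using n by (simp add: divide_right_mono)
  have T0: "?T \<ge> 0" by (intro sum_nonneg) auto
  have "(?T + ?N * exp (- c * real n / real m)) / ?N = ?T / ?N + exp (- c * real n / real m)"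
    using n by (simp add: field_simps)
  also have "\<dots> \<le> ?T / real n + exp (- c * real n / real m)"
    using n T0 by (intro add_mono divide_left_mono) auto
  finally have 2: "exp (- (\<Sum>j\<in>?I. y j) / ?N) \<le> ?T / real n + exp (- c * real n / real m)"
    using 1 by linarith
  have "exp (- (c * (\<Sum>j\<in>?I. min (a j * real m) 1))) = exp (- (\<Sum>j\<in>?I. y j) * (real m / real n))"
    using m n by (simp add: y_def sum_distrib_left sum_distrib_right sum_negf sum_divide_distrib)
  also have "\<dots> \<le> exp (real m * (- (\<Sum>j\<in>?I. y j) / ?N))"
  proof -
    have "(\<Sum>j\<in>?I. y j) * real m / ?N \<le> (\<Sum>j\<in>?I. y j) * real m / real n"
      using n y0 by (intro divide_left_mono mult_nonneg_nonneg sum_nonneg) auto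
    then show ?thesis by (simp add: mult.commute)
  qed
  also have "\<dots> = exp (- (\<Sum>j\<in>?I. y j) / ?N) ^ m" by (rule exp_of_nat_mult)
  also have "\<dots> \<le> (?T / real n + exp (- c * real n / real m)) ^ m"
    by (intro power_mono 2) auto
  finally show ?thesis by simp
qed

lemma tendsto_linear_times_exp: "c > 0 \<Longrightarrow> ((\<lambda>s::real. s * exp (- c * s)) \<longlongrightarrow> 0) at_top"
  by real_asymp

text \<open>
  The binomial coefficient is at most \<open>(e n / m)\<^sup>m\<close>, so with \<open>s = n / m\<close> the previous bound makes the \<open>m\<close>-th
  term at most \<open>(E (T + s exp (- c s)))\<^sup>m\<close>, where \<open>T\<close> tends to \<open>0\<close>. A small \<open>\<delta>\<close> forces \<open>s\<close> to be large and
  makes the base at most \<open>1/2\<close>. For \<open>m \<le> sqrt n\<close> the base even tends to \<open>0\<close>; the remaining terms form the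
  tail of a geometric series. The value of \<open>\<delta>\<close> depends only on \<open>c\<close> and \<open>C\<close>, which allows one threshold to serve
  several choices of \<open>a\<close>.
\<close>

lemma small_support_sum_tendsto_0:
  fixes a :: "nat \<Rightarrow> nat \<Rightarrow> real"
  assumes c: "c > 0" and C: "C > 0"
  shows "\<exists>\<delta>>0. \<forall>a :: nat \<Rightarrow> nat \<Rightarrow> real.
     (\<forall>n\<ge>1. \<forall>j\<in>{1..n+u}. a n j \<ge> 0) \<longrightarrow>
     (\<lambda>n. \<Sum>j=1..n+u. exp (- c * a n j * real n)) \<longlonglongrightarrow> 0 \<longrightarrow>
     (\<lambda>n. \<Sum>m | 1 \<le> m \<and> real m \<le> \<delta> * real n.
        real (n choose m) * C ^ m * exp (- c * (\<Sum>j=1..n+u. min (a n j * real m) 1))) \<longlonglongrightarrow> 0"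
proof -
  define E where "E = exp 1 * C"
  have E: "E > 0" using C by (simp add: E_def)
  have "eventually (\<lambda>s::real. s * exp (- c * s) < 1 / (4 * E)) at_top"
    using order_tendstoD(2)[OF tendsto_linear_times_exp[OF c], of "1 / (4 * E)"] E by simp
  then obtain s0 where s0: "\<And>s. s \<ge> s0 \<Longrightarrow> s * exp (- c * s) < 1 / (4 * E)"
    unfolding eventually_at_top_linorder by blast
  define \<delta> where "\<delta> = 1 / max s0 1"
  have d: "\<delta> > 0" "\<delta> \<le> 1" by (auto simp: \<delta>_def)
  have "(\<lambda>n. \<Sum>m | 1 \<le> m \<and> real m \<le> \<delta> * real n.
        real (n choose m) * C ^ m * exp (- c * (\<Sum>j=1..n+u. min (a n j * real m) 1))) \<longlonglongrightarrow> 0"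
    if a0: "\<forall>n\<ge>1. \<forall>j\<in>{1..n+u}. a n j \<ge> 0"
      and lim: "(\<lambda>n. \<Sum>j=1..n+u. exp (- c * a n j * real n)) \<longlonglongrightarrow> 0"
    for a :: "nat \<Rightarrow> nat \<Rightarrow> real"
  proof -
    define T where "T n = (\<Sum>j=1..n+u. exp (- c * a n j * real n))" for n
    have T0: "T n \<ge> 0" for n unfolding T_def by (intro sum_nonneg) auto
    define t where "t n m = real (n choose m) * C ^ m * exp (- c * (\<Sum>j=1..n+u. min (a n j * real m) 1))" for n m
    define I where "I n = {m. 1 \<le> m \<and> real m \<le> \<delta> * real n}" for n
    have fI: "finite (I n)" for n
      by (rule finite_subset[of _ "{..nat \<lfloor>\<delta> * real n\<rfloor>}"]) (auto simp: I_def le_nat_floor)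
    have t0: "t n m \<ge> 0" for n m using C by (simp add: t_def)
    have key: "t n m \<le> (E * (T n + (real n / real m) * exp (- c * (real n / real m)))) ^ m"
      if "n \<ge> 1" "m \<in> I n" for n m
    proof -
      have m: "1 \<le> m" using that by (simp add: I_def)
      have "\<delta> * real n \<le> 1 * real n" by (intro mult_right_mono d) auto
      moreover have "real m \<le> \<delta> * real n" using that by (simp add: I_def)
      ultimately have "real m \<le> real n" by linarith
      then have mn: "m \<le> n" by simp
      have "t n m \<le> (exp 1 * real n / real m) ^ m * C ^ m * (T n / real n + exp (- c * real n / real m)) ^ m"
        unfolding t_def T_def using C m mn that a0
        by (intro mult_mono binomial_le_exp_power small_support_bound c mult_nonneg_nonneg) auto
      also have "\<dots> = (exp 1 * real n / real m * C * (T n / real n + exp (- c * real n / real m))) ^ m"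
        by (simp only: power_mult_distrib)
      also have "exp 1 * real n / real m * C * (T n / real n + exp (- c * real n / real m))
          = E * (T n / real m + (real n / real m) * exp (- c * (real n / real m)))"
        using that m by (simp add: E_def field_simps)
      also have "\<dots> ^ m \<le> (E * (T n + (real n / real m) * exp (- c * (real n / real m)))) ^ m"
      proof (intro power_mono mult_left_mono add_mono)
        show "T n / real m \<le> T n" using T0[of n] m by (simp add: divide_le_eq mult_le_cancel_left1)
      qed (use E T0 in auto)
      finally show ?thesis .
    qed
    have half: "eventually (\<lambda>n. T n < 1 / (4 * E)) sequentially"
      using order_tendstoD(2)[OF lim, of "1 / (4 * E)"] E by (simp add: T_def)
    \<comment> \<open>the function \<open>s exp (- c s)\<close> decreases from \<open>1 / c\<close> onwards\<close>
    have dec: "\<exists>s1. \<forall>s t. s1 \<le> s \<longrightarrow> s \<le> t \<longrightarrow> t * exp (- c * t) \<le> s * exp (- c * s)"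
    proof (intro exI allI impI)
      fix s t :: real assume st: "1 / c \<le> s" "s \<le> t"
      have s: "s > 0" using st(1) c by (meson less_le_trans zero_less_divide_1_iff)
      have "t / s = 1 + (t - s) / s" using s by (simp add: field_simps)
      also have "\<dots> \<le> exp ((t - s) / s)" by (rule exp_ge_add_one_self)
      also have "\<dots> \<le> exp (c * (t - s))"
      proof -
        have "1 / s \<le> c" using st(1) s c by (simp add: field_simps)
        then have "(1 / s) * (t - s) \<le> c * (t - s)" using st(2) by (intro mult_right_mono) auto
        then show ?thesis by simp
      qed
      finally have "t \<le> s * exp (c * (t - s))" using s by (simp add: field_simps)
      then have "t * exp (- c * t) \<le> s * exp (c * (t - s)) * exp (- c * t)" by (intro mult_right_mono) auto
      also have "\<dots> = s * exp (- c * s)" by (simp add: mult.assoc exp_add[symmetric] algebra_simps)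
      finally show "t * exp (- c * t) \<le> s * exp (- c * s)" .
    qed
    then obtain s1 where s1: "\<And>s t. s1 \<le> s \<Longrightarrow> s \<le> t \<Longrightarrow> t * exp (- c * t) \<le> s * exp (- c * s)" by blast
    define \<sigma> where "\<sigma> n = E * (T n + sqrt (real n) * exp (- c * sqrt (real n)))" for n
    have \<sigma>lim: "\<sigma> \<longlonglongrightarrow> 0"
    proof -
      have "(\<lambda>n. sqrt (real n) * exp (- c * sqrt (real n))) \<longlonglongrightarrow> 0"
        using c by real_asymp
      from tendsto_mult_left[OF tendsto_add[OF lim this], of E]
      show ?thesis by (simp add: \<sigma>_def[abs_def] T_def)
    qed
    have "eventually (\<lambda>n. norm (\<Sum>m\<in>I n. t n m) \<le> 2 * \<sigma> n + 2 * (1/2) powr (sqrt (real n))) sequentially"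
      using half eventually_ge_at_top[of 1] order_tendstoD(2)[OF \<sigma>lim, of "1/2", simplified]
        eventually_ge_at_top[of "nat \<lceil>s1\<^sup>2\<rceil>"]
    proof eventually_elim
      case (elim n)
      have n1: "n \<ge> 1" using elim by simp
      have s1n: "s1 \<le> sqrt (real n)"
        using elim(4) by (intro real_le_rsqrt) linarith
      have \<sigma>0: "\<sigma> n \<ge> 0" using E T0[of n] by (simp add: \<sigma>_def)
      have le: "t n m \<le> (if real m \<le> sqrt (real n) then \<sigma> n * (1/2) ^ (m - 1) else (1/2) ^ m)" if m: "m \<in> I n" for m
      proof (cases "real m \<le> sqrt (real n)")
        case True
        have m1: "m \<ge> 1" using m by (simp add: I_def)
        have "sqrt (real n) * real m \<le> sqrt (real n) * sqrt (real n)" using True by (intro mult_left_mono) auto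
        then have "sqrt (real n) \<le> real n / real m" using m1 by (simp add: field_simps)
        then have "(real n / real m) * exp (- c * (real n / real m)) \<le> sqrt (real n) * exp (- c * sqrt (real n))"
          by (intro s1 s1n)
        then have "t n m \<le> \<sigma> n ^ m"
          unfolding \<sigma>_def using E T0[of n]
          by (intro order_trans[OF key[OF n1 m]] power_mono mult_left_mono add_left_mono) auto
        also have "\<sigma> n ^ m = \<sigma> n * \<sigma> n ^ (m - 1)" using m1 by (cases m) auto
        also have "\<dots> \<le> \<sigma> n * (1/2) ^ (m - 1)" using \<sigma>0 elim(3) by (intro mult_left_mono power_mono) auto
        finally show ?thesis using True by simp
      next
        case False
        have m1: "m \<ge> 1" "real m \<le> \<delta> * real n" using m by (auto simp: I_def)
        have "max s0 1 \<le> real n / real m"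
        proof -
          have "real m * max s0 1 \<le> real n" using m1(2) unfolding \<delta>_def
            by (simp add: field_simps)
          then show ?thesis using m1(1) by (subst pos_le_divide_eq) (auto simp: mult.commute)
        qed
        then have "(real n / real m) * exp (- c * (real n / real m)) < 1 / (4 * E)" by (intro s0) simp
        then have "E * (T n + (real n / real m) * exp (- c * (real n / real m))) \<le> E * (1 / (4 * E) + 1 / (4 * E))"
          using E elim(1) by (intro mult_left_mono add_mono) auto
        also have "\<dots> = 1/2" using E by (simp add: field_simps)
        finally have "t n m \<le> (1/2) ^ m"
          using E T0[of n] by (intro order_trans[OF key[OF n1 m]] power_mono) auto
        then show ?thesis using False by simp
      qed
      have "(\<Sum>m\<in>I n. t n m) \<le> (\<Sum>m\<in>I n. if real m \<le> sqrt (real n) then \<sigma> n * (1/2) ^ (m - 1) else (1/2) ^ m)"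
        by (intro sum_mono le)
      also have "\<dots> \<le> (\<Sum>m\<in>I n. \<sigma> n * (1/2) ^ (m - 1)) + (\<Sum>m\<in>I n. if real m \<le> sqrt (real n) then 0 else (1/2) ^ m)"
        unfolding sum.distrib[symmetric] using \<sigma>0 by (intro sum_mono) auto
      also have "(\<Sum>m\<in>I n. \<sigma> n * (1/2) ^ (m - 1)) \<le> \<sigma> n * 2"
      proof -
        have "(\<Sum>m\<in>I n. (1/2::real) ^ (m - 1)) = (\<Sum>m\<in>(\<lambda>m. m - 1) ` I n. (1/2) ^ m)"
          by (subst sum.reindex) (auto simp: I_def inj_on_def)
        also have "\<dots> \<le> suminf (\<lambda>m. (1/2::real) ^ m)" by (intro sum_le_suminf) (auto simp: fI)
        also have "\<dots> = 2" by (subst suminf_geometric) auto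
        finally show ?thesis using \<sigma>0 by (simp add: sum_distrib_left[symmetric] mult_left_mono)
      qed
      also have "(\<Sum>m\<in>I n. if real m \<le> sqrt (real n) then 0 else (1/2::real) ^ m) \<le> 2 * (1/2) powr (sqrt (real n))"
      proof -
        define b where "b = nat \<lceil>sqrt (real n)\<rceil>"
        have "(\<Sum>m\<in>I n. if real m \<le> sqrt (real n) then 0 else (1/2::real) ^ m)
          \<le> (\<Sum>m\<in>I n. if m < b then 0 else (1/2::real) ^ m)"
          by (intro sum_mono) (auto simp: b_def; linarith)
        also have "\<dots> = (\<Sum>m\<in>I n \<inter> {b..}. (1/2::real) ^ m)"
          by (intro sum.mono_neutral_cong_right) (auto simp: fI)
        also have "\<dots> = (\<Sum>m\<in>(\<lambda>m. m - b) ` (I n \<inter> {b..}). (1/2::real) ^ (m + b))"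
          by (subst sum.reindex) (auto simp: inj_on_def)
        also have "\<dots> = (1/2)^b * (\<Sum>m\<in>(\<lambda>m. m - b) ` (I n \<inter> {b..}). (1/2::real) ^ m)"
          by (simp add: power_add sum_distrib_left mult.commute)
        also have "\<dots> \<le> (1/2)^b * suminf (\<lambda>m. (1/2::real) ^ m)"
          by (intro mult_left_mono sum_le_suminf) (auto simp: fI)
        also have "\<dots> = 2 * (1/2)^b" by (subst suminf_geometric) auto
        also have "(1/2::real)^b = (1/2) powr real b" by (simp add: powr_realpow)
        also have "\<dots> \<le> (1/2) powr (sqrt (real n))"
        proof -
          have "sqrt (real n) \<le> real b" unfolding b_def by linarith
          then show ?thesis by (intro powr_mono') auto
        qed
        finally show ?thesis by simp
      qed
      finally have "(\<Sum>m\<in>I n. t n m) \<le> 2 * \<sigma> n + 2 * (1/2) powr (sqrt (real n))" by simp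
      then show ?case using t0 by (simp add: sum_nonneg)
    qed
    moreover have "(\<lambda>n. 2 * \<sigma> n + 2 * (1/2) powr (sqrt (real n))) \<longlonglongrightarrow> 0"
    proof -
      have "(\<lambda>n. (1/2::real) powr (sqrt (real n))) \<longlonglongrightarrow> 0" by real_asymp
      then show ?thesis
        using tendsto_add[OF tendsto_mult[OF tendsto_const[of 2] \<sigma>lim] tendsto_mult[OF tendsto_const[of 2]]] by fastforce
    qed
    ultimately have "(\<lambda>n. \<Sum>m\<in>I n. t n m) \<longlonglongrightarrow> 0" by (rule Lim_null_comparison)
    then show ?thesis by (simp add: t_def I_def)
  qed
  then show ?thesis using d by blast
qed

section \<open>Gaussian binomial coefficients and the Euler product\<close>

text \<open>
  The Gaussian binomial coefficient: the number of subspaces of codimension \<open>d\<close> of the space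
  \<open>F\<^sub>p\<^sup>r\<close>, defined by the \<open>q\<close>-Pascal rule.
\<close>

fun gbinom :: "nat \<Rightarrow> nat \<Rightarrow> nat \<Rightarrow> nat" where
  "gbinom p r 0 = 1"
| "gbinom p 0 (Suc d) = 0"
| "gbinom p (Suc r) (Suc d) = gbinom p r d + p ^ Suc d * gbinom p r (Suc d)"

lemma Suc_choose_two: "Suc d choose 2 = (d choose 2) + d"
  by (simp add: numeral_2_eq_2)

text \<open>
  The \<open>q\<close>-analogue of the partial alternating sums of a row of Pascal's triangle. The full sum
  vanishes for positive rank, and a truncated one has the sign of its last term; this is what makes
  truncated inclusion-exclusion a two-sided bound.
\<close>

lemma gbinom_alternating_sum:
  "(\<Sum>d\<le>D. (-1) ^ d * real p ^ (d choose 2) * real (gbinom p (Suc r) d))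
     = (-1) ^ D * real p ^ (Suc D choose 2) * real (gbinom p r D)"
proof (induction D)
  case (Suc D)
  then show ?case by (simp add: Suc_choose_two power_add algebra_simps del: gbinom.simps(1,2))
qed (simp add: numeral_2_eq_2)

lemma gbinom_alternating_sum_0:
  "(\<Sum>d\<le>D. (-1) ^ d * real p ^ (d choose 2) * real (gbinom p 0 d)) = 1"
proof (induction D)
  case (Suc D)
  then show ?case by simp
qed (simp add: numeral_2_eq_2)

text \<open>
  The number of linearly independent \<open>d\<close>-tuples in \<open>F\<^sub>p\<^sup>r\<close>.
\<close>

definition frames :: "nat \<Rightarrow> nat \<Rightarrow> nat \<Rightarrow> real" where
  "frames p r d = (\<Prod>i<d. real p ^ r - real p ^ i)"

lemma frames_Suc_Suc: "frames p (Suc r) (Suc d) = (real p ^ Suc r - 1) * real p ^ d * frames p r d"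
proof -
  have "frames p (Suc r) (Suc d) = (real p ^ Suc r - 1) * (\<Prod>i<d. real p ^ Suc r - real p ^ Suc i)"
    unfolding frames_def by (subst prod.lessThan_Suc_shift) simp
  also have "(\<Prod>i<d. real p ^ Suc r - real p ^ Suc i) = (\<Prod>i<d. real p * (real p ^ r - real p ^ i))"
    by (simp add: algebra_simps)
  also have "\<dots> = real p ^ d * frames p r d" by (simp add: prod.distrib frames_def)
  finally show ?thesis by (simp add: mult_ac)
qed

lemma gbinom_frames: "real (gbinom p r d) * frames p d d = frames p r d"
proof (induction p r d rule: gbinom.induct)
  case (1 p r)
  then show ?case by (simp add: frames_def)
next
  case (2 p d)
  have "frames p 0 (Suc d) = 0" unfolding frames_def by (subst prod.lessThan_Suc_shift) simp
  then show ?case by simp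
next
  case (3 p r d)
  have S: "frames p r (Suc d) = frames p r d * (real p ^ r - real p ^ d)" by (simp add: frames_def)
  have "real (gbinom p (Suc r) (Suc d)) * frames p (Suc d) (Suc d)
     = (real (gbinom p r d) * frames p d d) * ((real p ^ Suc d - 1) * real p ^ d)
       + real p ^ Suc d * (real (gbinom p r (Suc d)) * frames p (Suc d) (Suc d))"
    by (simp only: gbinom.simps of_nat_add of_nat_mult of_nat_power ring_distribs frames_Suc_Suc) (simp add: algebra_simps)
  also have "\<dots> = frames p r d * ((real p ^ Suc d - 1) * real p ^ d) + real p ^ Suc d * (frames p r d * (real p ^ r - real p ^ d))"
    unfolding 3 S ..
  also have "\<dots> = frames p (Suc r) (Suc d)" by (simp add: frames_Suc_Suc algebra_simps)
  finally show ?case .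
qed

lemma frames_pos: "p \<ge> 2 \<Longrightarrow> frames p d d > 0"
  unfolding frames_def by (intro prod_pos) (auto simp: power_strict_increasing)

lemma gbinom_asymptotics:
  assumes "p \<ge> 2"
  shows "(\<lambda>n. real (gbinom p n d) / real p ^ (d * n)) \<longlonglongrightarrow> 1 / frames p d d"
proof -
  have "(\<lambda>n. real p ^ i / real p ^ n) \<longlonglongrightarrow> 0" for i
  proof -
    have "(\<lambda>n. real p ^ i * (1 / real p) ^ n) \<longlonglongrightarrow> real p ^ i * 0"
      using assms by (intro tendsto_mult_left LIMSEQ_realpow_zero) auto
    then show ?thesis by (simp add: power_divide)
  qed
  then have "(\<lambda>n. (\<Prod>i<d. 1 - real p ^ i / real p ^ n) / frames p d d) \<longlonglongrightarrow> (\<Prod>i<d. 1 - 0) / frames p d d"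
    using frames_pos[OF assms, of d] by (intro tendsto_divide tendsto_prod tendsto_diff tendsto_const) auto
  moreover have "(\<Prod>i<d. 1 - real p ^ i / real p ^ n) / frames p d d = real (gbinom p n d) / real p ^ (d * n)" for n
  proof -
    have "(\<Prod>i<d. 1 - real p ^ i / real p ^ n) = (\<Prod>i<d. (real p ^ n - real p ^ i) / real p ^ n)"
      using assms by (intro prod.cong refl) (simp add: diff_divide_distrib)
    also have "\<dots> = frames p n d / real p ^ (d * n)"
      by (simp add: prod_dividef frames_def power_mult[symmetric] mult.commute)
    finally show ?thesis using frames_pos[OF assms, of d] by (simp add: gbinom_frames[of p n d, symmetric])
  qed
  ultimately show ?thesis by simp
qed

definition euler_coeff :: "nat \<Rightarrow> nat \<Rightarrow> real" where
  "euler_coeff p d = (-1) ^ d * real p ^ (d choose 2) / frames p d d"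

lemma euler_coeff_0: "euler_coeff p 0 = 1" by (simp add: euler_coeff_def frames_def numeral_2_eq_2)

lemma euler_coeff_Suc:
  assumes "p \<ge> 2" shows "euler_coeff p (Suc d) = - euler_coeff p d / (real p ^ Suc d - 1)"
proof -
  have cancel: "(-1) ^ Suc d * (P * x) / (Q * x * F) = - ((-1) ^ d * P / F) / Q" if "x \<noteq> 0" for P x Q F :: real
    using that by (simp add: divide_simps)
  have "real p ^ d \<noteq> 0" using assms by simp
  then show ?thesis
    unfolding euler_coeff_def frames_Suc_Suc Suc_choose_two power_add[of _ "d choose 2"] by (rule cancel)
qed

lemma summable_euler_coeff:
  assumes "p \<ge> 2" shows "summable (\<lambda>d. norm (euler_coeff p d))"
proof (rule summable_ratio_test[of "1/2" 1])
  fix d :: nat assume d: "1 \<le> d"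
  have "(2::real) ^ 2 \<le> 2 ^ Suc d" using d by (intro power_increasing) auto
  also have "\<dots> \<le> real p ^ Suc d" using assms by (intro power_mono) auto
  finally have "real p ^ Suc d - 1 \<ge> 2" by simp
  then have "\<bar>euler_coeff p d\<bar> / (real p ^ Suc d - 1) \<le> \<bar>euler_coeff p d\<bar> / 2" by (intro divide_left_mono) auto
  moreover have "\<bar>real p ^ Suc d - 1\<bar> = real p ^ Suc d - 1" using \<open>real p ^ Suc d - 1 \<ge> 2\<close> by linarith
  ultimately show "norm (norm (euler_coeff p (Suc d))) \<le> 1/2 * norm (norm (euler_coeff p d))"
    by (simp only: euler_coeff_Suc[OF assms] real_norm_def abs_divide abs_minus abs_abs)
qed simp

lemma summable_euler_powser:
  assumes "p \<ge> 2" "\<bar>z\<bar> \<le> 1" shows "summable (\<lambda>d. euler_coeff p d * z ^ d)"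
proof (rule summable_comparison_test[OF _ summable_euler_coeff[OF assms(1)]], intro exI allI impI)
  fix d
  show "norm (euler_coeff p d * z ^ d) \<le> norm (euler_coeff p d)"
    using assms(2) by (simp add: abs_mult power_abs mult_left_le power_le_one)
qed

definition euler_series :: "nat \<Rightarrow> real \<Rightarrow> real" where
  "euler_series p z = (\<Sum>d. euler_coeff p d * z ^ d)"

text \<open>
  Comparing coefficients, \<open>euler_coeff p (d + 1) (p\<^sup>d\<^sup>+\<^sup>1 - 1) = - euler_coeff p d\<close> is the functional equation
  \<open>f z - f (z / p) = - (z / p) f (z / p)\<close>.
\<close>

lemma euler_series_rec:
  assumes p: "p \<ge> 2" and z: "\<bar>z\<bar> \<le> 1"
  shows "euler_series p z = (1 - z / real p) * euler_series p (z / real p)"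
proof -
  let ?y = "z / real p"
  have "\<bar>z\<bar> \<le> real p" using p z by linarith
  then have y: "\<bar>?y\<bar> \<le> 1" using p by simp
  note S = summable_euler_powser[OF p]
  have "euler_series p z - euler_series p ?y = (\<Sum>d. euler_coeff p d * z ^ d - euler_coeff p d * ?y ^ d)"
    unfolding euler_series_def by (rule suminf_diff[OF S[OF z] S[OF y]])
  also have "\<dots> = (\<Sum>d. euler_coeff p (Suc d) * z ^ Suc d - euler_coeff p (Suc d) * ?y ^ Suc d)"
    using suminf_split_head[OF summable_diff[OF S[OF z] S[OF y]]] by simp
  also have "\<dots> = (\<Sum>d. - ?y * (euler_coeff p d * ?y ^ d))"
  proof (rule suminf_cong)
    fix d
    have pp: "real p ^ Suc d - 1 > 0" using p one_less_power[of "real p" "Suc d"] by simp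
    have zy: "z ^ Suc d = real p ^ Suc d * ?y ^ Suc d" using p by (simp add: power_mult_distrib[symmetric] del: power_Suc)
    have "euler_coeff p (Suc d) * z ^ Suc d - euler_coeff p (Suc d) * ?y ^ Suc d
      = euler_coeff p (Suc d) * (real p ^ Suc d - 1) * ?y ^ Suc d" unfolding zy by (simp only: ring_distribs mult.assoc mult_1)
    also have "euler_coeff p (Suc d) * (real p ^ Suc d - 1) = - euler_coeff p d"
      unfolding euler_coeff_Suc[OF p] using pp by (simp del: power_Suc)
    finally show "euler_coeff p (Suc d) * z ^ Suc d - euler_coeff p (Suc d) * ?y ^ Suc d = - ?y * (euler_coeff p d * ?y ^ d)"
      by simp
  qed
  also have "\<dots> = - ?y * euler_series p ?y"
    unfolding euler_series_def by (rule suminf_mult[OF S[OF y]])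
  finally show ?thesis by (simp add: algebra_simps)
qed

text \<open>
  Iterating the functional equation \<open>f z = (1 - z / p) f (z / p)\<close> from \<open>z = p\<^sup>-\<^sup>u\<close> splits off one factor at a
  time, and \<open>f\<close> is continuous at \<open>0\<close> with \<open>f 0 = 1\<close>.
\<close>

lemma euler_product:
  assumes p: "p \<ge> 2"
  shows "(\<Prod>i. 1 - 1 / real p ^ (Suc i + u)) = euler_series p (1 / real p ^ u)"
proof -
  have le1: "\<bar>1 / real p ^ m\<bar> \<le> 1" for m using p by simp
  have fin: "(\<Prod>i<n. 1 - 1 / real p ^ (Suc i + u)) * euler_series p (1 / real p ^ (u + n)) = euler_series p (1 / real p ^ u)" for n
  proof (induction n)
    case (Suc n)
    have "euler_series p (1 / real p ^ (u + n)) = (1 - 1 / real p ^ (Suc n + u)) * euler_series p (1 / real p ^ (u + Suc n))"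
      using euler_series_rec[OF p le1[of "u + n"]] by (simp add: add.commute mult.commute)
    then show ?case using Suc by (simp add: mult.assoc)
  qed simp
  have "isCont (\<lambda>z. \<Sum>d. euler_coeff p d * z ^ d) 0"
    by (rule isCont_powser[OF summable_euler_powser[OF p, of 1]]) auto
  then have c: "isCont (euler_series p) 0" by (simp add: euler_series_def[abs_def])
  have z: "(\<lambda>n. 1 / real p ^ (u + n)) \<longlonglongrightarrow> 0"
  proof -
    have "(\<lambda>n. (1 / real p ^ u) * (1 / real p) ^ n) \<longlonglongrightarrow> (1 / real p ^ u) * 0"
      using p by (intro tendsto_mult_left LIMSEQ_realpow_zero) auto
    then show ?thesis by (simp add: power_add power_divide)
  qed
  have "euler_series p 0 = 1" unfolding euler_series_def by (simp add: euler_coeff_0)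
  then have t: "(\<lambda>n. euler_series p (1 / real p ^ (u + n))) \<longlonglongrightarrow> 1"
    using isCont_tendsto_compose[OF c z] by simp
  have "(\<lambda>n. euler_series p (1 / real p ^ u) / euler_series p (1 / real p ^ (u + n))) \<longlonglongrightarrow> euler_series p (1 / real p ^ u) / 1"
    by (intro tendsto_divide t tendsto_const) auto
  moreover have "eventually (\<lambda>n. euler_series p (1 / real p ^ u) / euler_series p (1 / real p ^ (u + n)) = (\<Prod>i<n. 1 - 1 / real p ^ (Suc i + u))) sequentially"
    using order_tendstoD(1)[OF t, of 0, simplified]
  proof eventually_elim
    case (elim n)
    then show ?case using fin[of n] by (simp add: field_simps)
  qed
  ultimately have 1: "(\<lambda>n. \<Prod>i<n. 1 - 1 / real p ^ (Suc i + u)) \<longlonglongrightarrow> euler_series p (1 / real p ^ u)"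
    by (simp cong: filterlim_cong)
  have "abs_convergent_prod (\<lambda>i. 1 - 1 / real p ^ (Suc i + u))"
    unfolding abs_convergent_prod_conv_summable
  proof -
    have "summable (\<lambda>i. (1 / real p ^ (Suc u)) * (1 / real p) ^ i)"
      using p by (intro summable_mult summable_geometric) auto
    then show "summable (\<lambda>i. norm (1 - 1 / real p ^ (Suc i + u) - 1))"
      by (simp add: power_add power_divide mult_ac)
  qed
  then have "convergent_prod (\<lambda>i. 1 - 1 / real p ^ (Suc i + u))" by (rule abs_convergent_prod_imp_convergent_prod)
  then have "(\<lambda>n. \<Prod>i\<le>n. 1 - 1 / real p ^ (Suc i + u)) \<longlonglongrightarrow> (\<Prod>i. 1 - 1 / real p ^ (Suc i + u))"
    by (rule convergent_prod_LIMSEQ)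
  moreover have "(\<lambda>n. \<Prod>i\<le>n. 1 - 1 / real p ^ (Suc i + u)) \<longlonglongrightarrow> euler_series p (1 / real p ^ u)"
    using LIMSEQ_Suc[OF 1] by (simp only: lessThan_Suc_atMost)
  ultimately show ?thesis by (rule LIMSEQ_unique)
qed

lemma alternating_sandwich:
  fixes P :: "nat \<Rightarrow> real" and s :: "nat \<Rightarrow> nat \<Rightarrow> real"
  assumes s: "\<And>D. s D \<longlonglongrightarrow> L D" and L: "L \<longlonglongrightarrow> l"
    and ev: "\<And>D. even D \<Longrightarrow> eventually (\<lambda>n. P n \<le> s D n) sequentially"
    and od: "\<And>D. odd D \<Longrightarrow> eventually (\<lambda>n. s D n \<le> P n) sequentially"
  shows "P \<longlonglongrightarrow> l"
proof (rule order_tendstoI)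
  fix a assume "a < l"
  then obtain D0 where D0: "\<And>D. D \<ge> D0 \<Longrightarrow> a < L D"
    using order_tendstoD(1)[OF L] unfolding eventually_sequentially by blast
  have "odd (2 * D0 + 1)" "a < L (2 * D0 + 1)" using D0 by auto
  then show "eventually (\<lambda>n. a < P n) sequentially"
    using order_tendstoD(1)[OF s, of a "2 * D0 + 1"] od[of "2 * D0 + 1"]
    by (auto elim: eventually_elim2)
next
  fix a assume "a > l"
  then obtain D0 where D0: "\<And>D. D \<ge> D0 \<Longrightarrow> a > L D"
    using order_tendstoD(2)[OF L] unfolding eventually_sequentially by blast
  have "even (2 * D0)" "a > L (2 * D0)" using D0 by auto
  then show "eventually (\<lambda>n. a > P n) sequentially"
    using order_tendstoD(2)[OF s, of "2 * D0" a] ev[of "2 * D0"]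
    by (auto elim: eventually_elim2)
qed

section \<open>Equidistribution of sums of balanced residues\<close>

definition unit_root :: "nat \<Rightarrow> int \<Rightarrow> complex" where
  "unit_root q t = cis (2 * pi * of_int t / real q)"

lemma unit_root_add: "unit_root q (s + t) = unit_root q s * unit_root q t"
  by (simp add: unit_root_def cis_mult[symmetric] add_divide_distrib ring_distribs)

lemma unit_root_0 [simp]: "unit_root q 0 = 1" by (simp add: unit_root_def)

lemma norm_unit_root [simp]: "norm (unit_root q t) = 1" by (simp add: unit_root_def)

lemma unit_root_sum: "unit_root q (\<Sum>i\<in>S. x i) = (\<Prod>i\<in>S. unit_root q (x i))"
  by (induction S rule: infinite_finite_induct) (auto simp: unit_root_add)

lemma unit_root_mult_nat: "unit_root q (int s * t) = unit_root q t ^ s"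
  by (induction s) (auto simp: ring_distribs unit_root_add)

lemma unit_root_eq_1_iff:
  assumes "q > 0" shows "unit_root q t = 1 \<longleftrightarrow> int q dvd t"
proof
  assume "unit_root q t = 1"
  then have "cos (2 * pi * of_int t / real q) = 1"
    unfolding unit_root_def by (metis Re_complex_of_real cis.simps(1) of_real_1)
  then obtain m :: int where "2 * pi * of_int t / real q = of_int m * 2 * pi"
    unfolding cos_one_2pi_int by blast
  then have "real_of_int t = real_of_int (m * int q)" using assms by (simp add: field_simps)
  then show "int q dvd t" by (metis dvd_triv_right of_int_eq_iff)
next
  assume "int q dvd t"
  then obtain m where "t = int q * m" by blast
  then have "2 * pi * of_int t / real q = 2 * pi * of_int m" using assms by simp
  then show "unit_root q t = 1" by (simp add: unit_root_def)
qed

lemma sum_unit_root: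
  assumes "d > 0"
  shows "(\<Sum>s<d. unit_root d (int s * u)) = (if int d dvd u then of_nat d else 0)"
proof (cases "int d dvd u")
  case True
  then have "unit_root d (int s * u) = 1" for s using assms by (simp add: unit_root_eq_1_iff)
  then show ?thesis using True by simp
next
  case False
  then have ne: "unit_root d u \<noteq> 1" using assms by (simp add: unit_root_eq_1_iff)
  have "unit_root d u ^ d = 1"
    unfolding unit_root_mult_nat[symmetric] using assms by (simp add: unit_root_eq_1_iff)
  then show ?thesis using False ne by (simp add: unit_root_mult_nat geometric_sum)
qed

lemma unit_root_scale:
  assumes "q = d * e" "q > 0" shows "unit_root d t = unit_root q (int e * t)"
  using assms by (simp add: unit_root_def mult_ac)

text \<open>
  A lower bound for half of the distance between \<open>1\<close> and the real part of any other \<open>q\<close>-th root of unity;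
  the extra \<open>0\<close> gives the maximum a value for \<open>q = 1\<close> and can only lower the bound.
\<close>

definition spectral_gap :: "nat \<Rightarrow> real" where
  "spectral_gap q = (1 - Max (insert 0 ((\<lambda>t. Re (unit_root q t)) ` {1..<int q}))) / 2"

lemma unit_root_mod: "q > 0 \<Longrightarrow> unit_root q (t mod int q) = unit_root q t"
proof -
  assume q: "q > 0"
  have "unit_root q t = unit_root q (t mod int q + int q * (t div int q))" by simp
  also have "\<dots> = unit_root q (t mod int q)" unfolding unit_root_add using q by (simp add: unit_root_eq_1_iff)
  finally show ?thesis by simp
qed

lemma spectral_gap_pos: "spectral_gap q > 0"
proof -
  have "Re (unit_root q t) < 1" if "t \<in> {1..<int q}" for t
  proof -
    have "\<not> int q dvd t" using that zdvd_imp_le[of "int q" t] by auto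
    then have "unit_root q t \<noteq> 1" using that by (subst unit_root_eq_1_iff) auto
    moreover have "unit_root q t = 1" if "Re (unit_root q t) \<ge> 1"
    proof -
      have "Re (unit_root q t) = 1" using that complex_Re_le_cmod[of "unit_root q t"] by simp
      moreover have "(Re (unit_root q t))\<^sup>2 + (Im (unit_root q t))\<^sup>2 = 1"
        using cmod_power2[of "unit_root q t"] by simp
      ultimately show ?thesis by (auto simp: complex_eq_iff)
    qed
    ultimately show ?thesis by (meson not_le)
  qed
  then show ?thesis by (simp add: spectral_gap_def Max_less_iff)
qed

lemma Re_unit_root_le:
  assumes "q > 0" "\<not> int q dvd t"
  shows "Re (unit_root q t) \<le> 1 - 2 * spectral_gap q"
proof -
  have "t mod int q \<in> {1..<int q}" using assms pos_mod_sign[of "int q" t] pos_mod_bound[of "int q" t]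
    unfolding dvd_eq_mod_eq_0 atLeastLessThan_iff by linarith
  then have "Re (unit_root q (t mod int q)) \<le> Max (insert 0 ((\<lambda>t. Re (unit_root q t)) ` {1..<int q}))"
    by (intro Max_ge) auto
  then show ?thesis using assms by (simp add: spectral_gap_def unit_root_mod field_simps)
qed

text \<open>
  What the balance condition on a \<open>p\<close>-adic variable says about its law modulo \<open>q\<close>, a power of \<open>p\<close>.
\<close>

definition balanced_weights :: "nat \<Rightarrow> nat \<Rightarrow> real \<Rightarrow> (int \<Rightarrow> real) \<Rightarrow> bool" where
  "balanced_weights p q a w \<longleftrightarrow> (\<forall>r\<in>{0..<int q}. w r \<ge> 0) \<and> (\<Sum>r\<in>{0..<int q}. w r) = 1 \<and>
     (\<forall>s. (\<Sum>r | r \<in> {0..<int q} \<and> r mod int p = s. w r) \<le> 1 - a)"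

text \<open>
  The squared modulus of the coefficient is the average of \<open>Re (unit_root q (s (r - t)))\<close> over independent
  \<open>r\<close> and \<open>t\<close>. These are incongruent modulo \<open>p\<close> with probability at least \<open>a\<close>, and then \<open>r - t\<close> is a unit
  modulo \<open>q\<close>, so that \<open>s (r - t)\<close> is still not divisible by \<open>q\<close> and the real part stays away from \<open>1\<close>.
\<close>

lemma fourier_coefficient_bound:
  assumes w: "balanced_weights p q a w" and p: "Factorial_Ring.prime p" and q: "q = p ^ k"
    and s: "\<not> int q dvd s"
  shows "norm (\<Sum>r\<in>{0..<int q}. of_real (w r) * unit_root q (s * r)) \<le> exp (- spectral_gap q * a)"
proof -
  let ?R = "{0..<int q}"
  let ?f = "\<Sum>r\<in>?R. of_real (w r) * unit_root q (s * r)"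
  have q0: "q > 0" using p q by (simp add: prime_gt_0_nat)
  have w0: "\<And>r. r \<in> ?R \<Longrightarrow> w r \<ge> 0" and w1: "sum w ?R = 1"
    and wb: "\<And>t. (\<Sum>r | r \<in> ?R \<and> r mod int p = t. w r) \<le> 1 - a"
    using w by (auto simp: balanced_weights_def)
  have cn: "cnj (unit_root q t) = unit_root q (- t)" for t by (simp add: unit_root_def cis_cnj)
  have "of_real ((norm ?f)\<^sup>2) = ?f * cnj ?f" by (rule complex_norm_square)
  also have "\<dots> = (\<Sum>r\<in>?R. \<Sum>t\<in>?R. of_real (w r * w t) * unit_root q (s * (r - t)))"
    unfolding cnj_sum sum_product
  proof (intro sum.cong refl)
    fix r t
    have "unit_root q (s * (r - t)) = unit_root q (s * r) * unit_root q (- (s * t))"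
      unfolding unit_root_add[symmetric] by (simp add: algebra_simps)
    then show "of_real (w r) * unit_root q (s * r) * cnj (of_real (w t) * unit_root q (s * t))
      = of_real (w r * w t) * unit_root q (s * (r - t))" by (simp add: cn)
  qed
  finally have "(norm ?f)\<^sup>2 = Re (\<Sum>r\<in>?R. \<Sum>t\<in>?R. of_real (w r * w t) * unit_root q (s * (r - t)))"
    by (metis Re_complex_of_real)
  also have "\<dots> = (\<Sum>r\<in>?R. \<Sum>t\<in>?R. w r * w t * Re (unit_root q (s * (r - t))))"
    by (simp add: Re_sum)
  also have "\<dots> \<le> (\<Sum>r\<in>?R. \<Sum>t\<in>?R. w r * w t * (1 - 2 * spectral_gap q * (if t mod int p = r mod int p then 0 else 1)))"
  proof (intro sum_mono mult_left_mono)
    fix r t assume rt: "r \<in> ?R" "t \<in> ?R"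
    show "Re (unit_root q (s * (r - t))) \<le> 1 - 2 * spectral_gap q * (if t mod int p = r mod int p then 0 else 1)"
    proof (cases "t mod int p = r mod int p")
      case True
      then show ?thesis using complex_Re_le_cmod[of "unit_root q (s * (r - t))"] by simp
    next
      case False
      then have "\<not> int p dvd r - t" by (metis mod_eq_dvd_iff)
      then have "coprime (int q) (r - t)" unfolding q of_nat_power
        using p by (intro coprime_power_left_iff[THEN iffD2] disjI1 prime_imp_coprime) auto
      then have "\<not> int q dvd s * (r - t)" using s by (simp add: coprime_dvd_mult_left_iff)
      then show ?thesis using False Re_unit_root_le[OF q0] by simp
    qed
  qed (use w0 in auto)
  also have "\<dots> = (\<Sum>r\<in>?R. w r * ((1 - 2 * spectral_gap q) + 2 * spectral_gap q * (\<Sum>t | t \<in> ?R \<and> t mod int p = r mod int p. w t)))"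
  proof (rule sum.cong[OF refl])
    fix r
    have "(\<Sum>t\<in>?R. w r * w t * (1 - 2 * spectral_gap q * (if t mod int p = r mod int p then 0 else 1)))
       = w r * (\<Sum>t\<in>?R. w t * (1 - 2 * spectral_gap q) + 2 * spectral_gap q * (if t mod int p = r mod int p then w t else 0))"
      unfolding sum_distrib_left by (intro sum.cong refl) (auto simp: algebra_simps)
    also have "\<dots> = w r * ((\<Sum>t\<in>?R. w t) * (1 - 2 * spectral_gap q) + 2 * spectral_gap q * (\<Sum>t\<in>?R. if t mod int p = r mod int p then w t else 0))"
      by (simp add: sum.distrib sum_distrib_left sum_distrib_right)
    also have "(\<Sum>t\<in>?R. if t mod int p = r mod int p then w t else 0) = (\<Sum>t | t \<in> ?R \<and> t mod int p = r mod int p. w t)"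
      by (subst sum.inter_filter[symmetric]) auto
    finally show "(\<Sum>t\<in>?R. w r * w t * (1 - 2 * spectral_gap q * (if t mod int p = r mod int p then 0 else 1))) =
       w r * ((1 - 2 * spectral_gap q) + 2 * spectral_gap q * (\<Sum>t | t \<in> ?R \<and> t mod int p = r mod int p. w t))"
      by (simp add: w1)
  qed
  also have "\<dots> \<le> (\<Sum>r\<in>?R. w r * ((1 - 2 * spectral_gap q) + 2 * spectral_gap q * (1 - a)))"
    using w0 wb spectral_gap_pos[of q] by (intro sum_mono mult_left_mono add_left_mono) auto
  also have "\<dots> = 1 - 2 * spectral_gap q * a"
    unfolding sum_distrib_right[symmetric] w1 by (simp add: algebra_simps)
  also have "\<dots> \<le> exp (- 2 * spectral_gap q * a)" using exp_ge_add_one_self[of "- 2 * spectral_gap q * a"] by simp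
  also have "\<dots> = (exp (- spectral_gap q * a))\<^sup>2" by (simp add: exp_of_nat_mult[symmetric])
  finally show ?thesis by (rule power2_le_imp_le) auto
qed

text \<open>
  Fourier inversion on the integers modulo \<open>d\<close>: the trivial character contributes \<open>1 / d\<close>, and each of
  the other \<open>d - 1\<close> characters contributes a product of \<open>card S\<close> coefficients bounded by the previous lemma.
\<close>

lemma residue_equidistribution:
  assumes S: "finite S" and p: "Factorial_Ring.prime p" and q: "q = p ^ k" and d: "q = d * e"
    and w: "\<And>i. i \<in> S \<Longrightarrow> balanced_weights p q a (w i)"
  shows "\<bar>(\<Sum>x | x \<in> PiE S (\<lambda>_. {0..<int q}) \<and> int d dvd (\<Sum>i\<in>S. x i) - c. \<Prod>i\<in>S. w i (x i)) - 1 / real d\<bar>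
     \<le> (1 - 1 / real d) * exp (- spectral_gap q * a * real (card S))"
proof -
  let ?X = "PiE S (\<lambda>_. {0..<int q})"
  have q0: "q > 0" using p q by (simp add: prime_gt_0_nat)
  then have d0: "d > 0" and e0: "e > 0" using d by auto
  have fX: "finite ?X" using S by (intro finite_PiE) auto
  define P where "P = (\<Sum>x | x \<in> ?X \<and> int d dvd (\<Sum>i\<in>S. x i) - c. \<Prod>i\<in>S. w i (x i))"
  define F where "F s = (\<Prod>i\<in>S. \<Sum>r\<in>{0..<int q}. of_real (w i r) * unit_root q (int (s * e) * r))" for s
  have "of_real P = (\<Sum>x\<in>?X. of_real (\<Prod>i\<in>S. w i (x i)) * (if int d dvd (\<Sum>i\<in>S. x i) - c then 1 else 0))"
    unfolding P_def of_real_sum using fX by (subst sum.inter_filter) (auto intro!: sum.cong)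
  also have "\<dots> = (\<Sum>x\<in>?X. of_real (\<Prod>i\<in>S. w i (x i)) * ((\<Sum>s<d. unit_root d (int s * ((\<Sum>i\<in>S. x i) - c))) / of_nat d))"
    using d0 by (intro sum.cong refl) (simp add: sum_unit_root)
  also have "\<dots> = (\<Sum>s<d. \<Sum>x\<in>?X. of_real (\<Prod>i\<in>S. w i (x i)) * unit_root d (int s * ((\<Sum>i\<in>S. x i) - c))) / of_nat d"
    unfolding sum_divide_distrib sum_distrib_left
    by (subst sum.swap) (simp only: times_divide_eq_right)
  also have "\<dots> = (\<Sum>s<d. unit_root d (- int s * c) * F s) / of_nat d"
  proof (intro arg_cong2[where f = "(/)"] sum.cong refl)
    fix s
    have "F s = (\<Sum>x\<in>?X. \<Prod>i\<in>S. of_real (w i (x i)) * unit_root q (int (s * e) * x i))"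
      unfolding F_def using S by (subst prod_sum_PiE) auto
    also have "\<dots> = (\<Sum>x\<in>?X. of_real (\<Prod>i\<in>S. w i (x i)) * unit_root d (int s * (\<Sum>i\<in>S. x i)))"
    proof (intro sum.cong refl)
      fix x
      have "unit_root q (int (s * e) * y) = unit_root d (int s * y)" for y
        using unit_root_scale[OF d q0, of "int s * y"] by (simp add: mult_ac)
      then show "(\<Prod>i\<in>S. of_real (w i (x i)) * unit_root q (int (s * e) * x i))
         = of_real (\<Prod>i\<in>S. w i (x i)) * unit_root d (int s * (\<Sum>i\<in>S. x i))"
        by (simp add: prod.distrib sum_distrib_left unit_root_sum)
    qed
    finally have F: "F s = (\<Sum>x\<in>?X. of_real (\<Prod>i\<in>S. w i (x i)) * unit_root d (int s * (\<Sum>i\<in>S. x i)))" .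
    have "unit_root d (int s * (y - c)) = unit_root d (- int s * c) * unit_root d (int s * y)" for y
      unfolding unit_root_add[symmetric] by (simp add: algebra_simps)
    then show "(\<Sum>x\<in>?X. of_real (\<Prod>i\<in>S. w i (x i)) * unit_root d (int s * ((\<Sum>i\<in>S. x i) - c)))
      = unit_root d (- int s * c) * F s"
      unfolding F sum_distrib_left[of "unit_root d (- int s * c)"] by (intro sum.cong refl) simp
  qed
  finally have P: "of_real P = (\<Sum>s<d. unit_root d (- int s * c) * F s) / of_nat d" .
  have F0: "F 0 = 1"
    unfolding F_def using w by (auto simp: balanced_weights_def simp flip: of_real_sum)
  have split: "{..<d} = insert 0 {1..<d}" using d0 by auto
  have "of_real (P - 1 / real d) = (\<Sum>s\<in>{1..<d}. unit_root d (- int s * c) * F s) / of_nat d"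
    unfolding of_real_diff P split by (simp add: F0 add_divide_distrib)
  then have "\<bar>P - 1 / real d\<bar> = norm (\<Sum>s\<in>{1..<d}. unit_root d (- int s * c) * F s) / real d"
    by (metis norm_of_real norm_divide norm_of_nat)
  also have "\<dots> \<le> (\<Sum>s\<in>{1..<d}. exp (- spectral_gap q * a * real (card S))) / real d"
  proof (intro divide_right_mono sum_norm_le)
    fix s assume s: "s \<in> {1..<d}"
    have "\<not> d dvd s" using s nat_dvd_not_less[of s d] by auto
    then have "\<not> int q dvd int (s * e)" unfolding d using e0 by simp
    then have "norm (F s) \<le> (\<Prod>i\<in>S. exp (- spectral_gap q * a))"
      unfolding F_def prod_norm[symmetric]
      by (intro prod_mono conjI norm_ge_zero fourier_coefficient_bound[OF w p q])
    also have "\<dots> = exp (- spectral_gap q * a * real (card S))"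
      by (simp add: exp_of_nat_mult[symmetric] mult_ac)
    finally show "norm (unit_root d (- int s * c) * F s) \<le> exp (- spectral_gap q * a * real (card S))"
      by (simp add: norm_mult)
  qed auto
  also have "\<dots> = (1 - 1 / real d) * exp (- spectral_gap q * a * real (card S))"
    using d0 by (simp add: field_simps of_nat_diff)
  finally show ?thesis unfolding P_def .
qed

section \<open>Random products in a finite abelian group\<close>

text \<open>
  The expectation of \<open>f (y \<otimes> \<Otimes>\<^sub>i g\<^sub>i\<^sup>x\<^sup>i)\<close> for independent exponents \<open>x\<^sub>i\<close> with weights \<open>w\<^sub>i\<close>. The starting point \<open>y\<close>
  is kept as an argument, so that walks over disjoint index sets compose as operators on functions.
\<close>

definition walk :: "('g, 'b) monoid_scheme \<Rightarrow> nat \<Rightarrow> 'i set \<Rightarrow> ('i \<Rightarrow> int \<Rightarrow> real) \<Rightarrow> ('i \<Rightarrow> 'g)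
    \<Rightarrow> ('g \<Rightarrow> real) \<Rightarrow> 'g \<Rightarrow> real" where
  "walk G q S w g f y = (\<Sum>x\<in>PiE S (\<lambda>_. {0..<int q}). (\<Prod>i\<in>S. w i (x i)) *
      f (y \<otimes>\<^bsub>G\<^esub> (\<Otimes>\<^bsub>G\<^esub>i\<in>S. g i [^]\<^bsub>G\<^esub> x i)))"

definition stoch :: "nat \<Rightarrow> 'i set \<Rightarrow> ('i \<Rightarrow> int \<Rightarrow> real) \<Rightarrow> bool" where
  "stoch q S w \<longleftrightarrow> (\<forall>i\<in>S. (\<forall>r\<in>{0..<int q}. w i r \<ge> 0) \<and> (\<Sum>r\<in>{0..<int q}. w i r) = 1)"

lemma stoch_subset: "stoch q S w \<Longrightarrow> T \<subseteq> S \<Longrightarrow> stoch q T w"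
  by (auto simp: stoch_def)

lemma stoch_nonneg: "stoch q S w \<Longrightarrow> x \<in> PiE S (\<lambda>_. {0..<int q}) \<Longrightarrow> (\<Prod>i\<in>S. w i (x i)) \<ge> 0"
  by (intro prod_nonneg) (auto simp: stoch_def PiE_iff)

lemma stoch_total:
  assumes "finite S" "stoch q S w"
  shows "(\<Sum>x\<in>PiE S (\<lambda>_. {0..<int q}). \<Prod>i\<in>S. w i (x i)) = 1"
  using assms by (subst prod_sum_PiE[symmetric]) (auto simp: stoch_def)

context comm_group
begin

lemma finprod_powers_closed [simp]:
  "(\<And>i. i \<in> S \<Longrightarrow> g i \<in> carrier G) \<Longrightarrow> (\<Otimes>i\<in>S. g i [^] (x i :: int)) \<in> carrier G"
  by (intro finprod_closed) auto

lemma walk_empty: "y \<in> carrier G \<Longrightarrow> walk G q {} w g f y = f y"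
  by (simp add: walk_def)

lemma walk_insert:
  assumes S: "finite S" "i \<notin> S" and g: "\<And>j. j \<in> insert i S \<Longrightarrow> g j \<in> carrier G" and y: "y \<in> carrier G"
  shows "walk G q (insert i S) w g f y
    = (\<Sum>r\<in>{0..<int q}. w i r * walk G q S w g f (y \<otimes> g i [^] r))"
proof -
  let ?R = "{0..<int q}" and ?X = "PiE S (\<lambda>_. {0..<int q})"
  let ?c = "\<lambda>(r, x). x(i := r)"
  have "walk G q (insert i S) w g f y = (\<Sum>x\<in>?c ` (?R \<times> ?X). (\<Prod>j\<in>insert i S. w j (x j)) *
      f (y \<otimes> (\<Otimes>j\<in>insert i S. g j [^] x j)))"
    unfolding walk_def by (subst PiE_insert_eq) simp
  also have "\<dots> = (\<Sum>(r, x)\<in>?R \<times> ?X. w i r * ((\<Prod>j\<in>S. w j (x j)) *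
      f (y \<otimes> g i [^] r \<otimes> (\<Otimes>j\<in>S. g j [^] x j))))"
  proof (subst sum.reindex)
    show "inj_on ?c (?R \<times> ?X)" using inj_combinator[OF S(2), of "\<lambda>_. ?R"] by simp
    show "sum ((\<lambda>x. (\<Prod>j\<in>insert i S. w j (x j)) * f (y \<otimes> (\<Otimes>j\<in>insert i S. g j [^] x j))) \<circ> ?c) (?R \<times> ?X)
      = (\<Sum>(r, x)\<in>?R \<times> ?X. w i r * ((\<Prod>j\<in>S. w j (x j)) * f (y \<otimes> g i [^] r \<otimes> (\<Otimes>j\<in>S. g j [^] x j))))"
    proof (rule sum.cong[OF refl], clarify)
      fix r x
      have 1: "(\<Prod>j\<in>S. w j ((x(i := r)) j)) = (\<Prod>j\<in>S. w j (x j))"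
        using S by (intro prod.cong) auto
      have 2: "(\<Otimes>j\<in>S. g j [^] ((x(i := r)) j)) = (\<Otimes>j\<in>S. g j [^] x j)"
        using S g by (intro finprod_cong') auto
      have 3: "(\<Otimes>j\<in>insert i S. g j [^] ((x(i := r)) j)) = g i [^] r \<otimes> (\<Otimes>j\<in>S. g j [^] x j)"
        using S g by (subst finprod_insert) (auto simp: 2[simplified])
      show "((\<lambda>x. (\<Prod>j\<in>insert i S. w j (x j)) * f (y \<otimes> (\<Otimes>j\<in>insert i S. g j [^] x j))) \<circ> ?c) (r, x)
        = w i r * ((\<Prod>j\<in>S. w j (x j)) * f (y \<otimes> g i [^] r \<otimes> (\<Otimes>j\<in>S. g j [^] x j)))"
        using S g y 1 3 by (simp add: m_assoc)
    qed
  qed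
  also have "\<dots> = (\<Sum>r\<in>?R. w i r * walk G q S w g f (y \<otimes> g i [^] r))"
    by (simp add: sum.cartesian_product[symmetric] walk_def sum_distrib_left)
  finally show ?thesis .
qed

lemma walk_union:
  assumes "finite S" "finite T" "S \<inter> T = {}" "\<And>j. j \<in> S \<union> T \<Longrightarrow> g j \<in> carrier G" "y \<in> carrier G"
  shows "walk G q (S \<union> T) w g f y = walk G q S w g (walk G q T w g f) y"
  using assms
proof (induction S arbitrary: y rule: finite_induct)
  case empty
  then show ?case by (simp add: walk_empty)
next
  case (insert i S)
  have "walk G q (insert i S \<union> T) w g f y = walk G q (insert i (S \<union> T)) w g f y" by simp
  also have "\<dots> = (\<Sum>r\<in>{0..<int q}. w i r * walk G q (S \<union> T) w g f (y \<otimes> g i [^] r))"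
    using insert.hyps insert.prems by (intro walk_insert) auto
  also have "\<dots> = (\<Sum>r\<in>{0..<int q}. w i r * walk G q S w g (walk G q T w g f) (y \<otimes> g i [^] r))"
    using insert.prems by (intro sum.cong refl arg_cong2[where f = "(*)"] insert.IH) auto
  also have "\<dots> = walk G q (insert i S) w g (walk G q T w g f) y"
    using insert.hyps insert.prems by (intro walk_insert[symmetric]) auto
  finally show ?case .
qed

lemma walk_mono:
  assumes "stoch q S w" "\<And>j. j \<in> S \<Longrightarrow> g j \<in> carrier G" "y \<in> carrier G"
    and "\<And>z. z \<in> carrier G \<Longrightarrow> f z \<le> h z"
  shows "walk G q S w g f y \<le> walk G q S w g h y"
  unfolding walk_def using assms by (intro sum_mono mult_left_mono stoch_nonneg) auto

lemma walk_const:
  assumes "finite S" "stoch q S w"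
  shows "walk G q S w g (\<lambda>_. c) y = c"
  unfolding walk_def sum_distrib_right[symmetric] using stoch_total[OF assms] by simp

lemma walk_cmult: "walk G q S w g (\<lambda>z. c * f z) y = c * walk G q S w g f y"
  unfolding walk_def sum_distrib_left by (intro sum.cong refl) simp

lemma walk_nonneg:
  assumes "finite S" "stoch q S w" "\<And>j. j \<in> S \<Longrightarrow> g j \<in> carrier G" "y \<in> carrier G"
    and "\<And>z. z \<in> carrier G \<Longrightarrow> f z \<ge> 0"
  shows "walk G q S w g f y \<ge> 0"
  using walk_mono[where f = "\<lambda>_. 0" and h = f, OF assms(2-4)] assms walk_const[OF assms(1,2)] by simp

lemma bij_betw_subgroup_translate:
  assumes B: "subgroup B G" and b: "b \<in> B"
  shows "bij_betw (\<lambda>x. x \<otimes> b) B B"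
  using subgroup.mem_carrier[OF B] subgroup.m_closed[OF B] subgroup.m_inv_closed[OF B] b
  by (intro bij_betw_byWitness[where f' = "\<lambda>x. x \<otimes> inv b"]) (auto simp: m_assoc)

lemma int_pow_in_subgroup: "subgroup B G \<Longrightarrow> b \<in> B \<Longrightarrow> b [^] (r::int) \<in> B"
  by (rule group.subgroup_int_pow_closed[OF is_group])

lemma mem_subgroup_of_coprime_powers:
  assumes M: "subgroup M G" and y: "y \<in> carrier G" "y [^] (m::nat) \<in> M" "y [^] (t::int) \<in> M"
    and mt: "coprime (int m) t"
  shows "y \<in> M"
proof -
  obtain u v where uv: "int m * u + t * v = 1"
    using mt by (metis bezout_int coprime_imp_gcd_eq_1 mult.commute)
  have "y = y [^] (int m * u + t * v)" using y uv by (simp add: int_pow_1)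
  also have "\<dots> = (y [^] int m) [^] u \<otimes> (y [^] t) [^] v" using y by (simp add: int_pow_mult int_pow_pow)
  also have "\<dots> \<in> M"
  proof (rule subgroup.m_closed[OF M])
    show "(y [^] int m) [^] u \<in> M" by (rule int_pow_in_subgroup[OF M]) (simp add: int_pow_int y)
    show "(y [^] t) [^] v \<in> M" by (rule int_pow_in_subgroup[OF M y(3)])
  qed
  finally show ?thesis .
qed

text \<open>
  A step in \<open>B\<close> permutes the coset of \<open>B\<close> over which the sum extends.
\<close>

lemma walk_coset_sum:
  assumes B: "subgroup B G" and "finite S" "stoch q S w" "\<And>j. j \<in> S \<Longrightarrow> g j \<in> B" "y \<in> carrier G"
  shows "(\<Sum>b\<in>B. walk G q S w g f (y \<otimes> b)) = (\<Sum>b\<in>B. f (y \<otimes> b))"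
  using assms(2-)
proof (induction S rule: finite_induct)
  case empty
  then show ?case using subgroup.mem_carrier[OF B] by (simp add: walk_empty)
next
  case (insert i S)
  have gi: "g i \<in> B" "\<And>j. j \<in> insert i S \<Longrightarrow> g j \<in> carrier G"
    using insert.prems subgroup.mem_carrier[OF B] by auto
  have Bc: "\<And>b. b \<in> B \<Longrightarrow> b \<in> carrier G" using subgroup.mem_carrier[OF B] .
  have "(\<Sum>b\<in>B. walk G q (insert i S) w g f (y \<otimes> b))
     = (\<Sum>b\<in>B. \<Sum>r\<in>{0..<int q}. w i r * walk G q S w g f (y \<otimes> b \<otimes> g i [^] r))"
    using insert.hyps insert.prems gi Bc by (intro sum.cong refl walk_insert) auto
  also have "\<dots> = (\<Sum>r\<in>{0..<int q}. w i r * (\<Sum>b\<in>B. walk G q S w g f (y \<otimes> (b \<otimes> g i [^] r))))"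
    unfolding sum_distrib_left using insert.prems gi Bc by (subst sum.swap) (simp add: m_assoc)
  also have "\<dots> = (\<Sum>r\<in>{0..<int q}. w i r * (\<Sum>b\<in>B. walk G q S w g f (y \<otimes> b)))"
    using bij_betw_subgroup_translate[OF B int_pow_in_subgroup[OF B gi(1)]]
    by (intro sum.cong refl arg_cong2[where f = "(*)"] sum.reindex_bij_betw[where g = "\<lambda>b. walk G q S w g f (y \<otimes> b)"])
  also have "\<dots> = (\<Sum>b\<in>B. walk G q S w g f (y \<otimes> b))"
    unfolding sum_distrib_right[symmetric] using insert.prems by (simp add: stoch_def)
  also have "\<dots> = (\<Sum>b\<in>B. f (y \<otimes> b))" using insert.prems by (intro insert.IH stoch_subset[OF insert.prems(1)]) auto
  finally show ?case .
qed

lemma finprod_const_base: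
  assumes "finite S" "h \<in> carrier G"
  shows "(\<Otimes>i\<in>S. h [^] (x i :: int)) = h [^] (\<Sum>i\<in>S. x i)"
  using assms(1)
proof (induction S rule: finite_induct)
  case (insert i S)
  then show ?case using assms(2) by (simp add: int_pow_mult)
qed simp

lemma int_pow_cong:
  assumes h: "h \<in> carrier G" "h [^] q = \<one>" and st: "int q dvd s - t"
  shows "h [^] (s :: int) = h [^] t"
proof -
  obtain u where u: "s = t + int q * u" using st by (metis add.commute diff_add_cancel dvdE)
  have "h [^] (int q * u) = (h [^] int q) [^] u" using h by (simp add: int_pow_pow)
  also have "h [^] int q = \<one>" using h by (simp add: int_pow_int)
  finally show ?thesis using h by (simp add: u int_pow_mult)
qed

lemma walk_one_direction:
  assumes S: "finite S" and g: "\<And>i. i \<in> S \<Longrightarrow> g i = h" and h: "h \<in> carrier G" "h [^] q = \<one>"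
    and q: "q > 0" and y: "y \<in> carrier G"
  shows "walk G q S w g f y = (\<Sum>t\<in>{0..<int q}.
     (\<Sum>x | x \<in> PiE S (\<lambda>_. {0..<int q}) \<and> int q dvd (\<Sum>i\<in>S. x i) - t. \<Prod>i\<in>S. w i (x i)) * f (y \<otimes> h [^] t))"
proof -
  let ?X = "PiE S (\<lambda>_. {0..<int q})"
  have fX: "finite ?X" using S by (intro finite_PiE) auto
  have gp: "(\<Otimes>i\<in>S. g i [^] (x i :: int)) = h [^] (\<Sum>i\<in>S. x i)" for x
    using finprod_const_base[OF S h(1), of x] g h(1) finprod_cong'[of S S "\<lambda>i. h [^] x i" "\<lambda>i. g i [^] x i"] by auto
  have "walk G q S w g f y = (\<Sum>x\<in>?X. (\<Prod>i\<in>S. w i (x i)) * f (y \<otimes> h [^] (\<Sum>i\<in>S. x i)))"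
    by (simp add: walk_def gp)
  also have "\<dots> = (\<Sum>t\<in>{0..<int q}. \<Sum>x | x \<in> ?X \<and> (\<Sum>i\<in>S. x i) mod int q = t.
       (\<Prod>i\<in>S. w i (x i)) * f (y \<otimes> h [^] (\<Sum>i\<in>S. x i)))"
    using q by (intro sum.group[symmetric] fX) auto
  also have "\<dots> = (\<Sum>t\<in>{0..<int q}. \<Sum>x | x \<in> ?X \<and> int q dvd (\<Sum>i\<in>S. x i) - t.
       (\<Prod>i\<in>S. w i (x i)) * f (y \<otimes> h [^] t))"
  proof (intro sum.cong refl)
    fix t assume t: "t \<in> {0..<int q}"
    show "{x. x \<in> ?X \<and> (\<Sum>i\<in>S. x i) mod int q = t} = {x. x \<in> ?X \<and> int q dvd (\<Sum>i\<in>S. x i) - t}"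
      using t by (auto simp: mod_eq_dvd_iff[symmetric])
    fix x assume "x \<in> {x. x \<in> ?X \<and> int q dvd (\<Sum>i\<in>S. x i) - t}"
    then have "h [^] (\<Sum>i\<in>S. x i) = h [^] t" by (intro int_pow_cong[OF h]) auto
    then show "(\<Prod>i\<in>S. w i (x i)) * f (y \<otimes> h [^] (\<Sum>i\<in>S. x i)) = (\<Prod>i\<in>S. w i (x i)) * f (y \<otimes> h [^] t)" by simp
  qed
  finally show ?thesis by (simp add: sum_distrib_right)
qed

abbreviation uwalk :: "nat \<Rightarrow> 'a set \<Rightarrow> ('a \<Rightarrow> real) \<Rightarrow> 'a \<Rightarrow> real" where
  "uwalk q J \<equiv> walk G q J (\<lambda>_ _. 1 / real q) (\<lambda>h. h)"

lemma uwalk_translate: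
  assumes J: "finite J" "J \<subseteq> carrier G" and h: "h \<in> J" "h [^] q = \<one>" and q: "q > 0" and y: "y \<in> carrier G"
  shows "uwalk q J f (y \<otimes> h) = uwalk q J f y"
proof -
  define K where "K = J - {h}"
  have JK: "J = insert h K" "h \<notin> K" "finite K" using J h by (auto simp: K_def)
  have hc: "h \<in> carrier G" using J h by auto
  define F where "F = uwalk q K f"
  have *: "uwalk q J f z = (\<Sum>t\<in>{0..<int q}. 1 / real q * F (z \<otimes> h [^] t))" if "z \<in> carrier G" for z
    unfolding JK(1) F_def using JK J that by (intro walk_insert) auto
  have "uwalk q J f (y \<otimes> h) = (\<Sum>t\<in>{0..<int q}. 1 / real q * F (y \<otimes> h \<otimes> h [^] t))"
    using y hc by (intro *) auto
  also have "\<dots> = (\<Sum>t\<in>{0..<int q}. (\<lambda>t. 1 / real q * F (y \<otimes> h [^] t)) ((t + 1) mod int q))"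
  proof (intro sum.cong refl)
    fix t
    have "h [^] ((t + 1) mod int q) = h [^] (t + 1)" by (intro int_pow_cong[OF hc h(2)]) (simp add: mod_eq_dvd_iff[symmetric])
    also have "\<dots> = h \<otimes> h [^] t" using hc int_pow_mult[of h 1 t] by (simp add: add.commute int_pow_1)
    finally show "1 / real q * F (y \<otimes> h \<otimes> h [^] t) = (\<lambda>t. 1 / real q * F (y \<otimes> h [^] t)) ((t + 1) mod int q)"
      using y hc by (simp add: m_assoc)
  qed
  also have "\<dots> = (\<Sum>t\<in>{0..<int q}. 1 / real q * F (y \<otimes> h [^] t))"
  proof (rule sum.reindex_bij_betw)
    show "bij_betw (\<lambda>t. (t + 1) mod int q) {0..<int q} {0..<int q}"
      using q by (intro bij_betw_byWitness[where f' = "\<lambda>t. (t - 1) mod int q"]) (auto simp: mod_simps)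
  qed
  also have "\<dots> = uwalk q J f y" using * y by simp
  finally show ?thesis .
qed

text \<open>
  A walk with uniform steps in each direction of \<open>J\<close> is invariant under translation by \<open>J\<close>, hence
  constant on the cosets of the subgroup that \<open>J\<close> generates; its coset averages are those of \<open>f\<close>. This
  replaces the characters of a general finite abelian group by those of a cyclic one.
\<close>

lemma uwalk_eq_average:
  assumes J: "finite J" "J \<subseteq> carrier G" and e: "\<And>h. h \<in> carrier G \<Longrightarrow> h [^] q = \<one>" and q: "q > 0"
    and y: "y \<in> carrier G" and fin: "finite (carrier G)"
  shows "uwalk q J f y = (\<Sum>b\<in>generate G J. f (y \<otimes> b)) / real (card (generate G J))"
proof -
  let ?B = "generate G J"
  have B: "subgroup ?B G" using J by (rule_tac generate_is_subgroup)
  have Bc: "\<And>b. b \<in> ?B \<Longrightarrow> b \<in> carrier G" using subgroup.mem_carrier[OF B] .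
  have inv: "\<forall>y\<in>carrier G. uwalk q J f (y \<otimes> b) = uwalk q J f y" if "b \<in> ?B" for b
    using that
  proof (induction b rule: generate.induct)
    case one
    then show ?case by simp
  next
    case (incl h)
    then show ?case using uwalk_translate[OF J _ e q] J by auto
  next
    case (inv h)
    then have hc: "h \<in> carrier G" using J by auto
    show ?case
    proof
      fix y assume y: "y \<in> carrier G"
      have "uwalk q J f (y \<otimes> inv h \<otimes> h) = uwalk q J f (y \<otimes> inv h)"
        using inv y hc by (intro uwalk_translate[OF J _ e q]) auto
      then show "uwalk q J f (y \<otimes> inv h) = uwalk q J f y" using y hc by (simp add: m_assoc)
    qed
  next
    case (eng h1 h2)
    have "h1 \<in> carrier G" "h2 \<in> carrier G" using eng(1,2) Bc by auto
    then show ?case using eng(3,4) by (auto simp: m_assoc[symmetric])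
  qed
  have st: "stoch q J (\<lambda>_ _. 1 / real q)" using q by (simp add: stoch_def)
  have "(\<Sum>b\<in>?B. uwalk q J f (y \<otimes> b)) = (\<Sum>b\<in>?B. f (y \<otimes> b))"
    using J y by (intro walk_coset_sum[OF B J(1) st]) (auto intro: generate.incl)
  also have "(\<Sum>b\<in>?B. uwalk q J f (y \<otimes> b)) = real (card ?B) * uwalk q J f y"
    using inv y by simp
  finally have "real (card ?B) * uwalk q J f y = (\<Sum>b\<in>?B. f (y \<otimes> b))" .
  moreover have "card ?B > 0"
    using B fin by (metis Bc card_gt_0_iff empty_iff finite_subset subgroup.one_closed subsetI)
  ultimately show ?thesis by (simp add: field_simps)
qed

end

lemma balanced_weights_stoch: "(\<And>i. i \<in> S \<Longrightarrow> balanced_weights p q a (w i)) \<Longrightarrow> stoch q S w"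
  by (auto simp: stoch_def balanced_weights_def)

text \<open>
  A finite abelian group of exponent dividing \<open>q = p\<^sup>k\<close>: only the exponents modulo \<open>q\<close> of a product of
  powers matter.
\<close>

locale finite_p_exponent_group = comm_group G for G (structure) +
  fixes p k q :: nat
  assumes fin: "finite (carrier G)"
    and p: "Factorial_Ring.prime p" and k: "k > 0" and q: "q = p ^ k"
    and e: "\<And>h. h \<in> carrier G \<Longrightarrow> h [^] q = \<one>"
begin

lemma q_pos: "q > 0" using p q by (simp add: prime_gt_0_nat)

lemma walk_one_direction_bounds:
  assumes S: "finite S" and g: "\<And>i. i \<in> S \<Longrightarrow> g i = h" and h: "h \<in> carrier G"
    and w: "\<And>i. i \<in> S \<Longrightarrow> balanced_weights p q a (w i)"
    and f: "\<And>z. z \<in> carrier G \<Longrightarrow> f z \<ge> 0" and y: "y \<in> carrier G"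
    and eta: "exp (- spectral_gap q * a * real (card S)) \<le> \<eta>"
  shows "walk G q S w g f y \<le> (1 + real q * \<eta>) * uwalk q {h} f y"
    and "walk G q S w g f y \<ge> (1 - real q * \<eta>) * uwalk q {h} f y"
proof -
  define c where "c t = (\<Sum>x | x \<in> PiE S (\<lambda>_. {0..<int q}) \<and> int q dvd (\<Sum>i\<in>S. x i) - t. \<Prod>i\<in>S. w i (x i))" for t
  have c: "\<bar>c t - 1 / real q\<bar> \<le> \<eta>" for t
  proof -
    have "\<bar>c t - 1 / real q\<bar> \<le> (1 - 1 / real q) * exp (- spectral_gap q * a * real (card S))"
      unfolding c_def by (rule residue_equidistribution[OF S p q _ w, where e = 1]) auto
    also have "\<dots> \<le> 1 * exp (- spectral_gap q * a * real (card S))" by (intro mult_right_mono) auto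
    finally show ?thesis using eta by simp
  qed
  have W: "walk G q S w g f y = (\<Sum>t\<in>{0..<int q}. c t * f (y \<otimes> h [^] t))"
    unfolding c_def by (rule walk_one_direction[OF S g h e[OF h] q_pos y])
  have U: "uwalk q {h} f y = (\<Sum>t\<in>{0..<int q}. 1 / real q * f (y \<otimes> h [^] t))"
  proof -
    have "uwalk q {h} f y = (\<Sum>t\<in>{0..<int q}. 1 / real q * uwalk q {} f (y \<otimes> h [^] t))"
      using h y by (intro walk_insert) auto
    then show ?thesis using h y by (simp add: walk_empty)
  qed
  have q0: "real q > 0" using q_pos by simp
  show "walk G q S w g f y \<le> (1 + real q * \<eta>) * uwalk q {h} f y"
    unfolding W U sum_distrib_left mult.assoc[symmetric]
  proof (intro sum_mono mult_right_mono)
    fix t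
    have "c t \<le> 1 / real q + \<eta>" using c[of t] by linarith
    then show "c t \<le> (1 + real q * \<eta>) * (1 / real q)" using q0 by (simp add: field_simps)
  qed (use f h y in auto)
  show "walk G q S w g f y \<ge> (1 - real q * \<eta>) * uwalk q {h} f y"
    unfolding W U sum_distrib_left mult.assoc[symmetric]
  proof (intro sum_mono mult_right_mono)
    fix t
    have "c t \<ge> 1 / real q - \<eta>" using c[of t] by linarith
    then show "c t \<ge> (1 - real q * \<eta>) * (1 / real q)" using q0 by (simp add: field_simps)
  qed (use f h y in auto)
qed

text \<open>
  If a direction occurs often enough, the sum of its exponents is uniform modulo \<open>q\<close> up to the factor
  \<open>1 \<plusminus> q \<eta>\<close>. For nonnegative \<open>f\<close> such multiplicative errors pass through the other directions unchanged, so
  one factor per direction is lost.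
\<close>

lemma walk_many_directions_bounds:
  assumes J: "finite J" "J \<subseteq> carrier G"
    and S: "\<And>h. h \<in> J \<Longrightarrow> finite (S h)" and g: "\<And>h i. h \<in> J \<Longrightarrow> i \<in> S h \<Longrightarrow> g i = h"
    and w: "\<And>h i. h \<in> J \<Longrightarrow> i \<in> S h \<Longrightarrow> balanced_weights p q a (w i)"
    and f: "\<And>z. z \<in> carrier G \<Longrightarrow> f z \<ge> 0" and y: "y \<in> carrier G"
    and eta: "\<And>h. h \<in> J \<Longrightarrow> exp (- spectral_gap q * a * real (card (S h))) \<le> \<eta>"
    and eta0: "0 \<le> \<eta>" "real q * \<eta> \<le> 1"
  shows "walk G q (\<Union>h\<in>J. S h) w g f y \<le> (1 + real q * \<eta>) ^ card J * uwalk q J f y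
     \<and> (1 - real q * \<eta>) ^ card J * uwalk q J f y \<le> walk G q (\<Union>h\<in>J. S h) w g f y"
  using J S g w y eta
proof (induction J arbitrary: y rule: finite_induct)
  case empty
  then show ?case by (simp add: walk_empty)
next
  case (insert h J)
  let ?U = "\<Union>h\<in>J. S h"
  have hc: "h \<in> carrier G" using insert.prems by simp
  have gc: "g i \<in> carrier G" if "i \<in> S h \<union> ?U" for i
    using that insert.prems(1) insert.prems(3) by fastforce
  have "walk G q ?U w g f z \<le> (1 + real q * \<eta>) ^ card J * uwalk q J f z \<and>
     (1 - real q * \<eta>) ^ card J * uwalk q J f z \<le> walk G q ?U w g f z" if z: "z \<in> carrier G" for z
  proof (rule insert.IH)
    fix h' i assume "h' \<in> J" "i \<in> S h'"
    then show "balanced_weights p q a (w i)" using insert.prems(4)[of h' i] by simp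
  qed (use insert.prems(1-3,5-) z in auto)
  then have IH: "walk G q ?U w g f z \<le> (1 + real q * \<eta>) ^ card J * uwalk q J f z"
     "(1 - real q * \<eta>) ^ card J * uwalk q J f z \<le> walk G q ?U w g f z" if "z \<in> carrier G" for z
    using that by auto
  have stU: "stoch q ?U w"
    using insert.prems(4) by (intro balanced_weights_stoch) auto
  have st1: "stoch q K (\<lambda>_ _. 1 / real q)" for K using q_pos by (simp add: stoch_def)
  have split: "walk G q (\<Union>h\<in>insert h J. S h) w g f y = walk G q (S h) w g (walk G q ?U w g f) y"
  proof -
    have "walk G q (S h \<union> ?U) w g f y = walk G q (S h) w g (walk G q ?U w g f) y"
    proof (rule walk_union)
      show "S h \<inter> ?U = {}" using insert.prems(3) insert.hyps(2) by (auto; metis)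
    qed (use insert gc in auto)
    then show ?thesis by simp
  qed
  have usplit: "uwalk q (insert h J) f z = uwalk q {h} (uwalk q J f) z" if "z \<in> carrier G" for z
  proof -
    have "uwalk q ({h} \<union> J) f z = uwalk q {h} (uwalk q J f) z"
      using insert that by (intro walk_union) auto
    then show ?thesis by simp
  qed
  have nn: "walk G q ?U w g f z \<ge> 0" if "z \<in> carrier G" for z
    using insert gc that f by (intro walk_nonneg stU) auto
  have unn: "uwalk q K f z \<ge> 0" if "z \<in> carrier G" "finite K" "K \<subseteq> carrier G" for z K
    using that f by (intro walk_nonneg st1) auto
  have wh: "balanced_weights p q a (w i)" if "i \<in> S h" for i
    using insert.prems(4)[of h i] that by simp
  have *: "walk G q (S h) w g (walk G q ?U w g f) y \<le> (1 + real q * \<eta>) * uwalk q {h} (walk G q ?U w g f) y"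
    by (rule walk_one_direction_bounds(1)[OF _ _ hc wh nn insert.prems(5)]) (use insert.prems in auto)
  have **: "walk G q (S h) w g (walk G q ?U w g f) y \<ge> (1 - real q * \<eta>) * uwalk q {h} (walk G q ?U w g f) y"
    by (rule walk_one_direction_bounds(2)[OF _ _ hc wh nn insert.prems(5)]) (use insert.prems in auto)
  have 1: "uwalk q {h} (walk G q ?U w g f) y \<le> (1 + real q * \<eta>) ^ card J * uwalk q (insert h J) f y"
  proof -
    have "uwalk q {h} (walk G q ?U w g f) y \<le> uwalk q {h} (\<lambda>z. (1 + real q * \<eta>) ^ card J * uwalk q J f z) y"
      using hc insert.prems(5) IH by (intro walk_mono st1) auto
    then show ?thesis by (simp only: walk_cmult usplit[OF insert.prems(5)])
  qed
  have 2: "(1 - real q * \<eta>) ^ card J * uwalk q (insert h J) f y \<le> uwalk q {h} (walk G q ?U w g f) y"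
  proof -
    have "uwalk q {h} (\<lambda>z. (1 - real q * \<eta>) ^ card J * uwalk q J f z) y \<le> uwalk q {h} (walk G q ?U w g f) y"
      using hc insert.prems(5) IH by (intro walk_mono st1) auto
    then show ?thesis by (simp only: walk_cmult usplit[OF insert.prems(5)])
  qed
  have cJ: "card (insert h J) = Suc (card J)" using insert.hyps by simp
  show ?case
  proof
    have "(1 + real q * \<eta>) * uwalk q {h} (walk G q ?U w g f) y
        \<le> (1 + real q * \<eta>) * ((1 + real q * \<eta>) ^ card J * uwalk q (insert h J) f y)"
      using eta0 by (intro mult_left_mono 1) auto
    then show "walk G q (\<Union>h\<in>insert h J. S h) w g f y \<le> (1 + real q * \<eta>) ^ card (insert h J) * uwalk q (insert h J) f y"
      using * unfolding split cJ by (simp add: mult.assoc)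
    have "(1 - real q * \<eta>) * ((1 - real q * \<eta>) ^ card J * uwalk q (insert h J) f y)
       \<le> (1 - real q * \<eta>) * uwalk q {h} (walk G q ?U w g f) y"
      using eta0 by (intro mult_left_mono 2) auto
    then show "(1 - real q * \<eta>) ^ card (insert h J) * uwalk q (insert h J) f y \<le> walk G q (\<Union>h\<in>insert h J. S h) w g f y"
      using ** unfolding split cJ by (simp add: mult.assoc)
  qed
qed

lemma heavy_walk_bounds:
  assumes I: "finite I" and gI: "\<And>i. i \<in> I \<Longrightarrow> g i \<in> carrier G"
    and w: "\<And>i. i \<in> I \<Longrightarrow> balanced_weights p q a (w i)"
    and J: "J \<subseteq> carrier G"
    and eta: "\<And>h. h \<in> J \<Longrightarrow> exp (- spectral_gap q * a * real (card {i\<in>I. g i = h})) \<le> \<eta>"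
    and eta0: "0 \<le> \<eta>" "real q * \<eta> \<le> 1"
    and f: "\<And>z. z \<in> carrier G \<Longrightarrow> f z \<ge> 0"
    and up: "\<And>z. z \<in> carrier G \<Longrightarrow> (\<Sum>b\<in>generate G J. f (z \<otimes> b)) \<le> U"
    and y: "y \<in> carrier G"
  shows "walk G q I w g f y \<le> (1 + real q * \<eta>) ^ card J * (U / real (card (generate G J)))"
    and "(\<And>z. z \<in> carrier G \<Longrightarrow> L \<le> (\<Sum>b\<in>generate G J. f (z \<otimes> b))) \<Longrightarrow>
      (1 - real q * \<eta>) ^ card J * (L / real (card (generate G J))) \<le> walk G q I w g f y"
proof -
  define S where "S = (\<Union>h\<in>J. {i\<in>I. g i = h})"
  have fJ: "finite J" using J fin finite_subset by blast
  have split: "I = (I - S) \<union> S" by (auto simp: S_def)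
  have fS: "finite S" by (rule finite_subset[OF _ I]) (auto simp: S_def)
  have st: "stoch q (I - S) w" using w by (intro balanced_weights_stoch) auto
  have W: "walk G q I w g f y = walk G q (I - S) w g (walk G q S w g f) y"
    by (subst split, rule walk_union) (use I fS gI y split in auto)
  have B: "walk G q S w g f z \<le> (1 + real q * \<eta>) ^ card J * uwalk q J f z
     \<and> (1 - real q * \<eta>) ^ card J * uwalk q J f z \<le> walk G q S w g f z" if "z \<in> carrier G" for z
    unfolding S_def by (rule walk_many_directions_bounds[OF fJ J]) (use I w f eta eta0 that in auto)
  have A: "uwalk q J f z = (\<Sum>b\<in>generate G J. f (z \<otimes> b)) / real (card (generate G J))" if "z \<in> carrier G" for z
    by (rule uwalk_eq_average[OF fJ J e q_pos that fin])
  have "walk G q (I - S) w g (walk G q S w g f) y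
     \<le> walk G q (I - S) w g (\<lambda>_. (1 + real q * \<eta>) ^ card J * (U / real (card (generate G J)))) y"
  proof (rule walk_mono[OF st])
    fix z assume z: "z \<in> carrier G"
    have "uwalk q J f z \<le> U / real (card (generate G J))"
      unfolding A[OF z] by (intro divide_right_mono up z) auto
    then have "(1 + real q * \<eta>) ^ card J * uwalk q J f z \<le> (1 + real q * \<eta>) ^ card J * (U / real (card (generate G J)))"
      using eta0 by (intro mult_left_mono) auto
    then show "walk G q S w g f z \<le> (1 + real q * \<eta>) ^ card J * (U / real (card (generate G J)))"
      using B[OF z] by linarith
  qed (use gI y in auto)
  then show "walk G q I w g f y \<le> (1 + real q * \<eta>) ^ card J * (U / real (card (generate G J)))"
    unfolding W using walk_const[OF _ st] I by simp
  assume lo: "\<And>z. z \<in> carrier G \<Longrightarrow> L \<le> (\<Sum>b\<in>generate G J. f (z \<otimes> b))"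
  have "walk G q (I - S) w g (\<lambda>_. (1 - real q * \<eta>) ^ card J * (L / real (card (generate G J)))) y
     \<le> walk G q (I - S) w g (walk G q S w g f) y"
  proof (rule walk_mono[OF st])
    fix z assume z: "z \<in> carrier G"
    have "uwalk q J f z \<ge> L / real (card (generate G J))"
      unfolding A[OF z] by (intro divide_right_mono lo z) auto
    then have "(1 - real q * \<eta>) ^ card J * uwalk q J f z \<ge> (1 - real q * \<eta>) ^ card J * (L / real (card (generate G J)))"
      using eta0 by (intro mult_left_mono) auto
    then show "walk G q S w g f z \<ge> (1 - real q * \<eta>) ^ card J * (L / real (card (generate G J)))"
      using B[OF z] by linarith
  qed (use gI y in auto)
  then show "(1 - real q * \<eta>) ^ card J * (L / real (card (generate G J))) \<le> walk G q I w g f y"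
    unfolding W using walk_const[OF _ st] I by simp
qed

text \<open>
  The probability that the random product of powers of the \<open>g\<^sub>i\<close> is trivial.
\<close>

definition hit :: "'i set \<Rightarrow> ('i \<Rightarrow> int \<Rightarrow> real) \<Rightarrow> ('i \<Rightarrow> 'a) \<Rightarrow> real" where
  "hit I w g = walk G q I w g (\<lambda>z. if z = \<one> then 1 else 0) \<one>"

lemma generate_facts:
  assumes "J \<subseteq> carrier G"
  shows "subgroup (generate G J) G" "finite (generate G J)" "card (generate G J) > 0"
    "generate G J \<subseteq> carrier G"
proof -
  show s: "subgroup (generate G J) G" using assms by (rule generate_is_subgroup)
  then show c: "generate G J \<subseteq> carrier G" by (rule subgroup.subset)
  then show f: "finite (generate G J)" using fin finite_subset by blast
  show "card (generate G J) > 0" using f subgroup.one_closed[OF s] by (auto simp: card_gt_0_iff)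
qed

lemma sum_delta_coset:
  assumes B: "subgroup B G" and z: "z \<in> carrier G"
  shows "(\<Sum>b\<in>B. if z \<otimes> b = \<one> then 1 else 0 :: real) = (if z \<in> B then 1 else 0)"
proof -
  have fB: "finite B" using subgroup.subset[OF B] fin finite_subset by blast
  have iff: "z \<otimes> b = \<one> \<longleftrightarrow> b = inv z" if "b \<in> B" for b
    using subgroup.mem_carrier[OF B that] z inv_equality[of b z] by (auto simp: m_comm[of z b])
  have zi: "z \<in> B \<longleftrightarrow> inv z \<in> B"
    using z subgroup.m_inv_closed[OF B, of z] subgroup.m_inv_closed[OF B, of "inv z"] by auto
  have "(\<Sum>b\<in>B. if z \<otimes> b = \<one> then 1 else 0 :: real) = (\<Sum>b\<in>B. if inv z = b then 1 else 0)"
    by (intro sum.cong refl) (auto simp: iff)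
  then show ?thesis using zi fB by (simp add: sum.delta)
qed

lemma hit_good_bounds:
  assumes I: "finite I" and gI: "\<And>i. i \<in> I \<Longrightarrow> g i \<in> carrier G"
    and w: "\<And>i. i \<in> I \<Longrightarrow> balanced_weights p q a (w i)"
    and J: "J \<subseteq> carrier G" "generate G J = carrier G"
    and eta: "\<And>h. h \<in> J \<Longrightarrow> exp (- spectral_gap q * a * real (card {i\<in>I. g i = h})) \<le> \<eta>"
    and eta0: "0 \<le> \<eta>" "real q * \<eta> \<le> 1"
  shows "hit I w g \<le> (1 + real q * \<eta>) ^ card J / real (order G)"
    and "hit I w g \<ge> (1 - real q * \<eta>) ^ card J / real (order G)"
proof -
  have s: "(\<Sum>b\<in>generate G J. if z \<otimes> b = \<one> then 1 else 0 :: real) = 1" if "z \<in> carrier G" for z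
    using sum_delta_coset[OF generate_facts(1)[OF J(1)] that] that J(2) by simp
  show "hit I w g \<le> (1 + real q * \<eta>) ^ card J / real (order G)"
    using heavy_walk_bounds(1)[where f = "\<lambda>z. if z = \<one> then 1 else 0" and U = 1 and y = \<one>, OF I gI w J(1) eta eta0] s
    by (auto simp: hit_def order_def J(2))
  show "hit I w g \<ge> (1 - real q * \<eta>) ^ card J / real (order G)"
    using heavy_walk_bounds(2)[where f = "\<lambda>z. if z = \<one> then 1 else 0" and U = 1 and y = \<one> and L = 1, OF I gI w J(1) eta eta0] s
    by (auto simp: hit_def order_def J(2))
qed

text \<open>
  To be trivial, the product must first be brought into \<open>B\<close> by the factors outside \<open>B\<close>; given these, the
  factors inside \<open>B\<close> are nearly uniform on \<open>B\<close> and hit the one required element with probability close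
  to \<open>1 / card B\<close>.
\<close>

lemma hit_bad_bound:
  assumes I: "finite I" and gI: "\<And>i. i \<in> I \<Longrightarrow> g i \<in> carrier G"
    and w: "\<And>i. i \<in> I \<Longrightarrow> balanced_weights p q a (w i)"
    and J: "J \<subseteq> carrier G" and B: "B = generate G J"
    and eta: "\<And>h. h \<in> J \<Longrightarrow> exp (- spectral_gap q * a * real (card {i\<in>I. g i = h})) \<le> \<eta>"
    and eta0: "0 \<le> \<eta>" "real q * \<eta> \<le> 1"
  shows "hit I w g \<le> (1 + real q * \<eta>) ^ card J / real (card B)
     * walk G q {i\<in>I. g i \<notin> B} w g (\<lambda>z. if z \<in> B then 1 else 0) \<one>"
proof -
  let ?d = "\<lambda>z. if z = \<one> then 1 else 0 :: real"
  let ?c = "(1 + real q * \<eta>) ^ card J / real (card B)"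
  define O' where "O' = {i\<in>I. g i \<notin> B}"
  define I' where "I' = {i\<in>I. g i \<in> B}"
  have BG: "subgroup B G" unfolding B using J by (rule generate_facts)
  have split: "I = O' \<union> I'" "O' \<inter> I' = {}" "finite O'" "finite I'" using I by (auto simp: O'_def I'_def)
  have JB: "h \<in> B" if "h \<in> J" for h using that unfolding B by (rule generate.incl)
  have cI': "{i\<in>I'. g i = h} = {i\<in>I. g i = h}" if "h \<in> J" for h
    using JB[OF that] by (auto simp: I'_def)
  have "hit I w g = walk G q O' w g (walk G q I' w g ?d) \<one>"
    unfolding hit_def by (subst split(1), rule walk_union) (use split gI in auto)
  also have "\<dots> \<le> walk G q O' w g (\<lambda>z. ?c * (if z \<in> B then 1 else 0)) \<one>"
  proof (rule walk_mono)
    show "stoch q O' w" using w by (intro balanced_weights_stoch) (auto simp: O'_def)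
    fix z assume z: "z \<in> carrier G"
    show "walk G q I' w g ?d z \<le> ?c * (if z \<in> B then 1 else 0)"
    proof (cases "z \<in> B")
      case True
      have "walk G q I' w g ?d z \<le> (1 + real q * \<eta>) ^ card J * (1 / real (card (generate G J)))"
      proof (rule heavy_walk_bounds(1)[OF split(4) _ _ J _ eta0])
        fix z assume "z \<in> carrier G"
        show "(\<Sum>b\<in>generate G J. if z \<otimes> b = \<one> then 1 else 0 :: real) \<le> 1"
          using sum_delta_coset[OF generate_facts(1)[OF J] \<open>z \<in> carrier G\<close>] by simp
      qed (use z w gI cI' eta in \<open>auto simp: I'_def\<close>)
      then show ?thesis using True by (simp add: B)
    next
      case False
      have "walk G q I' w g ?d z = 0"
        unfolding walk_def
      proof (intro sum.neutral ballI)
        fix x :: "'c \<Rightarrow> int"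
        have "(\<Otimes>i\<in>I'. g i [^] x i) \<in> B"
        proof -
          have "\<forall>i\<in>I'. g i [^] x i \<in> B" by (auto simp: I'_def intro: int_pow_in_subgroup[OF BG])
          with split(4) show ?thesis
          proof (induction I' rule: finite_induct)
            case empty
            then show ?case using subgroup.one_closed[OF BG] by simp
          next
            case (insert i F)
            then have "(\<Otimes>i\<in>insert i F. g i [^] x i) = g i [^] x i \<otimes> (\<Otimes>i\<in>F. g i [^] x i)"
              by (intro finprod_insert) (auto intro: subgroup.mem_carrier[OF BG])
            then show ?case using insert subgroup.m_closed[OF BG] by simp
          qed
        qed
        then have "z \<otimes> (\<Otimes>i\<in>I'. g i [^] x i) \<noteq> \<one>"
          using False z inv_equality[of z "\<Otimes>i\<in>I'. g i [^] x i"] subgroup.mem_carrier[OF BG]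
            subgroup.m_inv_closed[OF BG] by auto
        then show "(\<Prod>i\<in>I'. w i (x i)) * ?d (z \<otimes> (\<Otimes>i\<in>I'. g i [^] x i)) = 0" by simp
      qed
      then show ?thesis using False by simp
    qed
  qed (use gI in \<open>auto simp: O'_def\<close>)
  finally show ?thesis by (simp only: walk_cmult O'_def)
qed

lemma pow_in_subgroup_imp_dvd:
  assumes B: "subgroup B G" and h: "h \<in> carrier G" "h \<notin> B" and t: "h [^] (t::int) \<in> B"
  shows "int p dvd t"
proof (rule ccontr)
  assume "\<not> int p dvd t"
  then have "coprime (int q) t" unfolding q of_nat_power
    using p by (intro coprime_power_left_iff[THEN iffD2] disjI1 prime_imp_coprime) auto
  moreover have "h [^] q \<in> B" using e[OF h(1)] subgroup.one_closed[OF B] by simp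
  ultimately show False using mem_subgroup_of_coprime_powers[OF B h(1) _ t] h(2) by blast
qed

text \<open>
  By pigeonhole some \<open>h\<close> outside \<open>B\<close> occurs at least \<open>card O' / order G\<close> times among the factors. When all
  other factors are fixed, membership in \<open>B\<close> determines the exponent sum of \<open>h\<close> modulo \<open>p\<close>, because
  \<open>h\<^sup>t \<in> B\<close> implies that \<open>p\<close> divides \<open>t\<close>. Equidistribution modulo \<open>p\<close> bounds the probability of one residue.
\<close>

lemma walk_avoid_subgroup_bound:
  assumes O: "finite O'" "O' \<noteq> {}" and g: "\<And>i. i \<in> O' \<Longrightarrow> g i \<in> carrier G" "\<And>i. i \<in> O' \<Longrightarrow> g i \<notin> B"
    and w: "\<And>i. i \<in> O' \<Longrightarrow> balanced_weights p q a (w i)"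
    and B: "subgroup B G" and a: "a \<ge> 0"
  shows "walk G q O' w g (\<lambda>z. if z \<in> B then 1 else 0) \<one>
    \<le> exp (- (min (spectral_gap q / real (order G)) 1 / 4) * min (a * real (card O')) 1)"
proof -
  let ?f = "\<lambda>z. if z \<in> B then 1 else 0 :: real"
  have N: "real (order G) > 0" using fin by (simp add: order_gt_0_iff_finite)
  have "\<exists>h\<in>carrier G. real (card O') / real (order G) \<le> real (card {i\<in>O'. g i = h})"
  proof (rule ccontr)
    assume "\<not> ?thesis"
    then have lt: "\<And>h. h \<in> carrier G \<Longrightarrow> real (card {i\<in>O'. g i = h}) < real (card O') / real (order G)" by force
    have "real (card O') = (\<Sum>h\<in>carrier G. real (card {i\<in>O'. g i = h}))"
    proof -
      have "g ` O' \<subseteq> carrier G" using g by auto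
      from sum.group[OF O(1) fin this, of "\<lambda>_. 1::real"] show ?thesis by simp
    qed
    also have "\<dots> < (\<Sum>h\<in>carrier G. real (card O') / real (order G))"
      using fin lt by (intro sum_strict_mono) auto
    also have "\<dots> = real (card O')" using N by (simp add: order_def)
    finally show False by simp
  qed
  then obtain h where h: "h \<in> carrier G" and hc: "real (card O') / real (order G) \<le> real (card {i\<in>O'. g i = h})" by blast
  define S where "S = {i\<in>O'. g i = h}"
  have "card O' > 0" using O by (simp add: card_gt_0_iff)
  then have "0 < real (card O') / real (order G)" using N by simp
  then have "0 < real (card S)" using hc unfolding S_def by linarith
  then have "card S > 0" by simp
  then have hB: "h \<notin> B" using g(2) by (auto simp: S_def card_gt_0_iff)
  have fS: "finite S" using O by (simp add: S_def)
  let ?E = "1 / real p + (1 - 1 / real p) * exp (- spectral_gap q * a * real (card S))"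
  have p1: "p \<ge> 2" using p by (rule prime_ge_2_nat)
  have E0: "?E \<ge> 0" using p1 by auto
  have qp: "q = p * p ^ (k - 1)" using q k by (cases k) auto
  have wS: "balanced_weights p q a (w i)" if "i \<in> S" for i using that w by (auto simp: S_def)
  have stS: "stoch q S w" using wS by (rule balanced_weights_stoch)
  have le: "walk G q S w g ?f z \<le> ?E" if z: "z \<in> carrier G" for z
  proof -
    let ?X = "PiE S (\<lambda>_. {0..<int q})"
    have fX: "finite ?X" using fS by (intro finite_PiE) auto
    have gp: "(\<Otimes>i\<in>S. g i [^] (x i :: int)) = h [^] (\<Sum>i\<in>S. x i)" for x
      using finprod_const_base[OF fS h, of x] h finprod_cong'[of S S "\<lambda>i. h [^] x i" "\<lambda>i. g i [^] x i"]
      by (auto simp: S_def)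
    have W: "walk G q S w g ?f z = (\<Sum>x\<in>?X. (\<Prod>i\<in>S. w i (x i)) * ?f (z \<otimes> h [^] (\<Sum>i\<in>S. x i)))"
      by (simp add: walk_def gp)
    show ?thesis
    proof (cases "\<exists>c::int. z \<otimes> h [^] c \<in> B")
      case False
      then have "walk G q S w g ?f z = 0" unfolding W by (intro sum.neutral) auto
      then show ?thesis using E0 by simp
    next
      case True
      then obtain c :: int where c: "z \<otimes> h [^] c \<in> B" by blast
      have dv: "int p dvd s - c" if s: "z \<otimes> h [^] s \<in> B" for s :: int
      proof (rule pow_in_subgroup_imp_dvd[OF B h hB])
        have "h [^] (s - c) = inv (z \<otimes> h [^] c) \<otimes> (z \<otimes> h [^] s)"
        proof -
          have hs: "h [^] s \<in> carrier G" "h [^] c \<in> carrier G" using h by auto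
          have "inv (z \<otimes> h [^] c) \<otimes> (z \<otimes> h [^] s) = inv (h [^] c) \<otimes> (inv z \<otimes> (z \<otimes> h [^] s))"
            using z hs by (simp add: inv_mult_group m_assoc)
          also have "inv z \<otimes> (z \<otimes> h [^] s) = h [^] s"
            using z hs by (simp add: m_assoc[symmetric])
          also have "inv (h [^] c) \<otimes> h [^] s = h [^] (s - c)" using z h
            by (simp add: int_pow_neg[symmetric] int_pow_mult[symmetric] add.commute)
          finally show ?thesis by simp
        qed
        then show "h [^] (s - c) \<in> B" using c s subgroup.m_closed[OF B] subgroup.m_inv_closed[OF B] by simp
      qed
      have "walk G q S w g ?f z \<le> (\<Sum>x\<in>?X. if int p dvd (\<Sum>i\<in>S. x i) - c then \<Prod>i\<in>S. w i (x i) else 0)"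
        unfolding W using stoch_nonneg[OF stS] dv by (intro sum_mono) auto
      also have "\<dots> = (\<Sum>x | x \<in> ?X \<and> int p dvd (\<Sum>i\<in>S. x i) - c. \<Prod>i\<in>S. w i (x i))"
        using fX by (simp add: sum.inter_filter)
      also have "\<dots> \<le> ?E"
        using residue_equidistribution[where c = c and w = w, OF fS p q qp wS] by linarith
      finally show ?thesis .
    qed
  qed
  have split: "O' = (O' - S) \<union> S" by (auto simp: S_def)
  have stO: "stoch q (O' - S) w" using w by (intro balanced_weights_stoch) auto
  have "walk G q O' w g ?f \<one> = walk G q (O' - S) w g (walk G q S w g ?f) \<one>"
    by (subst split, rule walk_union) (use O fS g split in auto)
  also have "\<dots> \<le> walk G q (O' - S) w g (\<lambda>_. ?E) \<one>"
    using g le by (intro walk_mono stO) auto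
  also have "\<dots> = ?E" using O stO by (intro walk_const) auto
  also have "?E \<le> exp (- min (spectral_gap q * a * real (card S)) 1 / 4)"
  proof -
    define x where "x = spectral_gap q * a * real (card S)"
    have x0: "x \<ge> 0" using spectral_gap_pos[of q] a by (simp add: x_def)
    \<comment> \<open>\<open>1 - exp (- x)\<close> is comparable to \<open>min x 1\<close>\<close>
    have e1: "min x 1 / 2 \<le> 1 - exp (- x)"
    proof -
      define m where "m = min x 1"
      have m: "0 \<le> m" "m \<le> 1" "m \<le> x" using x0 by (auto simp: m_def)
      have "1 + m \<le> exp m" by (rule exp_ge_add_one_self)
      then have "exp (- m) \<le> 1 / (1 + m)" using m by (simp add: exp_minus field_simps)
      also have "\<dots> \<le> 1 - m / 2"
      proof -
        have "m * m \<le> 1 * m" using m by (intro mult_right_mono) auto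
        then have "1 \<le> (1 - m / 2) * (1 + m)" by (simp add: algebra_simps)
        then show ?thesis using m by (simp add: field_simps)
      qed
      finally have "exp (- m) \<le> 1 - m / 2" .
      moreover have "exp (- x) \<le> exp (- m)" using m by simp
      ultimately show ?thesis unfolding m_def[symmetric] by linarith
    qed
    have "1 / real p \<le> 1 / 2" using p1 by simp
    then have "(1/2) * (1 - exp (- x)) \<le> (1 - 1 / real p) * (1 - exp (- x))"
      using x0 by (intro mult_right_mono) auto
    then have "1 / real p + (1 - 1 / real p) * exp (- x) \<le> 1 - (1/2) * (1 - exp (- x))"
      by (simp add: algebra_simps)
    also have "\<dots> \<le> 1 + (- min x 1 / 4)" using e1 by simp
    also have "\<dots> \<le> exp (- min x 1 / 4)" by (rule exp_ge_add_one_self)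
    finally show ?thesis by (simp add: x_def)
  qed
  also have "\<dots> \<le> exp (- (min (spectral_gap q / real (order G)) 1 / 4) * min (a * real (card O')) 1)"
  proof -
    define s where "s = min (spectral_gap q / real (order G)) 1"
    have s: "0 \<le> s" "s \<le> 1" "s \<le> spectral_gap q / real (order G)"
      using spectral_gap_pos[of q] N by (auto simp: s_def)
    define y where "y = a * real (card O')"
    have y: "y \<ge> 0" using a by (simp add: y_def)
    have "s * y \<le> spectral_gap q / real (order G) * y" using s y by (intro mult_right_mono) auto
    also have "\<dots> = spectral_gap q * a * (real (card O') / real (order G))" by (simp add: y_def)
    also have "\<dots> \<le> spectral_gap q * a * real (card S)"
      using hc a spectral_gap_pos[of q] unfolding S_def by (intro mult_left_mono) auto
    finally have 1: "s * y \<le> spectral_gap q * a * real (card S)" .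
    have "s * min y 1 \<le> s * y" "s * min y 1 \<le> s * 1" using s by (intro mult_left_mono; simp)+
    then have "s * min y 1 \<le> min (spectral_gap q * a * real (card S)) 1" using 1 s by linarith
    then show ?thesis by (simp add: s_def y_def)
  qed
  finally show ?thesis .
qed

end

section \<open>Universality for the generating tuples of one group\<close>

lemma prod_one_minus_ge:
  fixes x :: "'i \<Rightarrow> real"
  assumes "finite S" "\<And>i. i \<in> S \<Longrightarrow> 0 \<le> x i \<and> x i \<le> 1"
  shows "1 - (\<Sum>i\<in>S. x i) \<le> (\<Prod>i\<in>S. 1 - x i)"
  using assms
proof (induction S rule: finite_induct)
  case (insert i S)
  have P: "(\<Prod>i\<in>S. 1 - x i) \<le> 1" using insert.prems by (intro prod_le_1) auto
  have "x i * (\<Prod>i\<in>S. 1 - x i) \<le> x i * 1" using insert.prems P by (intro mult_left_mono) auto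
  moreover have "1 - (\<Sum>i\<in>S. x i) \<le> (\<Prod>i\<in>S. 1 - x i)" using insert by auto
  ultimately show ?case using insert.hyps by (simp add: algebra_simps)
qed simp

lemma sum_subsets_by_card:
  assumes "finite A"
  shows "(\<Sum>U | U \<subseteq> A \<and> P (card U). f (card U)) = (\<Sum>m | m \<le> card A \<and> P m. real (card A choose m) * (f m :: real))"
proof -
  let ?D = "{U. U \<subseteq> A \<and> P (card U)}" and ?M = "{m. m \<le> card A \<and> P m}"
  have fD: "finite ?D" using assms by simp
  have "(\<Sum>U\<in>?D. f (card U)) = (\<Sum>m\<in>?M. \<Sum>U | U \<in> ?D \<and> card U = m. f (card U))"
    using assms by (intro sum.group[symmetric] fD) (auto intro: card_mono)
  also have "\<dots> = (\<Sum>m\<in>?M. real (card A choose m) * f m)"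
  proof (rule sum.cong[OF refl])
    fix m assume m: "m \<in> ?M"
    then have "{U. U \<in> ?D \<and> card U = m} = {U. U \<subseteq> A \<and> card U = m}" by auto
    then show "(\<Sum>U | U \<in> ?D \<and> card U = m. f (card U)) = real (card A choose m) * f m"
      using n_subsets[OF assms, of m] by simp
  qed
  finally show ?thesis .
qed

context finite_p_exponent_group
begin

text \<open>
  These tuples correspond to the surjections onto \<open>G\<close> from a free module of rank \<open>n\<close>.
\<close>

definition gens :: "nat \<Rightarrow> (nat \<Rightarrow> 'a) set" where
  "gens n = {g \<in> PiE {1..n} (\<lambda>_. carrier G). generate G (g ` {1..n}) = carrier G}"

lemma finite_gens: "finite (gens n)"
  unfolding gens_def using fin by (intro finite_subset[OF _ finite_PiE[of "{1..n}" "\<lambda>_. carrier G"]]) auto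

lemma card_gens_le: "card (gens n) \<le> order G ^ n"
proof -
  have "card (gens n) \<le> card (PiE {1..n} (\<lambda>_. carrier G))"
    unfolding gens_def using fin by (intro card_mono finite_PiE) auto
  also have "\<dots> = order G ^ n" by (simp add: card_PiE order_def)
  finally show ?thesis .
qed

text \<open>
  A tuple is judged by the elements that occur in a positive proportion of its positions. If these
  generate the group the tuple is good; otherwise they generate a proper subgroup, and the few
  positions with an entry outside that subgroup are collected in \<open>off\<close>.
\<close>

definition heavy :: "real \<Rightarrow> nat \<Rightarrow> (nat \<Rightarrow> 'a) \<Rightarrow> 'a set" where
  "heavy t n g = {h \<in> carrier G. real (card {i\<in>{1..n}. g i = h}) \<ge> t * real n}"

definition off :: "real \<Rightarrow> nat \<Rightarrow> (nat \<Rightarrow> 'a) \<Rightarrow> nat set" where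
  "off t n g = {i\<in>{1..n}. g i \<notin> generate G (heavy t n g)}"

definition bad :: "real \<Rightarrow> nat \<Rightarrow> (nat \<Rightarrow> 'a) set" where
  "bad t n = {g \<in> gens n. generate G (heavy t n g) \<noteq> carrier G}"

lemma order_pos: "real (order G) \<ge> 1"
  using fin by (metis order_gt_0_iff_finite Suc_leI of_nat_1 of_nat_mono One_nat_def)

lemma heavy_sub: "heavy t n g \<subseteq> carrier G" by (auto simp: heavy_def)

lemma off_nonempty:
  assumes "g \<in> bad t n" shows "off t n g \<noteq> {}"
proof
  assume *: "off t n g = {}"
  let ?B = "generate G (heavy t n g)"
  have "g ` {1..n} \<subseteq> ?B" using * by (auto simp: off_def)
  then have "generate G (g ` {1..n}) \<subseteq> ?B"
    by (intro generate_subgroup_incl generate_facts heavy_sub)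
  then show False using assms generate_facts(4)[OF heavy_sub, of t n g] by (auto simp: bad_def gens_def)
qed

lemma card_off_le:
  assumes "g \<in> gens n" and t: "t \<ge> 0"
  shows "real (card (off t n g)) \<le> t * real (order G) * real n"
proof -
  let ?L = "carrier G - heavy t n g"
  have "off t n g \<subseteq> (\<Union>h\<in>?L. {i\<in>{1..n}. g i = h})"
    using assms by (auto simp: off_def gens_def PiE_iff intro: generate.incl)
  then have "card (off t n g) \<le> card (\<Union>h\<in>?L. {i\<in>{1..n}. g i = h})"
    by (rule card_mono[rotated]) (use fin in auto)
  also have "\<dots> \<le> (\<Sum>h\<in>?L. card {i\<in>{1..n}. g i = h})"
    using fin by (intro card_UN_le) auto
  finally have "real (card (off t n g)) \<le> real (\<Sum>h\<in>?L. card {i\<in>{1..n}. g i = h})" by (rule of_nat_mono)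
  also have "\<dots> \<le> (\<Sum>h\<in>?L. t * real n)"
    unfolding of_nat_sum by (intro sum_mono) (auto simp: heavy_def)
  also have "\<dots> \<le> (\<Sum>h\<in>carrier G. t * real n)"
    using fin t by (intro sum_mono2) auto
  finally show ?thesis by (simp add: order_def mult_ac)
qed

text \<open>
  Bad tuples are grouped by the proper subgroup \<open>B\<close> and by the set of positions outside \<open>B\<close>. For a given
  pair there are at most \<open>order G ^ m * card B ^ n\<close> tuples, where \<open>m\<close> is the number of those positions, and at
  most \<open>2 ^ order G\<close> subgroups.
\<close>

lemma sum_bad_le:
  fixes F :: "'a set \<Rightarrow> nat \<Rightarrow> real"
  assumes t: "t \<ge> 0" and phi: "\<And>m. 1 \<le> m \<Longrightarrow> \<phi> m \<ge> 0" and F0: "\<And>B m. F B m \<ge> 0"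
    and F: "\<And>B m. subgroup B G \<Longrightarrow> B \<noteq> carrier G \<Longrightarrow> 1 \<le> m \<Longrightarrow> real (card B) ^ n * F B m \<le> \<phi> m"
  shows "(\<Sum>g\<in>bad t n. F (generate G (heavy t n g)) (card (off t n g)))
    \<le> 2 ^ order G * (\<Sum>m | 1 \<le> m \<and> real m \<le> t * real (order G) * real n. real (n choose m) * (real (order G) ^ m * \<phi> m))"
proof -
  let ?N = "order G"
  let ?P = "Pow (carrier G)"
  let ?Q = "{U. U \<subseteq> {1..n} \<and> (1 \<le> card U \<and> real (card U) \<le> t * real ?N * real n)}"
  let ?k = "\<lambda>g. (generate G (heavy t n g), off t n g)"
  have fb: "finite (bad t n)" unfolding bad_def using finite_gens by simp
  have fP: "finite (?P \<times> ?Q)" using fin by simp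
  have im: "?k ` bad t n \<subseteq> ?P \<times> ?Q"
  proof
    fix z assume "z \<in> ?k ` bad t n"
    then obtain g where g: "g \<in> bad t n" "z = ?k g" by blast
    have "finite (off t n g)" by (simp add: off_def)
    then have "card (off t n g) \<ge> 1" using off_nonempty[OF g(1)] by (simp add: Suc_le_eq card_gt_0_iff)
    then show "z \<in> ?P \<times> ?Q"
      using g card_off_le[of g n t] t generate_facts(4)[OF heavy_sub, of t n g] by (auto simp: bad_def off_def)
  qed
  have "(\<Sum>g\<in>bad t n. F (generate G (heavy t n g)) (card (off t n g)))
     = (\<Sum>z\<in>?P \<times> ?Q. \<Sum>g | g \<in> bad t n \<and> ?k g = z. F (generate G (heavy t n g)) (card (off t n g)))"
    by (rule sum.group[OF fb fP im, symmetric])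
  also have "\<dots> \<le> (\<Sum>z\<in>?P \<times> ?Q. real ?N ^ card (snd z) * \<phi> (card (snd z)))"
  proof (rule sum_mono)
    fix z assume z: "z \<in> ?P \<times> ?Q"
    obtain B U where BU: "z = (B, U)" by fastforce
    have U: "U \<subseteq> {1..n}" "1 \<le> card U" and BG: "B \<subseteq> carrier G" using z BU by auto
    have fU: "finite U" using U finite_subset by blast
    have fB: "finite B" using BG fin finite_subset by blast
    show "(\<Sum>g | g \<in> bad t n \<and> ?k g = z. F (generate G (heavy t n g)) (card (off t n g)))
      \<le> real ?N ^ card (snd z) * \<phi> (card (snd z))"
    proof (cases "subgroup B G \<and> B \<noteq> carrier G")
      case False
      then have none: "{g. g \<in> bad t n \<and> ?k g = z} = {}"
        using BU generate_facts(1)[OF heavy_sub] by (auto simp: bad_def)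
      have "0 \<le> real ?N ^ card (snd z) * \<phi> (card (snd z))" using phi U BU by simp
      then show ?thesis unfolding none by simp
    next
      case True
      have B1: "card B \<ge> 1" using True fB subgroup.one_closed[of B G] by (auto simp: Suc_le_eq card_gt_0_iff)
      have "card {g. g \<in> bad t n \<and> ?k g = z} \<le> card (PiE {1..n} (\<lambda>i. if i \<in> U then carrier G else B))"
      proof (rule card_mono)
        show "finite (PiE {1..n} (\<lambda>i. if i \<in> U then carrier G else B))"
          using fin fB by (intro finite_PiE) auto
        show "{g. g \<in> bad t n \<and> ?k g = z} \<subseteq> PiE {1..n} (\<lambda>i. if i \<in> U then carrier G else B)"
        proof
          fix g assume "g \<in> {g. g \<in> bad t n \<and> ?k g = z}"
          then have g: "g \<in> PiE {1..n} (\<lambda>_. carrier G)" "B = generate G (heavy t n g)" "U = off t n g"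
            using BU by (auto simp: bad_def gens_def)
          show "g \<in> PiE {1..n} (\<lambda>i. if i \<in> U then carrier G else B)"
          proof (rule PiE_I)
            fix i assume i: "i \<in> {1..n}"
            show "g i \<in> (if i \<in> U then carrier G else B)"
              using PiE_mem[OF g(1) i] i unfolding g(2,3) off_def by simp
          qed (rule PiE_arb[OF g(1)])
        qed
      qed
      also have "\<dots> = (\<Prod>i\<in>{1..n}. if i \<in> U then ?N else card B)"
        by (simp add: card_PiE order_def if_distrib cong: if_cong)
      also have "\<dots> = ?N ^ card U * card B ^ card ({1..n} - U)"
      proof -
        have "{1..n} \<inter> {i. i \<in> U} = U" "{1..n} \<inter> - {i. i \<in> U} = {1..n} - U" using U by auto
        note * = this
        have "(\<Prod>i\<in>{1..n}. if i \<in> U then ?N else card B)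
          = prod (\<lambda>_. ?N) ({1..n} \<inter> {i. i \<in> U}) * prod (\<lambda>_. card B) ({1..n} \<inter> - {i. i \<in> U})"
          by (rule prod.If_cases) simp
        then show ?thesis by (simp only: * prod_constant)
      qed
      also have "\<dots> \<le> ?N ^ card U * card B ^ n"
        using B1 card_mono[of "{1..n}" "{1..n} - U"] by (intro mult_left_mono power_increasing) auto
      finally have c: "card {g. g \<in> bad t n \<and> ?k g = z} \<le> ?N ^ card U * card B ^ n" .
      have "(\<Sum>g | g \<in> bad t n \<and> ?k g = z. F (generate G (heavy t n g)) (card (off t n g)))
         = real (card {g. g \<in> bad t n \<and> ?k g = z}) * F B (card U)"
        unfolding BU by simp
      also have "\<dots> \<le> real (?N ^ card U * card B ^ n) * F B (card U)"
        using F0 c by (intro mult_right_mono of_nat_mono) auto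
      also have "\<dots> = real ?N ^ card U * (real (card B) ^ n * F B (card U))" by simp
      also have "\<dots> \<le> real ?N ^ card U * \<phi> (card U)"
        using True U by (intro mult_left_mono F) auto
      finally show ?thesis by (simp add: BU)
    qed
  qed
  also have "\<dots> = (\<Sum>B\<in>?P. \<Sum>U\<in>?Q. real ?N ^ card U * \<phi> (card U))"
    unfolding sum.cartesian_product case_prod_unfold by (rule refl)
  also have "\<dots> = 2 ^ ?N * (\<Sum>U\<in>?Q. real ?N ^ card U * \<phi> (card U))"
    using fin by (simp add: card_Pow order_def)
  also have "(\<Sum>U\<in>?Q. real ?N ^ card U * \<phi> (card U))
     = (\<Sum>m | m \<le> n \<and> 1 \<le> m \<and> real m \<le> t * real ?N * real n. real (n choose m) * (real ?N ^ m * \<phi> m))"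
    using sum_subsets_by_card[where A = "{1..n}" and P = "\<lambda>m. 1 \<le> m \<and> real m \<le> t * real ?N * real n"
      and f = "\<lambda>m. real ?N ^ m * \<phi> m"] by simp
  also have "\<dots> = (\<Sum>m | 1 \<le> m \<and> real m \<le> t * real ?N * real n. real (n choose m) * (real ?N ^ m * \<phi> m))"
  proof (rule sum.mono_neutral_left)
    show "finite {m. 1 \<le> m \<and> real m \<le> t * real ?N * real n}"
      by (rule finite_subset[of _ "{..nat \<lfloor>t * real ?N * real n\<rfloor>}"]) (auto simp: le_nat_floor)
  qed auto
  finally show ?thesis by simp
qed


lemma card_proper_subgroup_le:
  assumes "subgroup B G" "B \<noteq> carrier G"
  shows "2 * card B \<le> order G"
proof -
  have fB: "finite B" using subgroup.subset[OF assms(1)] fin finite_subset by blast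
  have L: "card (rcosets B) * card B = order G" using lagrange[OF assms(1)] .
  have "order G > 0" using order_pos by simp
  then have "card (rcosets B) \<noteq> 0" using L by (intro notI) simp
  moreover have "card (rcosets B) \<noteq> 1"
  proof
    assume "card (rcosets B) = 1"
    then have "card B = card (carrier G)" using L by (simp add: order_def)
    then show False using card_subset_eq[OF fin subgroup.subset[OF assms(1)]] assms(2) by blast
  qed
  ultimately have "card (rcosets B) \<ge> 2" by linarith
  then have "2 * card B \<le> card (rcosets B) * card B" by (intro mult_le_mono1)
  then show ?thesis using L by simp
qed

lemma hit_nonneg:
  assumes "finite I" "\<And>i. i \<in> I \<Longrightarrow> g i \<in> carrier G" "\<And>i. i \<in> I \<Longrightarrow> balanced_weights p q a (w i)"
  shows "hit I w g \<ge> 0"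
  unfolding hit_def
  by (rule walk_nonneg[OF assms(1) balanced_weights_stoch[OF assms(3)] assms(2)]) auto

text \<open>
  The universality statement for one group. For a good tuple every column is annihilated with
  probability \<open>(1 / order G) (1 + O(\<eta>\<^sub>j))\<close>, and the errors \<open>\<eta>\<^sub>j\<close> have a sum tending to \<open>0\<close>; there are at most
  \<open>order G ^ n\<close> good tuples. For the bad tuples both numbers in the difference have negligible sum: the
  product of probabilities by the bound for walks that must enter \<open>B\<close>, the constant because
  \<open>card B \<le> order G / 2\<close>. Both cases end in the same sum over small supports, once for the given \<open>a\<close> and
  once for \<open>a = 1\<close>.
\<close>

theorem hit_l1_tendsto_0:
  fixes a :: "nat \<Rightarrow> nat \<Rightarrow> real" and w :: "nat \<Rightarrow> nat \<Rightarrow> nat \<Rightarrow> int \<Rightarrow> real"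
  assumes a0: "\<And>n j. n \<ge> 1 \<Longrightarrow> j \<in> {1..n+u} \<Longrightarrow> a n j \<ge> 0"
    and lim: "\<And>\<epsilon>::real. \<epsilon> > 0 \<Longrightarrow> (\<lambda>n. \<Sum>j=1..n+u. exp (- \<epsilon> * a n j * real n)) \<longlonglongrightarrow> 0"
    and w: "\<And>n j i. n \<ge> 1 \<Longrightarrow> j \<in> {1..n+u} \<Longrightarrow> i \<in> {1..n} \<Longrightarrow> balanced_weights p q (a n j) (w n j i)"
  shows "(\<lambda>n. \<Sum>g\<in>gens n. \<bar>(\<Prod>j=1..n+u. hit {1..n} (w n j) g) - 1 / real (order G) ^ (n+u)\<bar>) \<longlonglongrightarrow> 0"
proof -
  define N where "N = real (order G)"
  have N1: "N \<ge> 1" using order_pos by (simp add: N_def)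
  define \<kappa> where "\<kappa> = min (spectral_gap q / N) 1 / 4"
  have \<kappa>: "0 < \<kappa>" "\<kappa> \<le> 1/4" using spectral_gap_pos[of q] N1 by (auto simp: \<kappa>_def)
  obtain \<delta> where \<delta>: "\<delta> > 0" and sm: "\<forall>a :: nat \<Rightarrow> nat \<Rightarrow> real.
     (\<forall>n\<ge>1. \<forall>j\<in>{1..n+u}. a n j \<ge> 0) \<longrightarrow>
     (\<lambda>n. \<Sum>j=1..n+u. exp (- \<kappa> * a n j * real n)) \<longlonglongrightarrow> 0 \<longrightarrow>
     (\<lambda>n. \<Sum>m | 1 \<le> m \<and> real m \<le> \<delta> * real n.
        real (n choose m) * N ^ m * exp (- \<kappa> * (\<Sum>j=1..n+u. min (a n j * real m) 1))) \<longlonglongrightarrow> 0"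
    using small_support_sum_tendsto_0[OF \<kappa>(1) less_le_trans[OF zero_less_one N1], of u] by blast
  note small = mp[OF mp[OF spec[OF sm]]]
  \<comment> \<open>at most \<open>N\<close> elements are light, so at most \<open>\<delta> n\<close> positions carry a light element\<close>
  define t where "t = \<delta> / N"
  have t: "t > 0" using \<delta> N1 by (simp add: t_def)
  have tN: "t * N = \<delta>" using N1 by (simp add: t_def)
  define \<eta> where "\<eta> n j = exp (- (spectral_gap q * t) * a n j * real n)" for n j
  define E where "E n = (\<Sum>j=1..n+u. \<eta> n j)" for n
  have Elim: "E \<longlonglongrightarrow> 0"
    unfolding E_def[abs_def] \<eta>_def by (rule lim) (use t spectral_gap_pos[of q] in simp)
  have \<eta>0: "\<eta> n j \<ge> 0" for n j by (simp add: \<eta>_def)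
  have \<eta>E: "\<eta> n j \<le> E n" if "j \<in> {1..n+u}" for n j
    unfolding E_def using \<eta>0 that by (intro member_le_sum) auto
  have heavy_eta: "exp (- spectral_gap q * a n j * real (card {i\<in>{1..n}. g i = h})) \<le> \<eta> n j"
    if "n \<ge> 1" "j \<in> {1..n+u}" "h \<in> heavy t n g" for n j g h
  proof -
    have "spectral_gap q * a n j * (t * real n) \<le> spectral_gap q * a n j * real (card {i\<in>{1..n}. g i = h})"
      using that a0[of n j] spectral_gap_pos[of q] by (intro mult_left_mono) (auto simp: heavy_def)
    then show ?thesis by (simp add: \<eta>_def mult_ac)
  qed
  define S where "S a n = (\<Sum>m | 1 \<le> m \<and> real m \<le> \<delta> * real n.
        real (n choose m) * N ^ m * exp (- \<kappa> * (\<Sum>j=1..n+u. min (a n j * real m) 1)))" for a :: "nat \<Rightarrow> nat \<Rightarrow> real" and n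
  have S1: "S a \<longlonglongrightarrow> 0" unfolding S_def[abs_def] using a0 \<kappa> by (intro small lim) auto
  have S2: "S (\<lambda>_ _. 1) \<longlonglongrightarrow> 0" unfolding S_def[abs_def]
  proof (rule small)
    have "(\<lambda>n. (real n + real u) * exp (- \<kappa> * real n)) \<longlonglongrightarrow> 0"
      using \<kappa>(1) by real_asymp
    then show "(\<lambda>n. \<Sum>j=1..n+u. exp (- \<kappa> * 1 * real n)) \<longlonglongrightarrow> 0" by simp
  qed auto
  have cardJ: "card (heavy t n g) \<le> order G" for n g
    unfolding order_def using fin heavy_sub by (intro card_mono)
  have pow_le: "(1 + real q * \<eta> n j) ^ card (heavy t n g) \<le> exp (N * real q * \<eta> n j)" for n j g
  proof -
    have "(1 + real q * \<eta> n j) ^ card (heavy t n g) \<le> (1 + real q * \<eta> n j) ^ order G"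
      using \<eta>0 cardJ by (intro power_increasing) auto
    also have "\<dots> \<le> exp (real q * \<eta> n j) ^ order G"
      using \<eta>0 by (intro power_mono) (auto simp: exp_ge_add_one_self add_increasing)
    also have "\<dots> = exp (N * real q * \<eta> n j)" by (simp add: exp_of_nat_mult[symmetric] N_def mult_ac)
    finally show ?thesis .
  qed
  have main: "(\<Sum>g\<in>gens n. \<bar>(\<Prod>j=1..n+u. hit {1..n} (w n j) g) - 1 / N ^ (n+u)\<bar>)
      \<le> (exp (N * real q * E n) - 1) + exp (N * real q * E n) * (2 ^ order G * S a n) + 2 ^ order G * (exp (\<kappa> * real u) * S (\<lambda>_ _. 1) n)"
    if n: "n \<ge> 1" and small_E: "N * real q * E n \<le> 1" for n
  proof -
    let ?H = "\<lambda>g. \<Prod>j=1..n+u. hit {1..n} (w n j) g"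
    let ?J = "{1..n+u}"
    have E0: "E n \<ge> 0" unfolding E_def using \<eta>0 by (intro sum_nonneg) auto
    have qE: "real q * \<eta> n j \<le> 1" and NqE: "N * real q * \<eta> n j \<le> 1" if "j \<in> ?J" for j
    proof -
      have "N * real q * \<eta> n j \<le> N * real q * E n" using \<eta>E[OF that] N1 by (intro mult_left_mono) auto
      then show 2: "N * real q * \<eta> n j \<le> 1" using small_E by simp
      have "1 * (real q * \<eta> n j) \<le> N * (real q * \<eta> n j)" using N1 \<eta>0 by (intro mult_right_mono) auto
      then show "real q * \<eta> n j \<le> 1" using 2 by (simp add: mult.assoc)
    qed
    have gc: "g i \<in> carrier G" if "g \<in> gens n" "i \<in> {1..n}" for g i
      using that by (auto simp: gens_def)
    have hit0: "hit {1..n} (w n j) g \<ge> 0" if "g \<in> gens n" "j \<in> ?J" for g j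
      using gc[OF that(1)] w[OF n that(2)] by (intro hit_nonneg) auto
    have good: "\<bar>?H g - 1 / N ^ (n+u)\<bar> \<le> (exp (N * real q * E n) - 1) / N ^ (n+u)"
      if g: "g \<in> gens n - bad t n" for g
    proof -
      have gg: "g \<in> gens n" "generate G (heavy t n g) = carrier G" using g by (auto simp: bad_def)
      have up: "hit {1..n} (w n j) g \<le> exp (N * real q * \<eta> n j) / N"
        and lo: "hit {1..n} (w n j) g \<ge> (1 - N * real q * \<eta> n j) / N" if j: "j \<in> ?J" for j
      proof -
        have "hit {1..n} (w n j) g \<le> (1 + real q * \<eta> n j) ^ card (heavy t n g) / N"
          unfolding N_def using gc[OF gg(1)] w[OF n j] heavy_eta[OF n j] \<eta>0 qE[OF j] heavy_sub gg(2)
          by (intro hit_good_bounds(1)) auto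
        also have "\<dots> \<le> exp (N * real q * \<eta> n j) / N"
          using N1 by (intro divide_right_mono pow_le) auto
        finally show "hit {1..n} (w n j) g \<le> exp (N * real q * \<eta> n j) / N" .
        have "1 - N * real q * \<eta> n j \<le> 1 + real (card (heavy t n g)) * (- (real q * \<eta> n j))"
        proof -
          have "real (card (heavy t n g)) * (real q * \<eta> n j) \<le> N * (real q * \<eta> n j)"
            using cardJ \<eta>0 unfolding N_def by (intro mult_right_mono) auto
          then show ?thesis by simp
        qed
        also have "\<dots> \<le> (1 + (- (real q * \<eta> n j))) ^ card (heavy t n g)"
          using qE[OF j] by (intro Bernoulli_inequality) auto
        finally have "(1 - N * real q * \<eta> n j) / N \<le> (1 - real q * \<eta> n j) ^ card (heavy t n g) / N"
          using N1 by (intro divide_right_mono) auto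
        also have "\<dots> \<le> hit {1..n} (w n j) g"
          unfolding N_def using gc[OF gg(1)] w[OF n j] heavy_eta[OF n j] \<eta>0 qE[OF j] heavy_sub gg(2)
          by (intro hit_good_bounds(2)) auto
        finally show "hit {1..n} (w n j) g \<ge> (1 - N * real q * \<eta> n j) / N" .
      qed
      have "?H g \<le> (\<Prod>j\<in>?J. exp (N * real q * \<eta> n j) / N)"
        using up hit0[OF gg(1)] by (intro prod_mono) auto
      also have "\<dots> = exp (N * real q * E n) / N ^ (n+u)"
        by (simp add: prod_dividef exp_sum[symmetric] E_def sum_distrib_left)
      finally have U: "?H g \<le> exp (N * real q * E n) / N ^ (n+u)" .
      have "(1 - N * real q * E n) / N ^ (n+u) \<le> (\<Prod>j\<in>?J. 1 - N * real q * \<eta> n j) / N ^ (n+u)"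
      proof (intro divide_right_mono)
        have "1 - (\<Sum>j\<in>?J. N * real q * \<eta> n j) \<le> (\<Prod>j\<in>?J. 1 - N * real q * \<eta> n j)"
          using NqE \<eta>0 N1 by (intro prod_one_minus_ge) auto
        then show "1 - N * real q * E n \<le> (\<Prod>j\<in>?J. 1 - N * real q * \<eta> n j)"
          by (simp add: E_def sum_distrib_left)
      qed (use N1 in auto)
      also have "\<dots> = (\<Prod>j\<in>?J. (1 - N * real q * \<eta> n j) / N)" by (simp add: prod_dividef)
      also have "\<dots> \<le> ?H g"
        using lo NqE N1 by (intro prod_mono) auto
      finally have L: "(1 - N * real q * E n) / N ^ (n+u) \<le> ?H g" .
      have "1 - (exp (N * real q * E n) - 1) \<le> 1 - N * real q * E n"
        using exp_ge_add_one_self[of "N * real q * E n"] by linarith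
      then have "(1 - (exp (N * real q * E n) - 1)) / N ^ (n+u) \<le> (1 - N * real q * E n) / N ^ (n+u)"
        by (rule divide_right_mono) (use N1 in simp)
      moreover have "(1 - (exp (N * real q * E n) - 1)) / N ^ (n+u) = 1 / N ^ (n+u) - (exp (N * real q * E n) - 1) / N ^ (n+u)"
        by (rule diff_divide_distrib)
      moreover have "(exp (N * real q * E n) - 1) / N ^ (n+u) = exp (N * real q * E n) / N ^ (n+u) - 1 / N ^ (n+u)"
        by (rule diff_divide_distrib)
      ultimately show ?thesis using U L unfolding abs_le_iff by linarith
    qed
    have "(\<Sum>g\<in>gens n - bad t n. \<bar>?H g - 1 / N ^ (n+u)\<bar>)
       \<le> (\<Sum>g\<in>gens n - bad t n. (exp (N * real q * E n) - 1) / N ^ (n+u))"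
      by (intro sum_mono good)
    also have "\<dots> = real (card (gens n - bad t n)) * ((exp (N * real q * E n) - 1) / N ^ (n+u))" by simp
    also have "\<dots> \<le> N ^ (n + u) * ((exp (N * real q * E n) - 1) / N ^ (n+u))"
    proof (rule mult_right_mono)
      have "real (card (gens n - bad t n)) \<le> real (card (gens n))"
        using finite_gens by (intro of_nat_mono card_mono) auto
      also have "\<dots> \<le> real (order G ^ n)" by (intro of_nat_mono card_gens_le)
      also have "\<dots> = N ^ n" by (simp add: N_def)
      also have "\<dots> \<le> N ^ (n + u)" using N1 by (intro power_increasing) auto
      finally show "real (card (gens n - bad t n)) \<le> N ^ (n + u)" .
      show "0 \<le> (exp (N * real q * E n) - 1) / N ^ (n+u)"
        using N1 E0 by (intro divide_nonneg_nonneg) auto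
    qed
    also have "\<dots> = exp (N * real q * E n) - 1" using N1 by simp
    finally have G: "(\<Sum>g\<in>gens n - bad t n. \<bar>?H g - 1 / N ^ (n+u)\<bar>) \<le> exp (N * real q * E n) - 1" .

    define F where "F B m = exp (N * real q * E n) * (exp (- \<kappa> * (\<Sum>j=1..n+u. min (a n j * real m) 1)) / real (card B) ^ (n+u))"
      for B :: "'a set" and m :: nat
    have "?H g \<le> F (generate G (heavy t n g)) (card (off t n g))" if g: "g \<in> bad t n" for g
    proof -
      let ?B = "generate G (heavy t n g)"
      have gg: "g \<in> gens n" using g by (simp add: bad_def)
      have "?H g \<le> (\<Prod>j\<in>?J. exp (N * real q * \<eta> n j) / real (card ?B) * exp (- \<kappa> * min (a n j * real (card (off t n g))) 1))"
      proof (intro prod_mono conjI hit0[OF gg])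
        fix j assume j: "j \<in> ?J"
        have "hit {1..n} (w n j) g \<le> (1 + real q * \<eta> n j) ^ card (heavy t n g) / real (card ?B)
           * walk G q {i\<in>{1..n}. g i \<notin> ?B} (w n j) g (\<lambda>z. if z \<in> ?B then 1 else 0) \<one>"
          by (rule hit_bad_bound[OF _ gc[OF gg] w[OF n j] heavy_sub refl heavy_eta[OF n j] \<eta>0 qE[OF j]]) simp_all
        also have "\<dots> \<le> exp (N * real q * \<eta> n j) / real (card ?B) * exp (- \<kappa> * min (a n j * real (card (off t n g))) 1)"
        proof (intro mult_mono divide_right_mono pow_le)
          show "walk G q {i\<in>{1..n}. g i \<notin> ?B} (w n j) g (\<lambda>z. if z \<in> ?B then 1 else 0) \<one>
            \<le> exp (- \<kappa> * min (a n j * real (card (off t n g))) 1)"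
            unfolding \<kappa>_def N_def off_def
            by (rule walk_avoid_subgroup_bound[OF _ off_nonempty[OF g, unfolded off_def] _ _ w[OF n j]
                  generate_facts(1)[OF heavy_sub] a0[OF n j]]) (use gc[OF gg] in simp_all)
          show "0 \<le> walk G q {i\<in>{1..n}. g i \<notin> ?B} (w n j) g (\<lambda>z. if z \<in> ?B then 1 else 0) \<one>"
            by (rule walk_nonneg[OF _ balanced_weights_stoch[OF w[OF n j]]]) (use gc[OF gg] in simp_all)
        qed auto
        finally show "hit {1..n} (w n j) g \<le> exp (N * real q * \<eta> n j) / real (card ?B) * exp (- \<kappa> * min (a n j * real (card (off t n g))) 1)" .
      qed
      also have "\<dots> = (\<Prod>j\<in>?J. exp (N * real q * \<eta> n j)) / real (card ?B) ^ (n+u)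
          * (\<Prod>j\<in>?J. exp (- \<kappa> * min (a n j * real (card (off t n g))) 1))"
        by (simp add: prod.distrib prod_dividef)
      also have "(\<Prod>j\<in>?J. exp (N * real q * \<eta> n j)) = exp (N * real q * E n)"
        unfolding E_def sum_distrib_left by (rule exp_sum[symmetric]) simp
      also have "(\<Prod>j\<in>?J. exp (- \<kappa> * min (a n j * real (card (off t n g))) 1))
          = exp (- \<kappa> * (\<Sum>j\<in>?J. min (a n j * real (card (off t n g))) 1))"
        unfolding sum_distrib_left by (rule exp_sum[symmetric]) simp
      finally have "?H g \<le> exp (N * real q * E n) / real (card ?B) ^ (n+u)
          * exp (- \<kappa> * (\<Sum>j\<in>?J. min (a n j * real (card (off t n g))) 1))" .
      then show ?thesis by (simp add: F_def)
    qed
    then have "(\<Sum>g\<in>bad t n. ?H g) \<le> (\<Sum>g\<in>bad t n. F (generate G (heavy t n g)) (card (off t n g)))"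
      by (rule sum_mono)
    also have "\<dots> \<le> 2 ^ order G * (\<Sum>m | 1 \<le> m \<and> real m \<le> t * real (order G) * real n. real (n choose m) * (real (order G) ^ m *
        (exp (N * real q * E n) * exp (- \<kappa> * (\<Sum>j=1..n+u. min (a n j * real m) 1)))))"
    proof (rule sum_bad_le)
      fix B :: "'a set" and m :: nat
      assume B: "subgroup B G"
      have "finite B" using subgroup.subset[OF B] fin finite_subset by blast
      then have B1: "real (card B) \<ge> 1" using subgroup.one_closed[OF B] by (auto simp: Suc_le_eq card_gt_0_iff)
      have "real (card B) ^ n * F B m = exp (N * real q * E n) * exp (- \<kappa> * (\<Sum>j=1..n+u. min (a n j * real m) 1)) / real (card B) ^ u"
        using B1 by (simp add: F_def power_add)
      also have "\<dots> \<le> exp (N * real q * E n) * exp (- \<kappa> * (\<Sum>j=1..n+u. min (a n j * real m) 1))"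
        using B1 divide_left_mono[of 1 "real (card B) ^ u" "exp (N * real q * E n) * exp (- \<kappa> * (\<Sum>j=1..n+u. min (a n j * real m) 1))"]
        by simp
      finally show "real (card B) ^ n * F B m \<le> exp (N * real q * E n) * exp (- \<kappa> * (\<Sum>j=1..n+u. min (a n j * real m) 1))" .
    qed (use t in \<open>auto simp: F_def\<close>)
    also have "\<dots> = exp (N * real q * E n) * (2 ^ order G * S a n)"
      unfolding N_def[symmetric] tN S_def sum_distrib_left by (intro sum.cong refl) (simp only: mult_ac)
    finally have B1: "(\<Sum>g\<in>bad t n. ?H g) \<le> exp (N * real q * E n) * (2 ^ order G * S a n)" .

    have "(\<Sum>g\<in>bad t n. 1 / N ^ (n+u)) \<le> 2 ^ order G * (\<Sum>m | 1 \<le> m \<and> real m \<le> t * real (order G) * real n. real (n choose m) * (real (order G) ^ m *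
        (exp (\<kappa> * real u) * exp (- \<kappa> * (\<Sum>j=1..n+u. min (1 * real m) 1)))))"
    proof (rule sum_bad_le[where F = "\<lambda>_ _. 1 / N ^ (n+u)"])
      fix B :: "'a set" and m :: nat
      assume B: "subgroup B G" "B \<noteq> carrier G" and m: "1 \<le> m"
      have "2 * real (card B) \<le> N" using of_nat_mono[OF card_proper_subgroup_le[OF B], where 'a = real] by (simp add: N_def)
      then have le: "real (card B) / N \<le> 1 / 2" using N1 by (simp add: field_simps)
      have "real (card B) ^ n * (1 / N ^ (n+u)) = (real (card B) / N) ^ n / N ^ u"
        by (simp add: power_add power_divide)
      also have "\<dots> \<le> (real (card B) / N) ^ n / 1" using N1 by (intro divide_left_mono) auto
      also have "\<dots> \<le> (1 / 2) ^ n" using le N1 by (simp add: power_mono)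
      also have "\<dots> \<le> exp (- \<kappa>) ^ n"
      proof (rule power_mono)
        show "1 / 2 \<le> exp (- \<kappa>)" using \<kappa> exp_ge_add_one_self[of "- \<kappa>"] by linarith
      qed simp
      also have "\<dots> = exp (\<kappa> * real u) * exp (- \<kappa> * (\<Sum>j=1..n+u. min (1 * real m) 1))"
      proof -
        have "exp (- \<kappa>) ^ n = exp (real n * (- \<kappa>))" by (rule exp_of_nat_mult[symmetric])
        also have "real n * (- \<kappa>) = \<kappa> * real u + - \<kappa> * (\<Sum>j=1..n+u. min (1 * real m) 1)"
          using m by (simp add: algebra_simps)
        finally show ?thesis by (simp only: exp_add)
      qed
      finally show "real (card B) ^ n * (1 / N ^ (n+u)) \<le> exp (\<kappa> * real u) * exp (- \<kappa> * (\<Sum>j=1..n+u. min (1 * real m) 1))" .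
    qed (use t N1 in auto)
    also have "\<dots> = 2 ^ order G * (exp (\<kappa> * real u) * S (\<lambda>_ _. 1) n)"
      unfolding N_def[symmetric] tN S_def sum_distrib_left by (intro sum.cong refl) (simp only: mult_ac)
    finally have B2: "(\<Sum>g\<in>bad t n. 1 / N ^ (n+u)) \<le> 2 ^ order G * (exp (\<kappa> * real u) * S (\<lambda>_ _. 1) n)" .
    have "(\<Sum>g\<in>bad t n. \<bar>?H g - 1 / N ^ (n+u)\<bar>) \<le> (\<Sum>g\<in>bad t n. ?H g + 1 / N ^ (n+u))"
    proof (rule sum_mono)
      fix g assume "g \<in> bad t n"
      then have "g \<in> gens n" by (simp add: bad_def)
      then have "?H g \<ge> 0" by (intro prod_nonneg hit0) auto
      moreover have "1 / N ^ (n+u) \<ge> 0" using N1 by simp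
      ultimately show "\<bar>?H g - 1 / N ^ (n+u)\<bar> \<le> ?H g + 1 / N ^ (n+u)" by linarith
    qed
    then have B: "(\<Sum>g\<in>bad t n. \<bar>?H g - 1 / N ^ (n+u)\<bar>)
       \<le> exp (N * real q * E n) * (2 ^ order G * S a n) + 2 ^ order G * (exp (\<kappa> * real u) * S (\<lambda>_ _. 1) n)"
      using B1 B2 by (simp add: sum.distrib)
    have "(\<Sum>g\<in>gens n. \<bar>?H g - 1 / N ^ (n+u)\<bar>)
       = (\<Sum>g\<in>gens n - bad t n. \<bar>?H g - 1 / N ^ (n+u)\<bar>) + (\<Sum>g\<in>bad t n. \<bar>?H g - 1 / N ^ (n+u)\<bar>)"
      by (rule sum.subset_diff[OF _ finite_gens]) (auto simp: bad_def)
    then show ?thesis using G B by linarith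
  qed
  have E1: "(\<lambda>n. N * real q * E n) \<longlonglongrightarrow> 0" using tendsto_mult_left[OF Elim, of "N * real q"] by simp
  have ev: "eventually (\<lambda>n. norm (\<Sum>g\<in>gens n. \<bar>(\<Prod>j=1..n+u. hit {1..n} (w n j) g) - 1 / N ^ (n+u)\<bar>)
      \<le> (exp (N * real q * E n) - 1) + exp (N * real q * E n) * (2 ^ order G * S a n) + 2 ^ order G * (exp (\<kappa> * real u) * S (\<lambda>_ _. 1) n)) sequentially"
    using eventually_ge_at_top[of 1] order_tendstoD(2)[OF E1, of 1, simplified]
  proof eventually_elim
    case (elim n)
    then show ?case using main[of n] by (simp add: sum_nonneg)
  qed
  have "(\<lambda>n. (exp (N * real q * E n) - 1) + exp (N * real q * E n) * (2 ^ order G * S a n) + 2 ^ order G * (exp (\<kappa> * real u) * S (\<lambda>_ _. 1) n))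
     \<longlonglongrightarrow> (exp 0 - 1) + exp 0 * (2 ^ order G * 0) + 2 ^ order G * (exp (\<kappa> * real u) * 0)"
    by (intro tendsto_intros E1 S1 S2)
  then show ?thesis using Lim_null_comparison[OF ev] by (simp add: N_def)
qed

end

section \<open>Subgroups with elementary abelian quotient\<close>

context comm_group
begin

text \<open>
  The subgroup generated by a subgroup \<open>M\<close> and one further element.
\<close>

definition adjoin :: "'a set \<Rightarrow> 'a \<Rightarrow> 'a set" where
  "adjoin M y = {m \<otimes> y [^] (a::int) | m a. m \<in> M}"

lemma adjoin_subgroup:
  assumes M: "subgroup M G" and y: "y \<in> carrier G" shows "subgroup (adjoin M y) G"
proof (rule subgroupI)
  note Mc = subgroup.mem_carrier[OF M]
  show "adjoin M y \<subseteq> carrier G" using Mc y by (auto simp: adjoin_def)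
  show "adjoin M y \<noteq> {}" using subgroup.one_closed[OF M] by (auto simp: adjoin_def)
  fix z assume "z \<in> adjoin M y"
  then obtain m a where z: "z = m \<otimes> y [^] (a::int)" "m \<in> M" by (auto simp: adjoin_def)
  have "inv z = inv m \<otimes> y [^] (- a)" using z Mc y by (simp add: inv_mult int_pow_neg)
  then show "inv z \<in> adjoin M y" using subgroup.m_inv_closed[OF M z(2)] by (auto simp: adjoin_def)
  fix w assume "w \<in> adjoin M y"
  then obtain m' b where w: "w = m' \<otimes> y [^] (b::int)" "m' \<in> M" by (auto simp: adjoin_def)
  have "z \<otimes> w = (m \<otimes> m') \<otimes> y [^] (a + b)" using z w Mc y by (simp add: int_pow_mult m_ac)
  then show "z \<otimes> w \<in> adjoin M y" using subgroup.m_closed[OF M z(2) w(2)] by (auto simp: adjoin_def)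
qed

lemma adjoin_base: "subgroup M G \<Longrightarrow> y \<in> carrier G \<Longrightarrow> M \<subseteq> adjoin M y"
proof
  fix m assume "subgroup M G" "y \<in> carrier G" "m \<in> M"
  then have "m = m \<otimes> y [^] (0::int)" using subgroup.mem_carrier[of M G m] by simp
  then show "m \<in> adjoin M y" using \<open>m \<in> M\<close> unfolding adjoin_def by blast
qed

lemma adjoin_gen: "subgroup M G \<Longrightarrow> y \<in> carrier G \<Longrightarrow> y \<in> adjoin M y"
proof -
  assume a: "subgroup M G" "y \<in> carrier G"
  then have "y = \<one> \<otimes> y [^] (1::int)" by (simp add: int_pow_1)
  then show ?thesis using subgroup.one_closed[OF a(1)] unfolding adjoin_def by blast
qed

lemma adjoin_least: "subgroup T G \<Longrightarrow> M \<subseteq> T \<Longrightarrow> y \<in> T \<Longrightarrow> adjoin M y \<subseteq> T"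
  by (auto simp: adjoin_def intro!: subgroup.m_closed int_pow_in_subgroup)

lemma mem_subgroup_of_prime_power:
  assumes M: "subgroup M G" and y: "y \<in> carrier G" "y [^] (p::nat) \<in> M" "y [^] (t::int) \<in> M"
    and p: "Factorial_Ring.prime p" and t: "\<not> int p dvd t"
  shows "y \<in> M"
  using p t by (intro mem_subgroup_of_coprime_powers[OF M y] prime_imp_coprime) auto

lemma card_adjoin:
  assumes M: "subgroup M G" "finite M" and y: "y \<in> carrier G" "y \<notin> M" "y [^] (p::nat) \<in> M"
    and p: "Factorial_Ring.prime p"
  shows "card (adjoin M y) = p * card M"
proof -
  note Mc = subgroup.mem_carrier[OF M(1)]
  have p0: "p > 0" using p by (simp add: prime_gt_0_nat)
  let ?f = "\<lambda>(m, a). m \<otimes> y [^] (a::int)"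
  have "adjoin M y = ?f ` (M \<times> {0..<int p})"
  proof
    show "?f ` (M \<times> {0..<int p}) \<subseteq> adjoin M y" by (auto simp: adjoin_def)
    show "adjoin M y \<subseteq> ?f ` (M \<times> {0..<int p})"
    proof
      fix z assume "z \<in> adjoin M y"
      then obtain m a where z: "z = m \<otimes> y [^] (a::int)" "m \<in> M" by (auto simp: adjoin_def)
      have "y [^] a = y [^] (int p * (a div int p) + a mod int p)" by simp
      also have "\<dots> = (y [^] int p) [^] (a div int p) \<otimes> y [^] (a mod int p)"
        using y unfolding int_pow_mult[OF y(1)] by (simp add: int_pow_pow)
      finally have "z = ?f (m \<otimes> (y [^] int p) [^] (a div int p), a mod int p)"
        using z Mc y by (simp add: m_assoc)
      moreover have "m \<otimes> (y [^] int p) [^] (a div int p) \<in> M"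
      proof (rule subgroup.m_closed[OF M(1) z(2)])
        show "(y [^] int p) [^] (a div int p) \<in> M" by (rule int_pow_in_subgroup[OF M(1)]) (simp add: int_pow_int y)
      qed
      ultimately show "z \<in> ?f ` (M \<times> {0..<int p})" using p0 by (intro image_eqI[of _ _ "(_, _)"]) auto
    qed
  qed
  moreover have "inj_on ?f (M \<times> {0..<int p})"
  proof (rule inj_onI, clarify)
    fix m a m' b assume ab: "m \<in> M" "m' \<in> M" "a \<in> {0..<int p}" "b \<in> {0..<int p}"
      and eq: "m \<otimes> y [^] a = m' \<otimes> y [^] b"
    have "y [^] (a - b) = inv m \<otimes> (m \<otimes> y [^] a) \<otimes> inv (y [^] b)"
      using ab Mc y by (simp add: m_assoc[symmetric] int_pow_diff)
    also have "\<dots> = inv m \<otimes> m'" unfolding eq using ab Mc y by (simp add: m_assoc)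
    also have "\<dots> \<in> M" using ab M by (simp add: subgroup.m_closed subgroup.m_inv_closed)
    finally have "int p dvd a - b" using mem_subgroup_of_prime_power[OF M(1) y(1,3) _ p] y(2) by blast
    moreover have "\<bar>a - b\<bar> < int p" using ab by auto
    ultimately have "a = b" using zdvd_imp_le[of "int p" "\<bar>a - b\<bar>"] by fastforce
    then show "m = m' \<and> a = b" using eq ab Mc y by simp
  qed
  ultimately have "card (adjoin M y) = card (M \<times> {0..<int p})" by (simp add: card_image)
  then show ?thesis by (simp add: card_cartesian_product mult.commute)
qed

text \<open>
  The subgroups \<open>M\<close> in question are the \<open>adjoin M' (s \<otimes> x)\<close> with \<open>s \<in> S\<close>, and two elements of \<open>S\<close> give the same one
  exactly if they agree modulo \<open>M'\<close>.
\<close>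

lemma count_complement_extensions:
  assumes S: "subgroup S G" "finite S" and x: "x \<in> carrier G" "x \<notin> S" and L: "L = adjoin S x"
    and Y: "subgroup Y G" "Y \<subseteq> M'" and pw: "\<And>z. z \<in> L \<Longrightarrow> z [^] (p::nat) \<in> Y"
    and M': "subgroup M' G" "M' \<subseteq> S" and p: "Factorial_Ring.prime p"
  shows "card {M. subgroup M G \<and> M \<subseteq> L \<and> \<not> M \<subseteq> S \<and> M \<inter> S = M'} * card M' = card S"
    and "\<And>M. subgroup M G \<Longrightarrow> M \<subseteq> L \<Longrightarrow> \<not> M \<subseteq> S \<Longrightarrow> M \<inter> S = M' \<Longrightarrow> card M = p * card M'"
proof -
  let ?MM = "{M. subgroup M G \<and> M \<subseteq> L \<and> \<not> M \<subseteq> S \<and> M \<inter> S = M'}"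
  define N where "N s = adjoin M' (s \<otimes> x)" for s
  note Sc = subgroup.mem_carrier[OF S(1)] and M'c = subgroup.mem_carrier[OF M'(1)]
  have LG: "subgroup L G" unfolding L using S x by (intro adjoin_subgroup)
  have SL: "S \<subseteq> L" and xinL: "x \<in> L" unfolding L using S x by (auto intro: adjoin_base[THEN subsetD] adjoin_gen)
  have finM': "finite M'" using M' S finite_subset by blast
  have sxc: "s \<otimes> x \<in> carrier G" "s \<otimes> x \<in> L" if "s \<in> S" for s
    using that Sc x SL xinL subgroup.m_closed[OF LG] by auto
  have sxS: "s \<otimes> x \<notin> S" if "s \<in> S" for s
  proof
    assume "s \<otimes> x \<in> S"
    then have "inv s \<otimes> (s \<otimes> x) \<in> S" using that S subgroup.m_closed subgroup.m_inv_closed by metis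
    then show False using that Sc x by (simp add: m_assoc[symmetric])
  qed
  have pS: "z [^] p \<in> S" if "z \<in> L" for z using pw[OF that] Y M' by blast
  have NS: "N s \<inter> S = M'" if s: "s \<in> S" for s
  proof
    show "M' \<subseteq> N s \<inter> S" using adjoin_base[OF M'(1) sxc(1)[OF s]] M' by (auto simp: N_def)
    show "N s \<inter> S \<subseteq> M'"
    proof
      fix z assume z: "z \<in> N s \<inter> S"
      then obtain m a where ma: "z = m \<otimes> (s \<otimes> x) [^] (a::int)" "m \<in> M'" by (auto simp: N_def adjoin_def)
      have "(s \<otimes> x) [^] a = inv m \<otimes> z" using ma M'c sxc[OF s] by (simp add: m_assoc[symmetric])
      then have "(s \<otimes> x) [^] a \<in> S"
        using z ma M' S by (metis IntD2 subgroup.m_closed subgroup.m_inv_closed subsetD)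
      then have "int p dvd a"
        using mem_subgroup_of_prime_power[OF S(1) sxc(1)[OF s] pS[OF sxc(2)[OF s]] _ p] sxS[OF s] by blast
      then obtain b where "a = int p * b" by blast
      then have "(s \<otimes> x) [^] a = ((s \<otimes> x) [^] p) [^] b" using sxc[OF s] by (simp add: int_pow_pow[symmetric] int_pow_int)
      also have "\<dots> \<in> M'" using pw[OF sxc(2)[OF s]] Y M' by (intro int_pow_in_subgroup) auto
      finally show "z \<in> M'" using ma M' by (simp add: subgroup.m_closed)
    qed
  qed
  have N_mem: "N s \<in> ?MM" if s: "s \<in> S" for s
  proof -
    have "subgroup (N s) G" unfolding N_def using M' sxc[OF s] by (intro adjoin_subgroup)
    moreover have "N s \<subseteq> L" unfolding N_def using M' SL sxc[OF s] by (intro adjoin_least LG) auto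
    moreover have "s \<otimes> x \<in> N s" unfolding N_def using M' sxc[OF s] by (intro adjoin_gen)
    ultimately show ?thesis using sxS[OF s] NS[OF s] by auto
  qed
  have surj: "\<exists>s\<in>S. M = N s" if M: "M \<in> ?MM" for M
  proof -
    have MG: "subgroup M G" and MsubL: "M \<subseteq> L" and MS: "M \<inter> S = M'" using M by auto
    note Mc = subgroup.mem_carrier[OF MG]
    obtain y where y: "y \<in> M" "y \<notin> S" using M by blast
    then obtain s a where sa: "y = s \<otimes> x [^] (a::int)" "s \<in> S" using MsubL L by (auto simp: adjoin_def)
    have "\<not> int p dvd a"
    proof
      assume "int p dvd a"
      then obtain b where "a = int p * b" by blast
      then have "x [^] a = (x [^] p) [^] b" using x by (simp add: int_pow_pow[symmetric] int_pow_int)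
      then have "x [^] a \<in> S" using pS[OF xinL] S by (simp add: int_pow_in_subgroup)
      then show False using y sa S by (simp add: subgroup.m_closed)
    qed
    then have "coprime a (int p)" using p by (metis coprime_commute prime_imp_coprime prime_nat_int_transfer)
    then obtain u v where uv: "a * u + int p * v = 1"
      by (metis bezout_int coprime_imp_gcd_eq_1 mult.commute)
    \<comment> \<open>since \<open>a u\<close> is congruent to \<open>1\<close> modulo \<open>p\<close>, the power \<open>y\<^sup>u\<close> has the form \<open>s' x\<close>\<close>
    define s' where "s' = s [^] u \<otimes> (x [^] p) [^] (- v)"
    have s': "s' \<in> S" unfolding s'_def using sa pS[OF xinL] by (intro subgroup.m_closed[OF S(1)] int_pow_in_subgroup[OF S(1)])
    have "y [^] u = s [^] u \<otimes> x [^] (a * u)"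
      using sa Sc x by (simp add: int_pow_distrib int_pow_pow)
    also have "a * u = int p * (- v) + 1" using uv by (simp add: algebra_simps)
    also have "x [^] (int p * (- v) + 1) = (x [^] p) [^] (- v) \<otimes> x"
      using x unfolding int_pow_mult[OF x(1)] by (simp add: int_pow_pow[symmetric] int_pow_int int_pow_1 del: int_pow_neg mult_minus_right)
    finally have yu: "y [^] u = s' \<otimes> x" unfolding s'_def using sa Sc x by (simp add: m_assoc)
    have s'M: "s' \<otimes> x \<in> M" using yu int_pow_in_subgroup[OF MG y(1), of u] by simp
    have "M = N s'"
    proof
      show "N s' \<subseteq> M" unfolding N_def using MS s'M by (intro adjoin_least MG) auto
      show "M \<subseteq> N s'"
      proof
        fix z assume z: "z \<in> M"
        then obtain t c where tc: "z = t \<otimes> x [^] (c::int)" "t \<in> S" using MsubL L by (auto simp: adjoin_def)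
        define m where "m = z \<otimes> (s' \<otimes> x) [^] (- c)"
        have mM: "m \<in> M" unfolding m_def by (rule subgroup.m_closed[OF MG z int_pow_in_subgroup[OF MG s'M]])
        have "m = t \<otimes> s' [^] (- c) \<otimes> (x [^] c \<otimes> x [^] (- c))"
          unfolding m_def tc using Sc[OF tc(2)] Sc[OF s'] x by (simp only: int_pow_distrib) (simp add: m_ac del: int_pow_neg)
        also have "x [^] c \<otimes> x [^] (- c) = \<one>" using x by (simp add: int_pow_neg)
        finally have "m \<in> S" using tc s' Sc[OF tc(2)] Sc[OF s']
          by (simp del: int_pow_neg add: subgroup.m_closed[OF S(1)] int_pow_in_subgroup[OF S(1)])
        then have "m \<in> M'" using mM MS by auto
        moreover have "z = m \<otimes> (s' \<otimes> x) [^] c"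
          unfolding m_def using Mc[OF z] sxc[OF s'] by (simp add: m_assoc int_pow_neg)
        ultimately show "z \<in> N s'" unfolding N_def adjoin_def by blast
      qed
    qed
    then show ?thesis using s' by blast
  qed
  show "\<And>M. subgroup M G \<Longrightarrow> M \<subseteq> L \<Longrightarrow> \<not> M \<subseteq> S \<Longrightarrow> M \<inter> S = M' \<Longrightarrow> card M = p * card M'"
  proof -
    fix M assume "subgroup M G" "M \<subseteq> L" "\<not> M \<subseteq> S" "M \<inter> S = M'"
    then obtain s where s: "s \<in> S" "M = N s" using surj by blast
    have "s \<otimes> x \<notin> M'" using sxS[OF s(1)] M' by blast
    then show "card M = p * card M'"
      unfolding s N_def using pw[OF sxc(2)[OF s(1)]] Y sxc[OF s(1)] by (intro card_adjoin M' finM' p) auto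
  qed
  have MM: "?MM = N ` S" using N_mem surj by blast
  have fib: "card {s \<in> S. N s = N t} = card M'" if t: "t \<in> S" for t
  proof -
    have "{s \<in> S. N s = N t} = (\<lambda>m. m \<otimes> t) ` M'"
    proof
      show "{s \<in> S. N s = N t} \<subseteq> (\<lambda>m. m \<otimes> t) ` M'"
      proof
        fix s assume s: "s \<in> {s \<in> S. N s = N t}"
        have "s \<otimes> x \<in> N t" "t \<otimes> x \<in> N t"
          using s t adjoin_gen[OF M'(1) sxc(1)] by (auto simp: N_def)
        moreover have "subgroup (N t) G" using N_mem[OF t] by simp
        ultimately have "s \<otimes> x \<otimes> inv (t \<otimes> x) \<in> N t" by (simp add: subgroup.m_closed subgroup.m_inv_closed)
        also have "s \<otimes> x \<otimes> inv (t \<otimes> x) = s \<otimes> inv t"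
        proof -
          have c: "s \<in> carrier G" "t \<in> carrier G" using s t Sc by auto
          have "s \<otimes> x \<otimes> inv (t \<otimes> x) = s \<otimes> inv t \<otimes> (x \<otimes> inv x)"
            using c x by (simp add: inv_mult m_ac)
          then show ?thesis using c x by simp
        qed
        finally have "s \<otimes> inv t \<in> N t \<inter> S" using s t S by (simp add: subgroup.m_closed subgroup.m_inv_closed)
        then have "s \<otimes> inv t \<in> M'" using NS[OF t] by simp
        moreover have "s = s \<otimes> inv t \<otimes> t" using s t Sc by (simp add: m_assoc)
        ultimately show "s \<in> (\<lambda>m. m \<otimes> t) ` M'" by blast
      qed
      show "(\<lambda>m. m \<otimes> t) ` M' \<subseteq> {s \<in> S. N s = N t}"
      proof clarify
        fix m assume m: "m \<in> M'"
        have mt: "m \<otimes> t \<in> S" using m M' t S by (auto intro: subgroup.m_closed)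
        have tG: "subgroup (N t) G" and mG: "subgroup (N (m \<otimes> t)) G" using N_mem[OF t] N_mem[OF mt] by auto
        have "m \<otimes> t \<otimes> x \<in> N t"
        proof -
          have "m \<otimes> t \<otimes> x = m \<otimes> (t \<otimes> x)" using m M'c t Sc x by (simp add: m_assoc)
          moreover have "m \<in> N t" "t \<otimes> x \<in> N t"
            using m NS[OF t] adjoin_gen[OF M'(1) sxc(1)[OF t]] by (auto simp: N_def)
          ultimately show ?thesis using tG by (simp add: subgroup.m_closed)
        qed
        then have 1: "N (m \<otimes> t) \<subseteq> N t" unfolding N_def[of "m \<otimes> t"] using NS[OF t] by (intro adjoin_least tG) auto
        have "t \<otimes> x \<in> N (m \<otimes> t)"
        proof -
          have "t \<otimes> x = inv m \<otimes> (m \<otimes> t \<otimes> x)" using m M'c t Sc x by (simp add: m_assoc[symmetric])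
          moreover have "m \<in> N (m \<otimes> t)" "m \<otimes> t \<otimes> x \<in> N (m \<otimes> t)"
            using m NS[OF mt] adjoin_gen[OF M'(1) sxc(1)[OF mt]] by (auto simp: N_def)
          ultimately show ?thesis using mG by (metis subgroup.m_closed subgroup.m_inv_closed)
        qed
        then have 2: "N t \<subseteq> N (m \<otimes> t)" unfolding N_def[of t] using NS[OF mt] by (intro adjoin_least mG) auto
        show "m \<otimes> t \<in> S \<and> N (m \<otimes> t) = N t" using 1 2 mt by auto
      qed
    qed
    moreover have "inj_on (\<lambda>m. m \<otimes> t) M'" using M'c t Sc by (intro inj_onI) simp
    ultimately show ?thesis by (simp add: card_image)
  qed
  have "card S = (\<Sum>M\<in>N ` S. \<Sum>s | s \<in> S \<and> N s = M. 1)"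
    using sum.group[of S "N ` S" N "\<lambda>_. 1::nat"] S by simp
  also have "\<dots> = (\<Sum>M\<in>N ` S. card M')"
    by (rule sum.cong[OF refl]) (auto simp: fib)
  also have "\<dots> = card ?MM * card M'" unfolding MM by simp
  finally show "card ?MM * card M' = card S" by simp
qed

lemma exists_maximal_subgroup:
  assumes Y: "subgroup Y G" and L: "subgroup L G" "finite L" and YL: "Y \<subset> L"
  obtains S x where "subgroup S G" "Y \<subseteq> S" "x \<in> L" "x \<notin> S" "L = adjoin S x"
proof -
  let ?P = "{S. subgroup S G \<and> Y \<subseteq> S \<and> S \<subset> L}"
  have f: "finite ?P" by (rule finite_subset[of _ "Pow L"]) (use L in auto)
  have ne: "?P \<noteq> {}" using Y YL by blast
  obtain S where S: "S \<in> ?P" and "\<forall>T\<in>?P. S \<subseteq> T \<longrightarrow> S = T"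
    using finite_has_maximal[OF f ne] by blast
  then have mx: "\<And>T. T \<in> ?P \<Longrightarrow> S \<subseteq> T \<Longrightarrow> T = S" by metis
  obtain x where x: "x \<in> L" "x \<notin> S" using S by blast
  have xc: "x \<in> carrier G" using x L subgroup.mem_carrier by metis
  have SG: "subgroup S G" using S by simp
  have "adjoin S x \<subseteq> L" using S x L by (intro adjoin_least) auto
  moreover have "S \<subseteq> adjoin S x" "x \<in> adjoin S x" "subgroup (adjoin S x) G"
    using adjoin_base[OF SG xc] adjoin_gen[OF SG xc] adjoin_subgroup[OF SG xc] by auto
  ultimately have "L = adjoin S x" using mx[of "adjoin S x"] S x by blast
  then show thesis using that S x by blast
qed

text \<open>
  The quotient of \<open>L\<close> by \<open>Y\<close> is a vector space over the field with \<open>p\<close> elements. With a hyperplane \<open>S\<close> fixed,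
  the subspaces inside \<open>S\<close> and those not inside \<open>S\<close> (counted by their intersection with \<open>S\<close>) give the two terms
  of the \<open>q\<close>-Pascal rule. Arguing inside the group makes a choice of basis unnecessary.
\<close>

theorem gaussian_subgroup_count:
  assumes "subgroup Y G" "subgroup L G" "finite L" "Y \<subseteq> L" "\<And>z. z \<in> L \<Longrightarrow> z [^] (p::nat) \<in> Y"
    and p: "Factorial_Ring.prime p"
  shows "\<exists>r. card L = p ^ r * card Y \<and>
    (\<forall>d. card {M. subgroup M G \<and> Y \<subseteq> M \<and> M \<subseteq> L \<and> card L = p ^ d * card M} = gbinom p r d)"
  using assms(2-5)
proof (induction "card L" arbitrary: L rule: less_induct)
  case less
  have p2: "p \<ge> 2" using p by (rule prime_ge_2_nat)
  have pos: "card M > 0" if "subgroup M G" "M \<subseteq> L" for M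
    using that less.prems subgroup.one_closed[of M G] finite_subset[of M L] by (auto simp: card_gt_0_iff)
  have top: "{M. subgroup M G \<and> Y \<subseteq> M \<and> M \<subseteq> L \<and> card L = p ^ 0 * card M} = {L}"
  proof (intro equalityI subsetI)
    fix M assume "M \<in> {M. subgroup M G \<and> Y \<subseteq> M \<and> M \<subseteq> L \<and> card L = p ^ 0 * card M}"
    then show "M \<in> {L}" using card_subset_eq[OF less.prems(2), of M] by simp
  qed (use less.prems in auto)
  show ?case
  proof (cases "Y = L")
    case True
    have "{M. subgroup M G \<and> Y \<subseteq> M \<and> M \<subseteq> L \<and> card L = p ^ Suc d * card M} = {}" for d
    proof -
      have "card L \<noteq> p ^ Suc d * card L"
        using pos[OF less.prems(1)] p2 one_less_power[of p "Suc d"] by (simp del: power_Suc)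
      then show ?thesis using True by auto
    qed
    note empty = this
    have "card {M. subgroup M G \<and> Y \<subseteq> M \<and> M \<subseteq> L \<and> card L = p ^ d * card M} = gbinom p 0 d" for d
    proof (cases d)
      case 0
      then show ?thesis unfolding 0 top by simp
    next
      case (Suc d')
      show ?thesis unfolding Suc empty by simp
    qed
    then show ?thesis using True by (intro exI[of _ 0]) simp
  next
    case False
    then have YL: "Y \<subset> L" using less.prems by blast
    obtain S x where S: "subgroup S G" "Y \<subseteq> S" and x: "x \<in> L" "x \<notin> S" and LS: "L = adjoin S x"
      by (rule exists_maximal_subgroup[OF assms(1) less.prems(1,2) YL])
    have xc: "x \<in> carrier G" using x less.prems subgroup.mem_carrier by metis
    have SL: "S \<subseteq> L" unfolding LS by (rule adjoin_base[OF S(1) xc])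
    have fS: "finite S" using SL less.prems finite_subset by blast
    have cL: "card L = p * card S"
      unfolding LS using less.prems(4)[OF x(1)] S x xc by (intro card_adjoin fS p) auto
    have "card S < card L" using SL x less.prems by (intro psubset_card_mono) auto
    from less.hyps[OF this S(1) fS S(2)] less.prems(4) SL
    obtain r where r: "card S = p ^ r * card Y"
      and cnt: "\<And>d. card {M. subgroup M G \<and> Y \<subseteq> M \<and> M \<subseteq> S \<and> card S = p ^ d * card M} = gbinom p r d" by blast
    have step: "card {M. subgroup M G \<and> Y \<subseteq> M \<and> M \<subseteq> L \<and> card L = p ^ Suc d * card M} = gbinom p (Suc r) (Suc d)" for d
    proof -
      let ?MM = "{M. subgroup M G \<and> Y \<subseteq> M \<and> M \<subseteq> L \<and> card L = p ^ Suc d * card M}"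
      let ?A = "{M. subgroup M G \<and> Y \<subseteq> M \<and> M \<subseteq> S \<and> card S = p ^ d * card M}"
      let ?NN = "{M. subgroup M G \<and> Y \<subseteq> M \<and> M \<subseteq> S \<and> card S = p ^ Suc d * card M}"
      let ?F = "\<lambda>M'. {M. subgroup M G \<and> M \<subseteq> L \<and> \<not> M \<subseteq> S \<and> M \<inter> S = M'}"
      have fin: "finite ?A" "finite ?NN" using fS by (auto intro: finite_subset[of _ "Pow S"])
      have finF: "finite (?F M')" for M' using less.prems(2) by (auto intro: finite_subset[of _ "Pow L"])
      have F: "card (?F M') * card M' = card S" "\<And>M. M \<in> ?F M' \<Longrightarrow> card M = p * card M'"
        if "subgroup M' G" "Y \<subseteq> M'" "M' \<subseteq> S" for M'
        using count_complement_extensions[OF S(1) fS xc x(2) LS assms(1) that(2) less.prems(4) that(1,3) p] by auto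
      have p0: "p > 0" using p2 by simp
      have "?MM = ?A \<union> (\<Union>M'\<in>?NN. ?F M')"
      proof (intro equalityI subsetI)
        fix M assume M: "M \<in> ?MM"
        show "M \<in> ?A \<union> (\<Union>M'\<in>?NN. ?F M')"
        proof (cases "M \<subseteq> S")
          case True
          then show ?thesis using M cL p0 by simp
        next
          case False
          have MS: "subgroup (M \<inter> S) G" using M S by (intro subgroups_Inter_pair) auto
          have "card M = p * card (M \<inter> S)" using M False S MS by (intro F(2)) auto
          then have "M \<inter> S \<in> ?NN" using M S MS cL p0 by auto
          then show ?thesis using M False by blast
        qed
      next
        fix M assume "M \<in> ?A \<union> (\<Union>M'\<in>?NN. ?F M')"
        then show "M \<in> ?MM"
        proof
          assume "M \<in> ?A"
          then show ?thesis using cL SL by auto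
        next
          assume "M \<in> (\<Union>M'\<in>?NN. ?F M')"
          then obtain M' where M': "M' \<in> ?NN" "M \<in> ?F M'" by blast
          then have "card M = p * card M'" by (intro F(2)) auto
          then show ?thesis using M' cL by auto
        qed
      qed
      then have "card ?MM = card ?A + card (\<Union>M'\<in>?NN. ?F M')"
        using fin finF by (simp only:) (intro card_Un_disjoint; auto)
      also have "card (\<Union>M'\<in>?NN. ?F M') = (\<Sum>M'\<in>?NN. card (?F M'))"
        using fin finF by (intro card_UN_disjoint) auto
      also have "\<dots> = (\<Sum>M'\<in>?NN. p ^ Suc d)"
      proof (rule sum.cong[OF refl])
        fix M' assume M': "M' \<in> ?NN"
        then have "card (?F M') * card M' = p ^ Suc d * card M'" using F(1)[of M'] by auto
        moreover have "card M' > 0" using pos M' SL by auto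
        ultimately show "card (?F M') = p ^ Suc d" by simp
      qed
      also have "\<dots> = p ^ Suc d * card ?NN" by simp
      finally show ?thesis by (simp only: cnt gbinom.simps)
    qed
    have "card {M. subgroup M G \<and> Y \<subseteq> M \<and> M \<subseteq> L \<and> card L = p ^ d * card M} = gbinom p (Suc r) d" for d
      using top step by (cases d) (auto simp del: power_Suc power_0 gbinom.simps(3))
    moreover have "card L = p ^ Suc r * card Y" using cL r by simp
    ultimately show ?thesis by blast
  qed
qed


definition power_image :: "nat \<Rightarrow> 'a set \<Rightarrow> 'a set" where
  "power_image p K = (\<lambda>x. x [^] p) ` K"

lemma power_image_subgroup:
  assumes K: "subgroup K G" shows "subgroup (power_image p K) G" "power_image p K \<subseteq> K"
proof -
  note Kc = subgroup.mem_carrier[OF K]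
  have pw: "x [^] p \<in> K" if "x \<in> K" for x
    using int_pow_in_subgroup[OF K that, of "int p"] by (simp add: int_pow_int)
  then show sub: "power_image p K \<subseteq> K" by (auto simp: power_image_def)
  show "subgroup (power_image p K) G"
  proof (rule subgroupI)
    show "power_image p K \<subseteq> carrier G" using sub Kc by blast
    show "power_image p K \<noteq> {}" using subgroup.one_closed[OF K] by (auto simp: power_image_def)
    fix a assume "a \<in> power_image p K"
    then obtain x where x: "x \<in> K" "a = x [^] p" by (auto simp: power_image_def)
    have "inv a = (inv x) [^] p" using x Kc by (simp add: nat_pow_inv)
    then show "inv a \<in> power_image p K" using x K by (auto simp: power_image_def subgroup.m_inv_closed)
    fix b assume "b \<in> power_image p K"
    then obtain y where y: "y \<in> K" "b = y [^] p" by (auto simp: power_image_def)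
    have "a \<otimes> b = (x \<otimes> y) [^] p" using x y Kc by (simp add: nat_pow_distrib)
    then show "a \<otimes> b \<in> power_image p K" using x y K by (auto simp: power_image_def subgroup.m_closed)
  qed
qed

definition prod_set :: "'a set \<Rightarrow> 'a set \<Rightarrow> 'a set" where
  "prod_set S T = {s \<otimes> t | s t. s \<in> S \<and> t \<in> T}"

lemma prod_set_subgroup:
  assumes S: "subgroup S G" and T: "subgroup T G" shows "subgroup (prod_set S T) G"
proof (rule subgroupI)
  note Sc = subgroup.mem_carrier[OF S] and Tc = subgroup.mem_carrier[OF T]
  show "prod_set S T \<subseteq> carrier G" using Sc Tc by (auto simp: prod_set_def)
  show "prod_set S T \<noteq> {}" using subgroup.one_closed[OF S] subgroup.one_closed[OF T] by (auto simp: prod_set_def)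
  fix a assume "a \<in> prod_set S T"
  then obtain s t where a: "s \<in> S" "t \<in> T" "a = s \<otimes> t" by (auto simp: prod_set_def)
  have "inv a = inv s \<otimes> inv t" using a Sc Tc by (simp add: inv_mult)
  then show "inv a \<in> prod_set S T" using a subgroup.m_inv_closed[OF S] subgroup.m_inv_closed[OF T]
    unfolding prod_set_def by blast
  fix b assume "b \<in> prod_set S T"
  then obtain s' t' where b: "s' \<in> S" "t' \<in> T" "b = s' \<otimes> t'" by (auto simp: prod_set_def)
  have "a \<otimes> b = (s \<otimes> s') \<otimes> (t \<otimes> t')" using a b Sc Tc by (simp add: m_ac)
  moreover have "s \<otimes> s' \<in> S" "t \<otimes> t' \<in> T" using a b S T by (auto simp: subgroup.m_closed)
  ultimately show "a \<otimes> b \<in> prod_set S T" unfolding prod_set_def by blast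
qed

lemma prod_set_sub_iff:
  assumes S: "subgroup S G" and T: "subgroup T G" and M: "subgroup M G"
  shows "prod_set S T \<subseteq> M \<longleftrightarrow> S \<subseteq> M \<and> T \<subseteq> M"
proof -
  note Sc = subgroup.mem_carrier[OF S] and Tc = subgroup.mem_carrier[OF T]
  have "s \<in> prod_set S T" if "s \<in> S" for s
  proof -
    have "s = s \<otimes> \<one>" using that Sc by simp
    then show ?thesis using that subgroup.one_closed[OF T] unfolding prod_set_def by blast
  qed
  moreover have "t \<in> prod_set S T" if "t \<in> T" for t
  proof -
    have "t = \<one> \<otimes> t" using that Tc by simp
    then show ?thesis using that subgroup.one_closed[OF S] unfolding prod_set_def by blast
  qed
  moreover have "prod_set S T \<subseteq> M" if "S \<subseteq> M" "T \<subseteq> M"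
    using that subgroup.m_closed[OF M] by (auto simp: prod_set_def)
  ultimately show ?thesis by blast
qed

text \<open>
  If \<open>K = S K\<^sup>p\<close>, then substituting this equation into itself gives \<open>K = S K\<^bsup>p\<^sup>j\<^esup>\<close> for every \<open>j\<close>, and the last
  factor is trivial for \<open>j = k\<close>.
\<close>

lemma nakayama_power_image:
  assumes S: "subgroup S G" "S \<subseteq> K" and K: "subgroup K G" and e: "\<And>x. x \<in> K \<Longrightarrow> x [^] ((p::nat) ^ k) = \<one>"
    and eq: "prod_set S (power_image p K) = K"
  shows "S = K"
proof -
  note Kc = subgroup.mem_carrier[OF K]
  have "\<forall>x\<in>K. \<exists>s\<in>S. \<exists>y\<in>K. x = s \<otimes> y [^] (p ^ j)" for j
  proof (induction j)
    case 0
    show ?case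
    proof
      fix x assume x: "x \<in> K"
      then have "x = \<one> \<otimes> x [^] (p ^ 0)" using Kc by simp
      then show "\<exists>s\<in>S. \<exists>y\<in>K. x = s \<otimes> y [^] (p ^ 0)" using x subgroup.one_closed[OF S(1)] by blast
    qed
  next
    case (Suc j)
    show ?case
    proof
      fix x assume "x \<in> K"
      then obtain s y where 1: "s \<in> S" "y \<in> K" "x = s \<otimes> y [^] (p ^ j)" using Suc by blast
      have "y \<in> prod_set S (power_image p K)" using 1(2) eq by simp
      then obtain s' z where 2: "s' \<in> S" "z \<in> K" "y = s' \<otimes> z [^] p"
        unfolding prod_set_def power_image_def by blast
      have c: "s \<in> carrier G" "s' \<in> carrier G" "z \<in> carrier G" using 1 2 S Kc by auto
      have "x = (s \<otimes> s' [^] (p ^ j)) \<otimes> z [^] (p ^ Suc j)"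
        unfolding 1(3) 2(3) using c by (simp add: nat_pow_distrib nat_pow_pow m_assoc)
      moreover have "s \<otimes> s' [^] (p ^ j) \<in> S"
        using 1 2 int_pow_in_subgroup[OF S(1), of s' "int (p ^ j)"] subgroup.m_closed[OF S(1)]
        unfolding int_pow_int by blast
      ultimately show "\<exists>s\<in>S. \<exists>y\<in>K. x = s \<otimes> y [^] (p ^ Suc j)" using 2 by blast
    qed
  qed
  note * = this[of k]
  have "K \<subseteq> S"
  proof
    fix x assume "x \<in> K"
    then obtain s y where sy: "s \<in> S" "y \<in> K" "x = s \<otimes> y [^] (p ^ k)" using * by blast
    then show "x \<in> S" using e[OF sy(2)] S Kc by auto
  qed
  then show ?thesis using S by blast
qed

text \<open>
  The subgroups of \<open>K\<close> of index \<open>p\<^sup>d\<close> with elementary abelian quotient: the subspaces of codimension \<open>d\<close>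
  of \<open>K / K\<^sup>p\<close>.
\<close>

definition hyper :: "nat \<Rightarrow> 'a set \<Rightarrow> nat \<Rightarrow> 'a set set" where
  "hyper p K d = {M. subgroup M G \<and> power_image p K \<subseteq> M \<and> M \<subseteq> K \<and> card K = p ^ d * card M}"

text \<open>
  By Nakayama, \<open>S = K\<close> holds exactly if \<open>S\<close> has image of codimension \<open>r = 0\<close> in \<open>K / K\<^sup>p\<close>. The number of
  codimension \<open>d\<close> subspaces that contain the image is a Gaussian binomial coefficient in \<open>r\<close>, so \<open>T D\<close> is a
  truncated alternating sum: it equals \<open>1\<close> for \<open>r = 0\<close> and has the sign of \<open>(-1) ^ D\<close> for \<open>r > 0\<close>.
\<close>

theorem bonferroni_generation:
  assumes K: "subgroup K G" "finite K" and S: "subgroup S G" and p: "Factorial_Ring.prime p"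
    and e: "\<And>x. x \<in> K \<Longrightarrow> x [^] (p ^ k) = \<one>"
  defines "T \<equiv> \<lambda>D. \<Sum>d\<le>D. (-1) ^ d * real p ^ (d choose 2) * real (card {M \<in> hyper p K d. S \<subseteq> M})"
  shows "even D \<Longrightarrow> (if S = K then 1 else 0) \<le> T D" "odd D \<Longrightarrow> T D \<le> (if S = K then 1 else 0)"
proof -
  have "(even D \<longrightarrow> (if S = K then 1 else 0) \<le> T D) \<and> (odd D \<longrightarrow> T D \<le> (if S = K then 1 else 0))"
  proof (cases "S \<subseteq> K")
    case False
    then have none: "{M \<in> hyper p K d. S \<subseteq> M} = {}" for d by (auto simp: hyper_def)
    have "T D = 0" unfolding T_def none by simp
    then show ?thesis using False by auto
  next
    case True
    note P = power_image_subgroup[OF K(1), of p]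
    define Y where "Y = prod_set S (power_image p K)"
    have YG: "subgroup Y G" unfolding Y_def by (rule prod_set_subgroup[OF S P(1)])
    have YK: "Y \<subseteq> K" "S \<subseteq> Y" "power_image p K \<subseteq> Y"
      using prod_set_sub_iff[OF S P(1) K(1)] prod_set_sub_iff[OF S P(1) YG] True P(2) by (auto simp: Y_def)
    have h: "{M \<in> hyper p K d. S \<subseteq> M} = {M. subgroup M G \<and> Y \<subseteq> M \<and> M \<subseteq> K \<and> card K = p ^ d * card M}" for d
      using prod_set_sub_iff[OF S P(1)] by (auto simp: hyper_def Y_def)
    obtain r where r: "card K = p ^ r * card Y"
      and cnt: "\<And>d. card {M \<in> hyper p K d. S \<subseteq> M} = gbinom p r d"
      using gaussian_subgroup_count[OF YG K YK(1) _ p] YK(3) unfolding h power_image_def by blast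
    have p2: "p \<ge> 2" using p by (rule prime_ge_2_nat)
    show ?thesis
    proof (cases r)
      case 0
      then have "Y = K" using r card_subset_eq[OF K(2) YK(1)] by simp
      then have "S = K" using nakayama_power_image[OF S True K(1) e] by (simp add: Y_def)
      moreover have "T D = 1" unfolding T_def cnt 0 by (rule gbinom_alternating_sum_0)
      ultimately show ?thesis by simp
    next
      case (Suc r')
      have "Y \<noteq> K"
      proof
        assume "Y = K"
        then have "card Y = p ^ r * card Y" using r by simp
        moreover have "card Y > 0"
          using YK(1) K(2) subgroup.one_closed[OF YG] finite_subset by (auto simp: card_gt_0_iff)
        ultimately show False using p2 Suc one_less_power[of p r] by simp
      qed
      then have "S \<noteq> K" using YK by blast
      moreover have "T D = (-1) ^ D * (real p ^ (Suc D choose 2) * real (gbinom p r' D))"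
        unfolding T_def cnt Suc using gbinom_alternating_sum by (simp add: mult.assoc)
      ultimately show ?thesis by simp
    qed
  qed
  then show "even D \<Longrightarrow> (if S = K then 1 else 0) \<le> T D" "odd D \<Longrightarrow> T D \<le> (if S = K then 1 else 0)" by auto
qed

lemma card_hyper:
  assumes K: "subgroup K G" "finite K" and p: "Factorial_Ring.prime p"
    and c: "card K = p ^ n * card (power_image p K)"
  shows "card (hyper p K d) = gbinom p n d"
proof -
  note P = power_image_subgroup[OF K(1), of p]
  obtain r where r: "card K = p ^ r * card (power_image p K)"
    and cnt: "\<And>d. card (hyper p K d) = gbinom p r d"
    using gaussian_subgroup_count[OF P(1) K P(2) _ p] unfolding hyper_def power_image_def by blast
  have "card (power_image p K) > 0"
    using P K(2) subgroup.one_closed[OF P(1)] finite_subset by (auto simp: card_gt_0_iff)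
  then have "p ^ r = p ^ n" using r c by simp
  then have "r = n" using prime_gt_1_nat[OF p] by (simp add: power_inject_exp)
  then show ?thesis using cnt by simp
qed

end

section \<open>Lattices as relations of generating tuples\<close>

lemma card_hom_image_kernel:
  assumes A: "group A" and B: "group B" and K: "subgroup K A" "finite K"
    and f: "\<And>x. x \<in> K \<Longrightarrow> f x \<in> carrier B"
    and hom: "\<And>x y. x \<in> K \<Longrightarrow> y \<in> K \<Longrightarrow> f (x \<otimes>\<^bsub>A\<^esub> y) = f x \<otimes>\<^bsub>B\<^esub> f y"
  shows "card K = card (f ` K) * card {x \<in> K. f x = \<one>\<^bsub>B\<^esub>}"
proof -
  interpret A: group A by fact
  interpret B: group B by fact
  note Kc = subgroup.mem_carrier[OF K(1)]
  let ?Z = "{x \<in> K. f x = \<one>\<^bsub>B\<^esub>}"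
  have fib: "card {x \<in> K. f x = f t} = card ?Z" if t: "t \<in> K" for t
  proof -
    have "f \<one>\<^bsub>A\<^esub> \<otimes>\<^bsub>B\<^esub> f \<one>\<^bsub>A\<^esub> = f \<one>\<^bsub>A\<^esub>"
      using hom[of "\<one>\<^bsub>A\<^esub>" "\<one>\<^bsub>A\<^esub>"] subgroup.one_closed[OF K(1)] by simp
    then have f1: "f \<one>\<^bsub>A\<^esub> = \<one>\<^bsub>B\<^esub>"
      using f[OF subgroup.one_closed[OF K(1)]] by simp
    have "{x \<in> K. f x = f t} = (\<lambda>z. z \<otimes>\<^bsub>A\<^esub> t) ` ?Z"
    proof
      show "(\<lambda>z. z \<otimes>\<^bsub>A\<^esub> t) ` ?Z \<subseteq> {x \<in> K. f x = f t}"
        using t f hom subgroup.m_closed[OF K(1)] by auto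
      show "{x \<in> K. f x = f t} \<subseteq> (\<lambda>z. z \<otimes>\<^bsub>A\<^esub> t) ` ?Z"
      proof
        fix x assume x: "x \<in> {x \<in> K. f x = f t}"
        let ?z = "x \<otimes>\<^bsub>A\<^esub> inv\<^bsub>A\<^esub> t"
        have it: "inv\<^bsub>A\<^esub> t \<in> K" using t K by (simp add: subgroup.m_inv_closed)
        then have zK: "?z \<in> K" using x K by (simp add: subgroup.m_closed)
        have "f ?z = f x \<otimes>\<^bsub>B\<^esub> f (inv\<^bsub>A\<^esub> t)" using x it by (simp add: hom)
        also have "f x = f t" using x by simp
        also have "f t \<otimes>\<^bsub>B\<^esub> f (inv\<^bsub>A\<^esub> t) = \<one>\<^bsub>B\<^esub>"
          using hom[OF t it] f1 t Kc by simp
        finally have "?z \<in> ?Z" using zK by simp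
        moreover have "x = ?z \<otimes>\<^bsub>A\<^esub> t" using x t Kc by (simp add: A.m_assoc)
        ultimately show "x \<in> (\<lambda>z. z \<otimes>\<^bsub>A\<^esub> t) ` ?Z" by blast
      qed
    qed
    moreover have "inj_on (\<lambda>z. z \<otimes>\<^bsub>A\<^esub> t) ?Z" using t Kc by (intro inj_onI) simp
    ultimately show ?thesis by (simp add: card_image)
  qed
  have "card K = (\<Sum>y\<in>f ` K. \<Sum>x | x \<in> K \<and> f x = y. 1)"
    using sum.group[of K "f ` K" f "\<lambda>_. 1::nat"] K by simp
  also have "\<dots> = (\<Sum>y\<in>f ` K. card ?Z)" by (rule sum.cong[OF refl]) (auto simp: fib)
  finally show ?thesis by simp
qed

text \<open>
  An isomorphism out of a quotient is recorded as a surjection with the prescribed kernel, so that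
  cosets disappear from the later arguments.
\<close>

lemma quotient_iso_as_hom:
  assumes Z: "comm_group Z" and I: "subgroup I Z" and G: "group G" and \<psi>: "\<psi> \<in> iso (Z Mod I) G"
  obtains \<Psi> where "\<Psi> \<in> hom Z G" "\<Psi> ` carrier Z = carrier G"
    "\<And>x. x \<in> carrier Z \<Longrightarrow> \<Psi> x = \<one>\<^bsub>G\<^esub> \<longleftrightarrow> x \<in> I"
proof
  interpret Z: comm_group Z by fact
  interpret G: group G by fact
  have nI: "I \<lhd> Z" using I by (rule Z.subgroup_imp_normal)
  interpret Q: group "Z Mod I" by (rule normal.factorgroup_is_group[OF nI])
  interpret h: group_hom "Z Mod I" G \<psi> using \<psi> by unfold_locales (simp add: iso_def)
  define \<Psi> where "\<Psi> x = \<psi> (I #>\<^bsub>Z\<^esub> x)" for x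
  have r: "(\<lambda>x. I #>\<^bsub>Z\<^esub> x) \<in> hom Z (Z Mod I)" by (rule normal.r_coset_hom_Mod[OF nI])
  show "\<Psi> \<in> hom Z G"
    using r \<psi> unfolding \<Psi>_def[abs_def] by (auto simp: hom_def iso_def Pi_iff)
  have "carrier G = \<psi> ` carrier (Z Mod I)" using \<psi> by (simp add: iso_def bij_betw_def)
  then show "\<Psi> ` carrier Z = carrier G" unfolding carrier_FactGroup \<Psi>_def[abs_def] image_image ..
  fix x assume x: "x \<in> carrier Z"
  have 1: "I #>\<^bsub>Z\<^esub> x \<in> carrier (Z Mod I)" using r x by (auto simp: hom_def)
  have 2: "inj_on \<psi> (carrier (Z Mod I))" using \<psi> by (simp add: iso_def bij_betw_def)
  have 3: "\<one>\<^bsub>Z Mod I\<^esub> \<in> carrier (Z Mod I)" using Q.subgroup_self by (rule subgroup.one_closed)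
  have "\<Psi> x = \<one>\<^bsub>G\<^esub> \<longleftrightarrow> \<psi> (I #>\<^bsub>Z\<^esub> x) = \<psi> \<one>\<^bsub>Z Mod I\<^esub>" unfolding h.hom_one \<Psi>_def ..
  also have "\<dots> \<longleftrightarrow> I #>\<^bsub>Z\<^esub> x = \<one>\<^bsub>Z Mod I\<^esub>" by (rule inj_on_eq_iff[OF 2 1 3])
  also have "\<dots> \<longleftrightarrow> I #>\<^bsub>Z\<^esub> x = I" by (simp add: FactGroup_def)
  also have "\<dots> \<longleftrightarrow> x \<in> I" using Z.coset_join1[OF _ x I] Z.coset_join2[OF x I] by blast
  finally show "\<Psi> x = \<one>\<^bsub>G\<^esub> \<longleftrightarrow> x \<in> I" .
qed

definition vecs :: "nat \<Rightarrow> nat \<Rightarrow> (nat \<Rightarrow> int) monoid" where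
  "vecs q n = product_group {1..n} (\<lambda>_. integer_mod_group q)"

lemma carrier_vecs: "q > 0 \<Longrightarrow> carrier (vecs q n) = PiE {1..n} (\<lambda>_. {0..<int q})"
  by (simp add: vecs_def carrier_integer_mod_group)

lemma finite_vecs: "q > 0 \<Longrightarrow> finite (carrier (vecs q n))"
  unfolding carrier_vecs by (intro finite_PiE) auto

lemma one_vecs: "\<one>\<^bsub>vecs q n\<^esub> = (\<lambda>i\<in>{1..n}. 0)" by (simp add: vecs_def)

lemma mult_vecs: "x \<otimes>\<^bsub>vecs q n\<^esub> y = (\<lambda>i\<in>{1..n}. (x i + y i) mod int q)" by (simp add: vecs_def)

lemma group_vecs: "group (vecs q n)"
  unfolding vecs_def by (intro product_group) simp

lemma comm_group_vecs: "comm_group (vecs q n)"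
  by (rule group.group_comm_groupI[OF group_vecs]) (auto simp: mult_vecs add.commute)

lemma pow_vecs: "x \<in> carrier (vecs q n) \<Longrightarrow> x [^]\<^bsub>vecs q n\<^esub> (a::nat) = (\<lambda>i\<in>{1..n}. (int a * x i) mod int q)"
proof (induction a)
  case 0
  then show ?case by (simp add: one_vecs monoid.nat_pow_0 group.is_monoid[OF group_vecs])
next
  case (Suc a)
  then show ?case
    by (simp add: monoid.nat_pow_Suc[OF group.is_monoid[OF group_vecs]] mult_vecs)
       (auto simp: mod_simps algebra_simps intro!: restrict_ext)
qed

definition unit_vec :: "nat \<Rightarrow> nat \<Rightarrow> nat \<Rightarrow> (nat \<Rightarrow> int)" where
  "unit_vec q n i = (\<lambda>j\<in>{1..n}. if j = i then 1 mod int q else 0)"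

lemma unit_vec_in: "q > 0 \<Longrightarrow> unit_vec q n i \<in> carrier (vecs q n)"
  by (auto simp: carrier_vecs unit_vec_def)

definition lincomb :: "('g, 'b) monoid_scheme \<Rightarrow> nat \<Rightarrow> (nat \<Rightarrow> 'g) \<Rightarrow> (nat \<Rightarrow> int) \<Rightarrow> 'g" where
  "lincomb G n g x = (\<Otimes>\<^bsub>G\<^esub>i\<in>{1..n}. g i [^]\<^bsub>G\<^esub> x i)"

lemma hom_vecs_eq_lincomb:
  assumes q: "q > 0" and G: "comm_group G" and h: "h \<in> hom (vecs q n) G" and x: "x \<in> carrier (vecs q n)"
  shows "h x = lincomb G n (\<lambda>i. h (unit_vec q n i)) x"
proof -
  interpret G: comm_group G by fact
  interpret V: comm_group "vecs q n" by (rule comm_group_vecs)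
  interpret h: group_hom "vecs q n" G h by unfold_locales (rule h)
  define r where "r S = (\<lambda>i\<in>{1..n}. if i \<in> S then x i else 0)" for S
  have hc: "h (unit_vec q n i) \<in> carrier G" for i using unit_vec_in[OF q] by simp
  have xr: "x i \<in> {0..<int q}" if "i \<in> {1..n}" for i using x that by (auto simp: carrier_vecs[OF q])
  have rc: "r S \<in> carrier (vecs q n)" for S using xr q by (auto simp: carrier_vecs[OF q] r_def)
  have "h (r S) = (\<Otimes>\<^bsub>G\<^esub>i\<in>S. h (unit_vec q n i) [^]\<^bsub>G\<^esub> x i)" if "finite S" "S \<subseteq> {1..n}" for S
    using that
  proof (induction S rule: finite_induct)
    case empty
    have "r {} = \<one>\<^bsub>vecs q n\<^esub>" by (simp add: r_def one_vecs cong: restrict_cong)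
    then show ?case by simp
  next
    case (insert i S)
    have i: "i \<in> {1..n}" using insert by simp
    let ?e = "unit_vec q n i"
    have "r (insert i S) = ?e [^]\<^bsub>vecs q n\<^esub> nat (x i) \<otimes>\<^bsub>vecs q n\<^esub> r S"
      unfolding pow_vecs[OF unit_vec_in[OF q]] mult_vecs
    proof
      fix j
      have xm: "x j mod int q = x j" if "j \<in> {1..n}" for j using xr[OF that] by simp
      have xn: "int (nat (x i)) = x i" using xr[OF i] by simp
      show "r (insert i S) j = (\<lambda>j\<in>{1..n}. ((\<lambda>j\<in>{1..n}. int (nat (x i)) * unit_vec q n i j mod int q) j + r S j) mod int q) j"
        using insert.hyps(2) xm[of j] i unfolding xn by (auto simp: r_def unit_vec_def mod_simps)
    qed
    then have "h (r (insert i S)) = h ?e [^]\<^bsub>G\<^esub> nat (x i) \<otimes>\<^bsub>G\<^esub> h (r S)"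
      using rc unit_vec_in[OF q] by (simp add: h.hom_nat_pow)
    also have "h ?e [^]\<^bsub>G\<^esub> nat (x i) = h ?e [^]\<^bsub>G\<^esub> x i"
      using xr[OF i] by (metis int_pow_int atLeastLessThan_iff int_nat_eq)
    finally show ?case using insert hc by (simp add: Pi_iff)
  qed
  from this[of "{1..n}"] have "h (r {1..n}) = lincomb G n (\<lambda>i. h (unit_vec q n i)) x" by (simp add: lincomb_def)
  moreover have "r {1..n} = x" using x unfolding carrier_vecs[OF q] r_def by (intro ext) (auto simp: PiE_iff extensional_def)
  ultimately show ?thesis by simp
qed

context finite_p_exponent_group
begin

lemma lincomb_closed: "g \<in> {1..n} \<rightarrow> carrier G \<Longrightarrow> lincomb G n g x \<in> carrier G"
  unfolding lincomb_def by (intro finprod_closed) auto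

lemma lincomb_hom:
  assumes g: "g \<in> {1..n} \<rightarrow> carrier G"
  shows "lincomb G n g \<in> hom (vecs q n) G"
proof (rule homI)
  fix x y
  have "(\<Otimes>i\<in>{1..n}. g i [^] ((x \<otimes>\<^bsub>vecs q n\<^esub> y) i)) = (\<Otimes>i\<in>{1..n}. g i [^] x i \<otimes> g i [^] y i)"
  proof (rule finprod_cong')
    fix i assume i: "i \<in> {1..n}"
    have gi: "g i \<in> carrier G" using g i by auto
    have "g i [^] ((x i + y i) mod int q) = g i [^] (x i + y i)"
      by (rule int_pow_cong[OF gi e[OF gi]]) (simp add: mod_eq_dvd_iff[symmetric])
    then show "g i [^] ((x \<otimes>\<^bsub>vecs q n\<^esub> y) i) = g i [^] x i \<otimes> g i [^] y i"
      using gi i by (simp add: mult_vecs int_pow_mult)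
  qed (use g in auto)
  then show "lincomb G n g (x \<otimes>\<^bsub>vecs q n\<^esub> y) = lincomb G n g x \<otimes> lincomb G n g y"
    unfolding lincomb_def using g by (subst finprod_multf[symmetric]) auto
qed (rule lincomb_closed[OF g])

lemma lincomb_unit_vec:
  assumes g: "g \<in> {1..n} \<rightarrow> carrier G" and i: "i \<in> {1..n}"
  shows "lincomb G n g (unit_vec q n i) = g i"
proof -
  have gi: "g i \<in> carrier G" using g i by auto
  have "lincomb G n g (unit_vec q n i) = (\<Otimes>j\<in>{1..n}. if i = j then g j else \<one>)"
    unfolding lincomb_def
  proof (rule finprod_cong')
    fix j assume j: "j \<in> {1..n}"
    have gj: "g j \<in> carrier G" using g j by auto
    have "g j [^] (1 mod int q) = g j [^] (1::int)"
      by (rule int_pow_cong[OF gj e[OF gj]]) (simp add: mod_eq_dvd_iff[symmetric])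
    then show "g j [^] unit_vec q n i j = (if i = j then g j else \<one>)"
      using j gj by (simp add: unit_vec_def int_pow_1)
  qed (use g in auto)
  also have "\<dots> = g i" using i g by (subst finprod_singleton) auto
  finally show ?thesis .
qed

definition relations :: "nat \<Rightarrow> (nat \<Rightarrow> 'a) \<Rightarrow> (nat \<Rightarrow> int) set" where
  "relations n g = {x \<in> carrier (vecs q n). lincomb G n g x = \<one>}"

lemma lincomb_image_gens:
  assumes "g \<in> gens n" shows "lincomb G n g ` carrier (vecs q n) = carrier G"
proof
  have g: "g \<in> {1..n} \<rightarrow> carrier G" using assms by (auto simp: gens_def)
  interpret V: group "vecs q n" by (rule group_vecs)
  interpret h: group_hom "vecs q n" G "lincomb G n g" by unfold_locales (rule lincomb_hom[OF g])
  show "lincomb G n g ` carrier (vecs q n) \<subseteq> carrier G" using lincomb_closed[OF g] by auto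
  have sub: "subgroup (lincomb G n g ` carrier (vecs q n)) G" by (rule h.img_is_subgroup)
  have "g ` {1..n} \<subseteq> lincomb G n g ` carrier (vecs q n)"
    using lincomb_unit_vec[OF g] unit_vec_in[OF q_pos] by (metis (no_types, lifting) image_eqI image_subsetI)
  then have "generate G (g ` {1..n}) \<subseteq> lincomb G n g ` carrier (vecs q n)"
    by (rule generate_subgroup_incl[OF _ sub])
  then show "carrier G \<subseteq> lincomb G n g ` carrier (vecs q n)" using assms by (simp add: gens_def)
qed

lemma gens_funcset: "g \<in> gens n \<Longrightarrow> g \<in> {1..n} \<rightarrow> carrier G"
  by (auto simp: gens_def)

lemma gensI:
  assumes "g \<in> PiE {1..n} (\<lambda>_. carrier G)" "carrier G \<subseteq> lincomb G n g ` carrier (vecs q n)"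
  shows "g \<in> gens n"
proof -
  have g: "g ` {1..n} \<subseteq> carrier G" "g \<in> {1..n} \<rightarrow> carrier G" using assms by auto
  note B = generate_facts[OF g(1)]
  have "lincomb G n g x \<in> generate G (g ` {1..n})" for x
  proof -
    have "(\<Otimes>i\<in>S. g i [^] x i) \<in> generate G (g ` {1..n})" if "finite S" "S \<subseteq> {1..n}" for S
      using that
    proof (induction S rule: finite_induct)
      case empty
      then show ?case using subgroup.one_closed[OF B(1)] by simp
    next
      case (insert i S)
      then have "(\<Otimes>i\<in>insert i S. g i [^] x i) = g i [^] x i \<otimes> (\<Otimes>i\<in>S. g i [^] x i)"
        using g by (intro finprod_insert) auto
      moreover have "g i [^] x i \<in> generate G (g ` {1..n})"
        using insert by (intro int_pow_in_subgroup[OF B(1)] generate.incl) auto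
      ultimately show ?case using insert subgroup.m_closed[OF B(1)] by simp
    qed
    then show ?thesis by (simp add: lincomb_def)
  qed
  then show ?thesis using assms B(4) unfolding gens_def by blast
qed

text \<open>
  A homomorphism on the module of vectors is determined by the images of the unit vectors; these form
  the tuple \<open>g\<close>.
\<close>

lemma surjection_presentation:
  assumes \<Phi>: "\<Phi> \<in> hom (vecs q n) G" and surj: "\<Phi> ` carrier (vecs q n) = carrier G"
  shows "\<exists>g\<in>gens n. relations n g = {v \<in> carrier (vecs q n). \<Phi> v = \<one>}"
proof -
  define g where "g = (\<lambda>i\<in>{1..n}. \<Phi> (unit_vec q n i))"
  have uc: "\<Phi> (unit_vec q n i) \<in> carrier G" for i using \<Phi> unit_vec_in[OF q_pos] by (auto simp: hom_def)
  have lin: "lincomb G n g v = \<Phi> v" if v: "v \<in> carrier (vecs q n)" for v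
  proof -
    have "lincomb G n g v = lincomb G n (\<lambda>i. \<Phi> (unit_vec q n i)) v"
      unfolding lincomb_def using uc by (intro finprod_cong') (auto simp: g_def)
    also have "\<dots> = \<Phi> v" by (rule hom_vecs_eq_lincomb[OF q_pos comm_group_axioms \<Phi> v, symmetric])
    finally show ?thesis .
  qed
  have "lincomb G n g ` carrier (vecs q n) = \<Phi> ` carrier (vecs q n)" by (rule image_cong[OF refl lin])
  then have "g \<in> gens n" using uc surj by (intro gensI) (auto simp: g_def)
  moreover have "relations n g = {v \<in> carrier (vecs q n). \<Phi> v = \<one>}"
    unfolding relations_def using lin by auto
  ultimately show ?thesis by blast
qed

lemma relations_subgroup:
  assumes g: "g \<in> {1..n} \<rightarrow> carrier G" shows "subgroup (relations n g) (vecs q n)"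
proof -
  interpret V: group "vecs q n" by (rule group_vecs)
  interpret h: group_hom "vecs q n" G "lincomb G n g" by unfold_locales (rule lincomb_hom[OF g])
  have "relations n g = kernel (vecs q n) G (lincomb G n g)" by (simp add: relations_def kernel_def)
  then show ?thesis using h.subgroup_kernel by simp
qed

lemma card_relations:
  assumes g: "g \<in> gens n" shows "card (carrier (vecs q n)) = order G * card (relations n g)"
proof -
  note h = lincomb_hom[OF gens_funcset[OF g]]
  note gr = group_vecs[of q n]
  have "card (carrier (vecs q n)) = card (lincomb G n g ` carrier (vecs q n)) * card {x \<in> carrier (vecs q n). lincomb G n g x = \<one>}"
    using h by (intro card_hom_image_kernel[OF gr is_group group.subgroup_self[OF gr] finite_vecs[OF q_pos]]) (auto simp: hom_def)
  then show ?thesis unfolding lincomb_image_gens[OF g] by (simp add: order_def relations_def)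
qed

lemma hit_eq_sum_relations:
  assumes g: "g \<in> {1..n} \<rightarrow> carrier G"
  shows "hit {1..n} w g = (\<Sum>x\<in>relations n g. \<Prod>i\<in>{1..n}. w i (x i))"
proof -
  have c: "(\<Otimes>i\<in>{1..n}. g i [^] (x i::int)) \<in> carrier G" for x using g by (intro finprod_closed) auto
  have "hit {1..n} w g = (\<Sum>x\<in>carrier (vecs q n). if lincomb G n g x = \<one> then (\<Prod>i\<in>{1..n}. w i (x i)) else 0)"
    unfolding hit_def walk_def carrier_vecs[OF q_pos] lincomb_def using c by (intro sum.cong refl) simp
  also have "\<dots> = (\<Sum>x\<in>relations n g. \<Prod>i\<in>{1..n}. w i (x i))"
    unfolding relations_def by (rule sum.inter_filter[OF finite_vecs[OF q_pos], symmetric])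
  finally show ?thesis .
qed

text \<open>
  Two generating tuples have the same relations if and only if an automorphism carries one to the
  other, and that automorphism is unique since the tuples generate.
\<close>

lemma card_gens_fibre:
  assumes g0: "g0 \<in> gens n"
  shows "card {g \<in> gens n. relations n g = relations n g0} = order (AutoGroup G)"
proof -
  let ?V = "carrier (vecs q n)"
  let ?ev = "lincomb G n"
  let ?act = "\<lambda>\<phi>. \<lambda>i\<in>{1..n}. \<phi> (g0 i)"
  note f0 = gens_funcset[OF g0]
  interpret V: group "vecs q n" by (rule group_vecs)
  have act_ev: "?ev (?act \<phi>) x = \<phi> (?ev g0 x)" if \<phi>: "\<phi> \<in> hom G G" and x: "x \<in> ?V" for \<phi> x
  proof -
    have "\<phi> \<circ> ?ev g0 \<in> hom (vecs q n) G" using lincomb_hom[OF f0] \<phi> by (auto simp: hom_def Pi_iff)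
    from hom_vecs_eq_lincomb[OF q_pos comm_group_axioms this x]
    have "\<phi> (?ev g0 x) = lincomb G n (\<lambda>i. \<phi> (?ev g0 (unit_vec q n i))) x" by simp
    also have "\<dots> = ?ev (?act \<phi>) x"
    proof -
      have c: "\<phi> (g0 i) \<in> carrier G" if "i \<in> {1..n}" for i
        using f0 \<phi> that by (auto simp: hom_def Pi_iff)
      show ?thesis
        unfolding lincomb_def[of G n "?act \<phi>"] lincomb_def[of G n "\<lambda>i. \<phi> (?ev g0 (unit_vec q n i))"]
        using lincomb_unit_vec[OF f0] c by (intro finprod_cong') auto
    qed
    finally show ?thesis by simp
  qed
  have "bij_betw ?act (auto G) {g \<in> gens n. relations n g = relations n g0}"
  proof (rule bij_betwI')
    fix \<phi> \<psi> assume \<phi>: "\<phi> \<in> auto G" and \<psi>: "\<psi> \<in> auto G"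
    have hs: "\<phi> \<in> hom G G" "\<psi> \<in> hom G G" "\<phi> \<in> extensional (carrier G)" "\<psi> \<in> extensional (carrier G)"
      using \<phi> \<psi> by (auto simp: auto_def Bij_def)
    show "?act \<phi> = ?act \<psi> \<longleftrightarrow> \<phi> = \<psi>"
    proof
      assume eq: "?act \<phi> = ?act \<psi>"
      show "\<phi> = \<psi>"
      proof (rule extensionalityI[OF hs(3,4)])
        fix y assume "y \<in> carrier G"
        then obtain x where x: "x \<in> ?V" "y = ?ev g0 x" using lincomb_image_gens[OF g0] by auto
        then show "\<phi> y = \<psi> y" using act_ev[OF hs(1) x(1)] act_ev[OF hs(2) x(1)] eq by simp
      qed
    qed simp
  next
    fix \<phi> assume \<phi>: "\<phi> \<in> auto G"
    have h: "\<phi> \<in> hom G G" and b: "bij_betw \<phi> (carrier G) (carrier G)" using \<phi> by (auto simp: auto_def Bij_def)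
    have aP: "?act \<phi> \<in> PiE {1..n} (\<lambda>_. carrier G)" using f0 h by (auto simp: hom_def)
    have "carrier G \<subseteq> ?ev (?act \<phi>) ` ?V"
    proof
      fix y assume "y \<in> carrier G"
      then obtain z where z: "z \<in> carrier G" "y = \<phi> z" using b by (auto simp: bij_betw_def)
      then obtain x where "x \<in> ?V" "z = ?ev g0 x" using lincomb_image_gens[OF g0] by auto
      then show "y \<in> ?ev (?act \<phi>) ` ?V" using act_ev[OF h] z by (auto intro!: image_eqI[of _ _ x])
    qed
    then have "?act \<phi> \<in> gens n" by (rule gensI[OF aP])
    moreover have "\<phi> z = \<one> \<longleftrightarrow> z = \<one>" if "z \<in> carrier G" for z
      using b h that hom_one[OF h is_group is_group] by (metis bij_betw_def inj_onD one_closed)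
    then have "relations n (?act \<phi>) = relations n g0"
      using act_ev[OF h] lincomb_closed[OF f0] by (auto simp: relations_def)
    ultimately show "?act \<phi> \<in> {g \<in> gens n. relations n g = relations n g0}" by simp
  next
    fix g assume "g \<in> {g \<in> gens n. relations n g = relations n g0}"
    then have g: "g \<in> gens n" and rel: "relations n g = relations n g0" by auto
    note f = gens_funcset[OF g]
    \<comment> \<open>any section of the surjection given by \<open>g0\<close>; the automorphism sends \<open>y\<close> to the image of \<open>s y\<close> under \<open>g\<close>\<close>
    define s where "s y = (SOME x. x \<in> ?V \<and> ?ev g0 x = y)" for y
    have s: "s y \<in> ?V" "?ev g0 (s y) = y" if "y \<in> carrier G" for y
    proof -
      have "\<exists>x. x \<in> ?V \<and> ?ev g0 x = y" using lincomb_image_gens[OF g0] that by (auto simp: set_eq_iff image_iff) metis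
      from someI_ex[OF this] show "s y \<in> ?V" "?ev g0 (s y) = y" by (auto simp: s_def)
    qed
    have welldef: "?ev g x = ?ev g y \<longleftrightarrow> ?ev g0 x = ?ev g0 y" if x: "x \<in> ?V" and y: "y \<in> ?V" for x y
    proof -
      let ?z = "x \<otimes>\<^bsub>vecs q n\<^esub> inv\<^bsub>vecs q n\<^esub> y"
      have z: "?z \<in> ?V" using x y by simp
      have *: "?ev g' x = ?ev g' y \<longleftrightarrow> ?z \<in> relations n g'" if g': "g' \<in> {1..n} \<rightarrow> carrier G" for g'
      proof -
        interpret h: group_hom "vecs q n" G "?ev g'" by unfold_locales (rule lincomb_hom[OF g'])
        have "?ev g' ?z = ?ev g' x \<otimes> inv (?ev g' y)" using x y by simp
        then show ?thesis using z x y by (auto simp: relations_def) (metis h.hom_closed inv_solve_right' l_one one_closed)+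
      qed
      show ?thesis using *[OF f] *[OF f0] rel by simp
    qed
    define \<phi> where "\<phi> = (\<lambda>y\<in>carrier G. ?ev g (s y))"
    have \<phi>_ev: "\<phi> (?ev g0 x) = ?ev g x" if x: "x \<in> ?V" for x
      using s[OF lincomb_closed[OF f0, of x]] lincomb_closed[OF f0, of x] x welldef by (simp add: \<phi>_def)
    interpret h: group_hom "vecs q n" G "?ev g" by unfold_locales (rule lincomb_hom[OF f])
    interpret h0: group_hom "vecs q n" G "?ev g0" by unfold_locales (rule lincomb_hom[OF f0])
    have hom: "\<phi> \<in> hom G G"
    proof (rule homI)
      fix y z assume yz: "y \<in> carrier G" "z \<in> carrier G"
      have "y \<otimes> z = ?ev g0 (s y \<otimes>\<^bsub>vecs q n\<^esub> s z)" using s yz by simp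
      then have "\<phi> (y \<otimes> z) = ?ev g (s y \<otimes>\<^bsub>vecs q n\<^esub> s z)"
        by (simp only:) (rule \<phi>_ev, use s yz in simp)
      also have "\<dots> = \<phi> y \<otimes> \<phi> z" using s yz by (simp add: \<phi>_def)
      finally show "\<phi> (y \<otimes> z) = \<phi> y \<otimes> \<phi> z" .
    qed (use s in \<open>auto simp: \<phi>_def\<close>)
    have "inj_on \<phi> (carrier G)"
    proof (rule inj_onI)
      fix y z assume yz: "y \<in> carrier G" "z \<in> carrier G" "\<phi> y = \<phi> z"
      then have "?ev g (s y) = ?ev g (s z)" by (simp add: \<phi>_def)
      then show "y = z" using welldef s yz by metis
    qed
    moreover have "\<phi> ` carrier G = carrier G"
    proof
      show "\<phi> ` carrier G \<subseteq> carrier G" using hom by (auto simp: hom_def)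
      show "carrier G \<subseteq> \<phi> ` carrier G"
      proof
        fix y assume "y \<in> carrier G"
        then obtain x where "x \<in> ?V" "y = ?ev g x" using lincomb_image_gens[OF g] by auto
        then show "y \<in> \<phi> ` carrier G" using \<phi>_ev lincomb_closed[OF f0] by (metis imageI)
      qed
    qed
    ultimately have "\<phi> \<in> auto G" using hom by (simp add: auto_def Bij_def bij_betw_def \<phi>_def)
    moreover have "g = ?act \<phi>"
    proof (rule extensionalityI[of _ "{1..n}"])
      show "g \<in> extensional {1..n}" using g by (auto simp: gens_def PiE_def)
      fix i assume i: "i \<in> {1..n}"
      have "\<phi> (g0 i) = \<phi> (?ev g0 (unit_vec q n i))" using lincomb_unit_vec[OF f0 i] by simp
      also have "\<dots> = g i" using \<phi>_ev unit_vec_in[OF q_pos] lincomb_unit_vec[OF f i] by simp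
      finally show "g i = ?act \<phi> i" using i by simp
    qed simp
    ultimately show "\<exists>\<phi>\<in>auto G. g = ?act \<phi>" by blast
  qed
  then have "card (auto G) = card {g \<in> gens n. relations n g = relations n g0}" by (rule bij_betw_same_card)
  then show ?thesis by (simp add: order_def AutoGroup_def)
qed

lemma card_gens_eq: "card (gens n) = card (relations n ` gens n) * order (AutoGroup G)"
proof -
  have "card (gens n) = (\<Sum>K\<in>relations n ` gens n. \<Sum>g | g \<in> gens n \<and> relations n g = K. 1)"
    using sum.group[of "gens n" "relations n ` gens n" "relations n" "\<lambda>_. 1::nat"] finite_gens by simp
  also have "\<dots> = (\<Sum>K\<in>relations n ` gens n. order (AutoGroup G))"
    by (rule sum.cong[OF refl]) (auto simp: card_gens_fibre)
  finally show ?thesis by simp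
qed

text \<open>
  A tuple that does not generate lies in one of boundedly many proper subgroups, each of which has
  at most half of the elements.
\<close>

lemma card_gens_asymptotics: "(\<lambda>n. real (card (gens n)) / real (order G) ^ n) \<longlonglongrightarrow> 1"
proof -
  let ?N = "order G"
  have N: "real ?N \<ge> 1" by (rule order_pos)
  have lower: "1 - 2 ^ ?N * (1/2) ^ n \<le> real (card (gens n)) / real ?N ^ n" for n
  proof -
    let ?all = "PiE {1..n} (\<lambda>_. carrier G)"
    let ?B = "{B. subgroup B G \<and> B \<noteq> carrier G}"
    have fa: "finite ?all" using fin by (intro finite_PiE) auto
    have fB: "finite ?B" by (rule finite_subset[of _ "Pow (carrier G)"]) (use fin subgroup.subset in auto)
    have cB: "card ?B \<le> 2 ^ ?N"
    proof -
      have "card ?B \<le> card (Pow (carrier G))" by (rule card_mono) (use fin subgroup.subset in auto)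
      then show ?thesis using fin by (simp add: card_Pow order_def)
    qed
    have "?all - gens n \<subseteq> (\<Union>B\<in>?B. PiE {1..n} (\<lambda>_. B))"
    proof
      fix g assume g: "g \<in> ?all - gens n"
      let ?b = "generate G (g ` {1..n})"
      have sub: "g ` {1..n} \<subseteq> carrier G" using g by auto
      have "?b \<in> ?B" using generate_facts(1)[OF sub] g by (auto simp: gens_def)
      moreover have "g \<in> PiE {1..n} (\<lambda>_. ?b)" using g by (auto intro: generate.incl)
      ultimately show "g \<in> (\<Union>B\<in>?B. PiE {1..n} (\<lambda>_. B))" by blast
    qed
    moreover have "finite (PiE {1..n} (\<lambda>_. B))" if "B \<in> ?B" for B
      using that fin finite_subset[OF subgroup.subset] by (intro finite_PiE) auto
    ultimately have "card (?all - gens n) \<le> card (\<Union>B\<in>?B. PiE {1..n} (\<lambda>_. B))"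
      using fB by (intro card_mono) auto
    also have "\<dots> \<le> (\<Sum>B\<in>?B. card (PiE {1..n} (\<lambda>_. B)))" by (rule card_UN_le[OF fB])
    finally have "real (card (?all - gens n)) \<le> (\<Sum>B\<in>?B. real (card B) ^ n)"
      by (simp add: card_PiE flip: of_nat_power of_nat_sum)
    also have "\<dots> \<le> (\<Sum>B\<in>?B. (real ?N / 2) ^ n)"
    proof (rule sum_mono)
      fix B assume "B \<in> ?B"
      then have "2 * card B \<le> ?N" by (intro card_proper_subgroup_le) auto
      then have "2 * real (card B) \<le> real ?N" using of_nat_mono[of "2 * card B" ?N, where 'a = real] by simp
      then show "real (card B) ^ n \<le> (real ?N / 2) ^ n" by (intro power_mono) auto
    qed
    also have "\<dots> = real (card ?B) * (real ?N / 2) ^ n" by simp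
    also have "\<dots> \<le> 2 ^ ?N * (real ?N / 2) ^ n"
      using of_nat_mono[OF cB, where 'a = real] by (intro mult_right_mono) auto
    finally have 1: "real (card (?all - gens n)) \<le> 2 ^ ?N * (real ?N / 2) ^ n" .
    have gs: "gens n \<subseteq> ?all" by (auto simp: gens_def)
    have "card ?all = ?N ^ n" by (simp add: card_PiE order_def)
    then have "real ?N ^ n = real (card (?all - gens n)) + real (card (gens n))"
      using card_Diff_subset[OF finite_gens gs] card_mono[OF fa gs] by (simp flip: of_nat_power)
    then have "real ?N ^ n - 2 ^ ?N * (real ?N / 2) ^ n \<le> real (card (gens n))" using 1 by linarith
    then have "(real ?N ^ n - 2 ^ ?N * (real ?N / 2) ^ n) / real ?N ^ n \<le> real (card (gens n)) / real ?N ^ n"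
      using N by (intro divide_right_mono) auto
    moreover have "(real ?N ^ n - 2 ^ ?N * (real ?N / 2) ^ n) / real ?N ^ n = 1 - 2 ^ ?N * (1/2) ^ n"
      using N by (simp add: field_simps power_divide)
    ultimately show ?thesis by simp
  qed
  have upper: "real (card (gens n)) / real ?N ^ n \<le> 1" for n
    using of_nat_mono[OF card_gens_le, where 'a = real, of n] N by simp
  have "(\<lambda>n. 1 - 2 ^ ?N * (1/2::real) ^ n) \<longlonglongrightarrow> 1 - 2 ^ ?N * 0"
    by (intro tendsto_diff tendsto_const tendsto_mult_left LIMSEQ_realpow_zero) auto
  then have l: "(\<lambda>n. 1 - 2 ^ ?N * (1/2::real) ^ n) \<longlonglongrightarrow> 1" by simp
  show ?thesis
    by (rule tendsto_sandwich[OF _ _ l tendsto_const]) (use lower upper in auto)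
qed

end

text \<open>
  Group structures on a fixed set of \<open>N\<close> labels. There are finitely many, and every group of order \<open>N\<close> is
  isomorphic to one of them, so sums over lattices of index \<open>N\<close> become finitely many sums over tuples.
\<close>

definition labelled_groups :: "nat \<Rightarrow> nat monoid set" where
  "labelled_groups N = (\<lambda>(t, e). \<lparr>carrier = {..<N}, mult = (\<lambda>x y. t (x, y)), one = e\<rparr>) `
     (PiE ({..<N} \<times> {..<N}) (\<lambda>_. {..<N}) \<times> {..<N})"

lemma finite_labelled_groups: "finite (labelled_groups N)"
  unfolding labelled_groups_def
  by (rule finite_imageI, rule finite_cartesian_product, rule finite_PiE) simp_all

lemma labelled_groups_order: "G \<in> labelled_groups N \<Longrightarrow> order G = N"
  unfolding labelled_groups_def by (elim imageE) (simp add: order_def case_prod_unfold)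

lemma (in comm_group) iso_to_labelled_group:
  assumes c: "card (carrier G) = N" "N > 0"
  shows "\<exists>L\<in>labelled_groups N. comm_group L \<and> (\<exists>h. h \<in> iso G L)"
proof -
  have "finite (carrier G)" by (rule card_ge_0_finite) (simp only: c)
  from ex_bij_betw_finite_nat[OF this] obtain h where h: "bij_betw h (carrier G) {0..<N}"
    unfolding c(1) by blast
  let ?k = "inv_into (carrier G) h"
  define t where "t = restrict (\<lambda>(a, b). h (?k a \<otimes> ?k b)) ({..<N} \<times> {..<N})"
  define L where "L = \<lparr>carrier = {..<N}, mult = (\<lambda>x y. t (x, y)), one = h \<one>\<rparr>"
  have hc: "h x < N" if "x \<in> carrier G" for x using bij_betwE[OF h] that by simp
  have kh: "?k (h x) = x" if "x \<in> carrier G" for x by (rule inv_into_f_f[OF bij_betw_imp_inj_on[OF h] that])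
  have hs: "\<exists>x\<in>carrier G. a = h x" if "a < N" for a
  proof -
    have "a \<in> h ` carrier G" using h that by (simp add: bij_betw_def)
    then show ?thesis unfolding image_iff .
  qed
  have mlt: "h x \<otimes>\<^bsub>L\<^esub> h y = h (x \<otimes> y)" if "x \<in> carrier G" "y \<in> carrier G" for x y
    using that hc kh by (simp add: L_def t_def)
  have cL: "carrier L = {..<N}" and oL: "\<one>\<^bsub>L\<^esub> = h \<one>" by (simp_all add: L_def)
  have tP: "t \<in> PiE ({..<N} \<times> {..<N}) (\<lambda>_. {..<N})"
  proof (rule PiE_I)
    fix z assume z: "z \<in> {..<N} \<times> {..<N}"
    then obtain a b where ab: "z = (a, b)" "a < N" "b < N" by auto
    obtain x where x: "x \<in> carrier G" "a = h x" by (rule bexE[OF hs[OF ab(2)]])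
    obtain y where y: "y \<in> carrier G" "b = h y" by (rule bexE[OF hs[OF ab(3)]])
    from x y show "t z \<in> {..<N}" using ab hc kh by (simp add: t_def)
  qed (auto simp: t_def)
  have "L \<in> labelled_groups N"
    unfolding labelled_groups_def L_def using tP hc by (intro image_eqI[of _ _ "(t, h \<one>)"]) auto
  moreover have "h \<in> iso G L"
  proof (rule isoI)
    show "h \<in> hom G L" by (rule homI) (simp_all add: cL hc mlt)
    show "bij_betw h (carrier G) (carrier L)" using h by (simp add: cL lessThan_atLeast0)
  qed
  moreover have "monoid L"
  proof (rule monoidI)
    fix a b assume ab: "a \<in> carrier L" "b \<in> carrier L"
    obtain x where x: "x \<in> carrier G" "a = h x" by (rule bexE[OF hs[OF ab(1)[unfolded cL lessThan_iff]]])
    obtain y where y: "y \<in> carrier G" "b = h y" by (rule bexE[OF hs[OF ab(2)[unfolded cL lessThan_iff]]])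
    show "a \<otimes>\<^bsub>L\<^esub> b \<in> carrier L" unfolding x(2) y(2) mlt[OF x(1) y(1)] cL using hc x(1) y(1) by simp
    fix c assume c: "c \<in> carrier L"
    obtain z where z: "z \<in> carrier G" "c = h z" by (rule bexE[OF hs[OF c[unfolded cL lessThan_iff]]])
    show "a \<otimes>\<^bsub>L\<^esub> b \<otimes>\<^bsub>L\<^esub> c = a \<otimes>\<^bsub>L\<^esub> (b \<otimes>\<^bsub>L\<^esub> c)"
      unfolding x(2) y(2) z(2) using x(1) y(1) z(1) by (simp add: mlt m_assoc)
  next
    show "\<one>\<^bsub>L\<^esub> \<in> carrier L" unfolding oL cL using hc by simp
    fix a assume a: "a \<in> carrier L"
    obtain x where x: "x \<in> carrier G" "a = h x" by (rule bexE[OF hs[OF a[unfolded cL lessThan_iff]]])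
    show "\<one>\<^bsub>L\<^esub> \<otimes>\<^bsub>L\<^esub> a = a" "a \<otimes>\<^bsub>L\<^esub> \<one>\<^bsub>L\<^esub> = a"
      unfolding oL x(2) using x(1) by (simp_all add: mlt)
  qed
  moreover have "comm_group L"
    by (rule iso_imp_comm_group) (use calculation in \<open>auto simp: is_iso_def\<close>)
  ultimately show ?thesis by blast
qed

text \<open>
  A subgroup of index \<open>N\<close> consists of the relations between the images of the unit vectors in its
  quotient, with the elements of the quotient relabelled by \<open>0, \<dots>, N - 1\<close>.
\<close>

lemma lattice_presentation:
  assumes p: "Factorial_Ring.prime p" and k: "k > 0" and q: "q = p ^ k" and N: "N > 0"
    and M: "subgroup M (vecs q n)" and cM: "card (carrier (vecs q n)) = N * card M"
  shows "\<exists>G\<in>labelled_groups N. finite_p_exponent_group G p k q \<and>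
     (\<exists>g\<in>finite_p_exponent_group.gens G n. finite_p_exponent_group.relations G q n g = M)"
proof -
  have q0: "q > 0" using p q by (simp add: prime_gt_0_nat)
  interpret V: comm_group "vecs q n" by (rule comm_group_vecs)
  let ?Q = "vecs q n Mod M"
  have nM: "M \<lhd> vecs q n" using M by (rule V.subgroup_imp_normal)
  interpret Q: comm_group ?Q by (rule V.abelian_FactGroup[OF M])
  have fV: "finite (carrier (vecs q n))" by (rule finite_vecs[OF q0])
  have M0: "card M > 0"
    using fV subgroup.subset[OF M] subgroup.one_closed[OF M] finite_subset by (auto simp: card_gt_0_iff)
  have "card (rcosets\<^bsub>vecs q n\<^esub> M) * card M = N * card M"
    using V.lagrange[OF M] cM by (simp add: order_def)
  then have cQ: "card (carrier ?Q) = N" using M0 by (simp add: FactGroup_def)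
  obtain L h where L: "L \<in> labelled_groups N" "comm_group L" and h: "h \<in> iso ?Q L"
    using Q.iso_to_labelled_group[OF cQ N] by blast
  interpret L: comm_group L by fact
  obtain \<Phi> where \<Phi>: "\<Phi> \<in> hom (vecs q n) L" and surj: "\<Phi> ` carrier (vecs q n) = carrier L"
    and ker: "\<And>x. x \<in> carrier (vecs q n) \<Longrightarrow> \<Phi> x = \<one>\<^bsub>L\<^esub> \<longleftrightarrow> x \<in> M"
    using quotient_iso_as_hom[OF comm_group_vecs M L.is_group h] by blast
  interpret F: group_hom "vecs q n" L \<Phi> by unfold_locales (rule \<Phi>)
  interpret G: finite_p_exponent_group L p k q
  proof (unfold_locales)
    show "finite (carrier L)" by (rule card_ge_0_finite) (simp only: labelled_groups_order[OF L(1), unfolded order_def] N)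
    fix a assume "a \<in> carrier L"
    then obtain x where x: "x \<in> carrier (vecs q n)" "a = \<Phi> x" using surj by blast
    have "x [^]\<^bsub>vecs q n\<^esub> q = \<one>\<^bsub>vecs q n\<^esub>" unfolding pow_vecs[OF x(1)] one_vecs by simp
    then have "\<Phi> (x [^]\<^bsub>vecs q n\<^esub> q) = \<one>\<^bsub>L\<^esub>" by simp
    then show "a [^]\<^bsub>L\<^esub> q = \<one>\<^bsub>L\<^esub>" using x by (simp add: F.hom_nat_pow)
  qed (use p k q in auto)
  have "{v \<in> carrier (vecs q n). \<Phi> v = \<one>\<^bsub>L\<^esub>} = M" using ker subgroup.subset[OF M] by auto
  then show ?thesis using L(1) G.finite_p_exponent_group_axioms G.surjection_presentation[OF \<Phi> surj] by metis
qed

definition lattices :: "nat \<Rightarrow> nat \<Rightarrow> nat \<Rightarrow> (nat \<Rightarrow> int) set set" where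
  "lattices q n N = {M. subgroup M (vecs q n) \<and> card (carrier (vecs q n)) = N * card M}"

lemma finite_lattices: "q > 0 \<Longrightarrow> finite (lattices q n N)"
  by (rule finite_subset[of _ "Pow (carrier (vecs q n))"])
     (auto simp: lattices_def finite_vecs dest: subgroup.subset)

text \<open>
  The probability that \<open>m\<close> independent random columns with independent entries all lie in \<open>M\<close>.
\<close>

definition lattice_mass :: "nat \<Rightarrow> nat \<Rightarrow> (nat \<Rightarrow> nat \<Rightarrow> int \<Rightarrow> real) \<Rightarrow> (nat \<Rightarrow> int) set \<Rightarrow> real" where
  "lattice_mass n m w M = (\<Prod>j=1..m. \<Sum>x\<in>M. \<Prod>i\<in>{1..n}. w j i (x i))"

text \<open>
  Universality: for independent uniform columns the probability is exactly \<open>1 / N\<^sup>n\<^sup>+\<^sup>u\<close>, and in the limit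
  balanced columns cannot be told apart from uniform ones by all lattices of a fixed index together.
\<close>

theorem lattice_mass_l1_tendsto_0:
  fixes a :: "nat \<Rightarrow> nat \<Rightarrow> real" and w :: "nat \<Rightarrow> nat \<Rightarrow> nat \<Rightarrow> int \<Rightarrow> real"
  assumes p: "Factorial_Ring.prime p" and k: "k > 0" and q: "q = p ^ k" and N: "N > 0"
    and a0: "\<And>n j. n \<ge> 1 \<Longrightarrow> j \<in> {1..n+u} \<Longrightarrow> a n j \<ge> 0"
    and lim: "\<And>\<epsilon>::real. \<epsilon> > 0 \<Longrightarrow> (\<lambda>n. \<Sum>j=1..n+u. exp (- \<epsilon> * a n j * real n)) \<longlonglongrightarrow> 0"
    and w: "\<And>n j i. n \<ge> 1 \<Longrightarrow> j \<in> {1..n+u} \<Longrightarrow> i \<in> {1..n} \<Longrightarrow> balanced_weights p q (a n j) (w n j i)"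
  shows "(\<lambda>n. \<Sum>M\<in>lattices q n N. \<bar>lattice_mass n (n+u) (w n) M - 1 / real N ^ (n+u)\<bar>) \<longlonglongrightarrow> 0"
proof -
  have q0: "q > 0" using p q by (simp add: prime_gt_0_nat)
  define GG where "GG = {G \<in> labelled_groups N. finite_p_exponent_group G p k q}"
  have fGG: "finite GG" using finite_labelled_groups by (simp add: GG_def)
  define gg where "gg G n = finite_p_exponent_group.gens G n" for G :: "nat monoid" and n
  define rr where "rr G n g = finite_p_exponent_group.relations G q n g" for G :: "nat monoid" and n g
  define f where "f n M = \<bar>lattice_mass n (n+u) (w n) M - 1 / real N ^ (n+u)\<bar>" for n M
  have lim0: "(\<lambda>n. \<Sum>g\<in>gg G n. f n (rr G n g)) \<longlonglongrightarrow> 0" if G: "G \<in> GG" for G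
  proof -
    interpret G: finite_p_exponent_group G p k q using G by (simp add: GG_def)
    have o: "order G = N" using G labelled_groups_order by (simp add: GG_def)
    have "f n (rr G n g) = \<bar>(\<Prod>j=1..n+u. G.hit {1..n} (w n j) g) - 1 / real (order G) ^ (n+u)\<bar>" if "g \<in> gg G n" for n g
      using that G.hit_eq_sum_relations[OF G.gens_funcset] by (simp add: f_def lattice_mass_def gg_def rr_def o)
    then have "(\<lambda>n. \<Sum>g\<in>gg G n. f n (rr G n g)) = (\<lambda>n. \<Sum>g\<in>G.gens n. \<bar>(\<Prod>j=1..n+u. G.hit {1..n} (w n j) g) - 1 / real (order G) ^ (n+u)\<bar>)"
      by (intro ext sum.cong) (auto simp: gg_def)
    then show ?thesis using G.hit_l1_tendsto_0[OF a0 lim w] by simp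
  qed
  have "(\<Sum>M\<in>lattices q n N. f n M) \<le> (\<Sum>G\<in>GG. \<Sum>g\<in>gg G n. f n (rr G n g))" for n
  proof -
    let ?S = "Sigma GG (\<lambda>G. gg G n)"
    have fin: "finite ?S"
    proof (rule finite_SigmaI[OF fGG])
      fix G assume "G \<in> GG"
      then show "finite (gg G n)" using finite_p_exponent_group.finite_gens by (auto simp: GG_def gg_def)
    qed
    have "lattices q n N \<subseteq> (\<lambda>(G, g). rr G n g) ` ?S"
    proof
      fix M assume "M \<in> lattices q n N"
      then obtain G g where "G \<in> labelled_groups N" "finite_p_exponent_group G p k q"
        "g \<in> finite_p_exponent_group.gens G n" "finite_p_exponent_group.relations G q n g = M"
        using lattice_presentation[OF p k q N] unfolding lattices_def by blast
      then show "M \<in> (\<lambda>(G, g). rr G n g) ` ?S"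
        by (intro image_eqI[of _ _ "(G, g)"]) (auto simp: GG_def gg_def rr_def)
    qed
    then have "(\<Sum>M\<in>lattices q n N. f n M) \<le> (\<Sum>M\<in>(\<lambda>(G, g). rr G n g) ` ?S. f n M)"
      using fin by (intro sum_mono2) (auto simp: f_def)
    also have "\<dots> \<le> (\<Sum>z\<in>?S. f n (case z of (G, g) \<Rightarrow> rr G n g))"
      using sum_image_le[OF fin, of "f n" "\<lambda>(G, g). rr G n g"] by (simp add: f_def o_def)
    also have "\<dots> = (\<Sum>(G, g)\<in>?S. f n (rr G n g))" by (simp add: case_prod_unfold)
    also have "\<dots> = (\<Sum>G\<in>GG. \<Sum>g\<in>gg G n. f n (rr G n g))"
    proof (rule sum.Sigma[symmetric, OF fGG], rule ballI)
      fix G assume "G \<in> GG"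
      then show "finite (gg G n)" using finite_p_exponent_group.finite_gens by (auto simp: GG_def gg_def)
    qed
    finally show ?thesis .
  qed
  moreover have "(\<Sum>M\<in>lattices q n N. f n M) \<ge> 0" for n by (intro sum_nonneg) (simp add: f_def)
  ultimately have "eventually (\<lambda>n. norm (\<Sum>M\<in>lattices q n N. f n M) \<le> (\<Sum>G\<in>GG. \<Sum>g\<in>gg G n. f n (rr G n g))) sequentially"
    by simp
  moreover have "(\<lambda>n. \<Sum>G\<in>GG. \<Sum>g\<in>gg G n. f n (rr G n g)) \<longlonglongrightarrow> 0"
    using tendsto_sum[OF lim0, of GG] by simp
  ultimately have "(\<lambda>n. \<Sum>M\<in>lattices q n N. f n M) \<longlonglongrightarrow> 0" by (rule Lim_null_comparison)
  then show ?thesis by (simp add: f_def)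
qed

context finite_p_exponent_group
begin

text \<open>
  The order of \<open>K / K\<^sup>p\<close> is that of the kernel of \<open>x \<mapsto> x\<^sup>p\<close> on \<open>K\<close>. As \<open>p\<^sup>k\<^sup>-\<^sup>1\<close> annihilates \<open>G\<close>, the lattice \<open>K\<close> contains
  every vector all of whose entries are divisible by \<open>p\<^sup>k\<^sup>-\<^sup>1\<close>, and these are the vectors killed by \<open>p\<close>.
\<close>

lemma card_relations_power_image:
  assumes e': "\<And>h. h \<in> carrier G \<Longrightarrow> h [^] (p ^ (k - 1)) = \<one>" and g: "g \<in> {1..n} \<rightarrow> carrier G"
  shows "card (relations n g) = p ^ n * card (comm_group.power_image (vecs q n) p (relations n g))"
proof -
  interpret V: comm_group "vecs q n" by (rule comm_group_vecs)
  let ?K = "relations n g"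
  let ?r = "p ^ (k - 1)"
  have KV: "subgroup ?K (vecs q n)" by (rule relations_subgroup[OF g])
  have Kc: "x \<in> carrier (vecs q n)" if "x \<in> ?K" for x using that by (simp add: relations_def)
  have fK: "finite ?K" using finite_vecs[OF q_pos] Kc finite_subset[of ?K "carrier (vecs q n)"] by blast
  have qr: "q = p * ?r" using q k by (cases k) auto
  have p0: "p > 0" using p by (simp add: prime_gt_0_nat)
  have r0: "?r > 0" using p0 by simp
  let ?T = "{t \<in> {0..<int q}. int q dvd int p * t}"
  have T: "?T = (\<lambda>t. t * int ?r) ` {0..<int p}"
  proof (intro equalityI subsetI)
    fix t assume t: "t \<in> ?T"
    then have "int ?r dvd t" using p0 by (simp add: qr)
    then obtain s where s: "t = int ?r * s" by blast
    have "0 \<le> int ?r * s" using t s by simp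
    then have "0 \<le> s" using r0 by (metis mult_less_0_iff not_le of_nat_0_less_iff)
    moreover have "int ?r * s < int ?r * int p" using t s by (simp add: qr mult.commute)
    then have "s < int p" using r0 by (simp add: mult_less_cancel_left)
    ultimately show "t \<in> (\<lambda>t. t * int ?r) ` {0..<int p}" using s by (auto simp: mult.commute)
  next
    fix t assume "t \<in> (\<lambda>t. t * int ?r) ` {0..<int p}"
    then obtain s where s: "t = s * int ?r" "0 \<le> s" "s < int p" by auto
    have "s * int ?r < int p * int ?r" using s r0 by (intro mult_strict_right_mono) auto
    then show "t \<in> ?T" using s by (auto simp: qr)
  qed
  have cT: "card ?T = p"
    unfolding T using r0 by (subst card_image) (auto simp: inj_on_def)
  have "card ?K = card ((\<lambda>x. x [^]\<^bsub>vecs q n\<^esub> p) ` ?K) * card {x \<in> ?K. x [^]\<^bsub>vecs q n\<^esub> p = \<one>\<^bsub>vecs q n\<^esub>}"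
    using Kc by (intro card_hom_image_kernel[OF group_vecs group_vecs KV fK]) (auto simp: V.nat_pow_distrib)
  also have "{x \<in> ?K. x [^]\<^bsub>vecs q n\<^esub> p = \<one>\<^bsub>vecs q n\<^esub>} = PiE {1..n} (\<lambda>_. ?T)"
  proof (intro equalityI subsetI)
    fix x assume x: "x \<in> {x \<in> ?K. x [^]\<^bsub>vecs q n\<^esub> p = \<one>\<^bsub>vecs q n\<^esub>}"
    then have xV: "x \<in> carrier (vecs q n)" using Kc by blast
    have "(int p * x i) mod int q = 0" if "i \<in> {1..n}" for i
    proof -
      have "x [^]\<^bsub>vecs q n\<^esub> p = \<one>\<^bsub>vecs q n\<^esub>" using x by simp
      from fun_cong[OF this[unfolded pow_vecs[OF xV] one_vecs], of i] that show ?thesis by simp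
    qed
    then show "x \<in> PiE {1..n} (\<lambda>_. ?T)"
      using xV unfolding carrier_vecs[OF q_pos] by (auto simp: PiE_iff mod_eq_0_iff_dvd)
  next
    fix x assume x: "x \<in> PiE {1..n} (\<lambda>_. ?T)"
    then have xV: "x \<in> carrier (vecs q n)" unfolding carrier_vecs[OF q_pos] by (auto simp: PiE_iff)
    have d: "int q dvd int p * x i" if "i \<in> {1..n}" for i using x that by auto
    have "x [^]\<^bsub>vecs q n\<^esub> p = \<one>\<^bsub>vecs q n\<^esub>"
      unfolding pow_vecs[OF xV] one_vecs using d by (intro restrict_ext) (simp add: mod_eq_0_iff_dvd)
    moreover have "lincomb G n g x = \<one>"
    proof -
      have "g i [^] x i = \<one>" if i: "i \<in> {1..n}" for i
      proof -
        have gi: "g i \<in> carrier G" using g i by auto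
        have "int ?r dvd x i" using d[OF i] p0 by (simp add: qr)
        then have "g i [^] x i = g i [^] (0::int)" by (intro int_pow_cong[OF gi e'[OF gi]]) simp
        then show ?thesis by simp
      qed
      then have "lincomb G n g x = (\<Otimes>i\<in>{1..n}. \<one>)" unfolding lincomb_def by (intro finprod_cong') auto
      then show ?thesis by simp
    qed
    ultimately show "x \<in> {x \<in> ?K. x [^]\<^bsub>vecs q n\<^esub> p = \<one>\<^bsub>vecs q n\<^esub>}" using xV by (simp add: relations_def)
  qed
  also have "card (PiE {1..n} (\<lambda>_. ?T)) = p ^ n" unfolding card_PiE[OF finite_atLeastAtMost] cT by simp
  finally show ?thesis unfolding V.power_image_def by (simp only: mult.commute)
qed

end

section \<open>Residues of random p-adic matrices\<close>

lemma Zp_residue_mod: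
  assumes x: "x \<in> carrier (Zp p)" and j: "j \<le> k" shows "x k mod int p ^ j = x j"
  using j
proof (induction k rule: dec_induct)
  case base
  have "x j \<in> {0..<int p ^ j}" using x by (auto simp: Zp_def)
  then show ?case by simp
next
  case (step k)
  have "x (Suc k) mod int p ^ j = x (Suc k) mod int p ^ k mod int p ^ j"
    using step by (simp add: mod_mod_cancel le_imp_power_dvd)
  also have "x (Suc k) mod int p ^ k = x k" using x by (auto simp: Zp_def)
  finally show ?case using step by simp
qed

lemma Zp_range: "x \<in> carrier (Zp p) \<Longrightarrow> 0 \<le> x k \<and> x k < int p ^ k"
  by (auto simp: Zp_def)

lemma Zp_memI: "(\<And>k. 0 \<le> x k \<and> x k < int p ^ k) \<Longrightarrow> (\<And>k. x (Suc k) mod int p ^ k = x k) \<Longrightarrow> x \<in> carrier (Zp p)"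
  by (auto simp: Zp_def)

text \<open>
  Division by \<open>p\<^sup>k\<close> shifts the sequence of residues: the residue of \<open>d / p\<^sup>k\<close> modulo \<open>p\<^sup>l\<close> is determined by that
  of \<open>d\<close> modulo \<open>p\<^sup>l\<^sup>+\<^sup>k\<close>.
\<close>

lemma Zp_divide_power:
  assumes p: "p > 0" and d: "d \<in> carrier (Zp p)" "d k = 0"
  shows "\<exists>z\<in>carrier (Zp p). \<forall>l. int p ^ k * z l = d (l + k)"
proof -
  have dv: "int p ^ k dvd d (l + k)" for l
    using Zp_residue_mod[OF d(1), of k "l + k"] d(2) by (simp add: dvd_eq_mod_eq_0)
  have P0: "int p ^ k > 0" using p by simp
  define z where "z l = d (l + k) div int p ^ k" for l
  have pz: "int p ^ k * z l = d (l + k)" for l using dv by (simp add: z_def)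
  have "z \<in> carrier (Zp p)"
  proof (rule Zp_memI)
    fix l
    have "int p ^ k * 0 \<le> int p ^ k * z l" "int p ^ k * z l < int p ^ k * int p ^ l"
      unfolding pz using Zp_range[OF d(1), of "l + k"] by (simp_all add: power_add mult.commute)
    then show "0 \<le> z l \<and> z l < int p ^ l" using P0 by (metis mult_le_cancel_left_pos mult_less_cancel_left_pos)
    have "int p ^ k * (z (Suc l) mod int p ^ l) = (int p ^ k * z (Suc l)) mod (int p ^ k * int p ^ l)"
      by (rule mult_mod_right)
    also have "\<dots> = d (Suc l + k) mod int p ^ (l + k)" unfolding pz power_add by (simp only: mult.commute)
    also have "\<dots> = int p ^ k * z l" using Zp_residue_mod[OF d(1), of "l + k" "Suc l + k"] by (simp add: pz)
    finally have "int p ^ k * (z (Suc l) mod int p ^ l) = int p ^ k * z l" .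
    moreover have "int p ^ k \<noteq> 0" using P0 by linarith
    ultimately show "z (Suc l) mod int p ^ l = z l" using mult_left_cancel by blast
  qed
  then show ?thesis using pz by blast
qed

text \<open>
  The residue classes modulo \<open>p\<close> in the definition of a balanced variable are cosets of a principal
  ideal; here they are identified with the sets of all sequences with a given first residue.
\<close>

lemma Zp_class_in_quotient:
  assumes p: "p > 0" and y: "y \<in> carrier (Zp p)"
  shows "{x \<in> carrier (Zp p). x 1 = y 1} \<in> carrier (Zp_mod_p p)"
proof -
  let ?R = "Zp p"
  interpret R: cring ?R by (rule Zp_cring[OF p])
  let ?pi = "[p] \<cdot>\<^bsub>?R\<^esub> \<one>\<^bsub>?R\<^esub>"
  let ?I = "PIdl\<^bsub>?R\<^esub> ?pi"
  have pic: "?pi \<in> carrier ?R" by simp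
  have pk: "int p ^ k > 0" for k using p by simp
  have pi: "?pi k = int p mod int p ^ k" for k
  proof -
    have "([m] \<cdot>\<^bsub>?R\<^esub> \<one>\<^bsub>?R\<^esub>) k = int m mod int p ^ k" for m :: nat
    proof (induction m)
      case 0
      have "[(0::nat)] \<cdot>\<^bsub>?R\<^esub> \<one>\<^bsub>?R\<^esub> = \<zero>\<^bsub>?R\<^esub>" by simp
      then show ?case by (simp only:) (simp add: Zp_def)
    next
      case (Suc m)
      have "[Suc m] \<cdot>\<^bsub>?R\<^esub> \<one>\<^bsub>?R\<^esub> = [m] \<cdot>\<^bsub>?R\<^esub> \<one>\<^bsub>?R\<^esub> \<oplus>\<^bsub>?R\<^esub> \<one>\<^bsub>?R\<^esub>" by simp
      moreover have "(a \<oplus>\<^bsub>?R\<^esub> \<one>\<^bsub>?R\<^esub>) k = (a k + 1 mod int p ^ k) mod int p ^ k" for a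
        by (simp add: Zp_def)
      ultimately have "([Suc m] \<cdot>\<^bsub>?R\<^esub> \<one>\<^bsub>?R\<^esub>) k = (([m] \<cdot>\<^bsub>?R\<^esub> \<one>\<^bsub>?R\<^esub>) k + 1 mod int p ^ k) mod int p ^ k"
        by simp
      then show ?case using Suc by (simp add: mod_simps add.commute)
    qed
    then show ?thesis by simp
  qed
  let ?C = "?I +>\<^bsub>?R\<^esub> y"
  have "?C \<in> carrier (Zp_mod_p p)" using y by (auto simp: Zp_mod_p_def FactRing_def A_RCOSETS_def')
  moreover have "x \<in> ?C" if x: "x \<in> carrier ?R" "x 1 = y 1" for x
  proof -
    define d where "d = x \<ominus>\<^bsub>?R\<^esub> y"
    have dc: "d \<in> carrier ?R" using x y by (simp add: d_def)
    have "x = d \<oplus>\<^bsub>?R\<^esub> y" unfolding d_def using x y by (simp add: a_minus_def R.a_assoc R.l_neg)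
    then have xd: "x k = (d k + y k) mod int p ^ k" for k by (simp add: Zp_def)
    have cd: "d k \<in> {0..<int p ^ k}" "d (Suc k) mod int p ^ k = d k" for k using dc by (auto simp: Zp_def)
    have y1: "y 1 \<in> {0..<int p ^ 1}" using y unfolding Zp_def by (simp only: partial_object.simps mem_Collect_eq)
    have d1: "d 1 = 0"
    proof -
      have "(d 1 + y 1) mod int p = y 1" using xd[of 1] x(2) by simp
      moreover have "y 1 mod int p = y 1" using y1 by simp
      ultimately have "int p dvd d 1" by (metis add_diff_cancel_right' mod_eq_dvd_iff)
      then show ?thesis using cd(1)[of 1] zdvd_imp_le[of "int p" "d 1"] by fastforce
    qed
    obtain z where zc: "z \<in> carrier ?R" and pz: "\<And>k. int p * z k = d (Suc k)"
      using Zp_divide_power[OF p dc d1] by auto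
    have "d = z \<otimes>\<^bsub>?R\<^esub> ?pi"
    proof
      fix k
      have "(z \<otimes>\<^bsub>?R\<^esub> a) k = (z k * a k) mod int p ^ k" for a by (simp add: Zp_def)
      then have "(z \<otimes>\<^bsub>?R\<^esub> ?pi) k = (z k * ?pi k) mod int p ^ k" .
      also have "\<dots> = (int p * z k) mod int p ^ k" unfolding pi by (simp add: mod_simps mult.commute)
      also have "\<dots> = d k" using cd(2)[of k] by (simp add: pz)
      finally show "d k = (z \<otimes>\<^bsub>?R\<^esub> ?pi) k" by simp
    qed
    then have "d \<in> ?I" using zc by (auto simp: cgenideal_def)
    then show ?thesis using \<open>x = d \<oplus>\<^bsub>?R\<^esub> y\<close> by (auto simp: a_r_coset_def')
  qed
  moreover have "x \<in> carrier ?R \<and> x 1 = y 1" if x: "x \<in> ?C" for x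
  proof -
    obtain z where z: "z \<in> carrier ?R" "x = z \<otimes>\<^bsub>?R\<^esub> ?pi \<oplus>\<^bsub>?R\<^esub> y"
      using x by (auto simp: a_r_coset_def' cgenideal_def)
    have "x \<in> carrier ?R" using z y pic by simp
    have ml: "(z \<otimes>\<^bsub>?R\<^esub> a) 1 = (z 1 * a 1) mod int p ^ 1" for a by (simp add: Zp_def)
    have ad: "(a \<oplus>\<^bsub>?R\<^esub> b) 1 = (a 1 + b 1) mod int p ^ 1" for a b by (simp add: Zp_def)
    have "(z \<otimes>\<^bsub>?R\<^esub> ?pi) 1 = (z 1 * ?pi 1) mod int p ^ 1" by (rule ml)
    also have "\<dots> = 0" unfolding pi by simp
    finally have "x 1 = y 1 mod int p" unfolding z(2) ad by simp
    moreover have "y 1 \<in> {0..<int p ^ 1}" using y unfolding Zp_def by (simp only: partial_object.simps mem_Collect_eq)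
    ultimately show ?thesis using \<open>x \<in> carrier ?R\<close> by simp
  qed
  ultimately have "{x \<in> carrier ?R. x 1 = y 1} = ?C" by blast
  then show ?thesis using \<open>?C \<in> carrier (Zp_mod_p p)\<close> by simp
qed

lemma Zp_borel_space: "space (Zp_borel p) = carrier (Zp p)"
  unfolding Zp_borel_def by (rule space_measure_of) auto

lemma Zp_residue_set_measurable: "{x \<in> carrier (Zp p). x k = r} \<in> sets (Zp_borel p)"
  unfolding Zp_borel_def by (subst sets_measure_of) auto

lemma balanced_imp_balanced_weights:
  assumes M: "prob_space M" and p: "Factorial_Ring.prime p" and k: "k > 0" and a: "a \<le> 1"
    and b: "balanced p M a y"
  shows "balanced_weights p (p ^ k) a (\<lambda>r. measure M {\<omega> \<in> space M. y \<omega> k = r})"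
proof -
  interpret prob_space M by fact
  have p0: "p > 0" using p by (simp add: prime_gt_0_nat)
  have ym: "y \<in> measurable M (Zp_borel p)" and bal: "\<And>C. C \<in> carrier (Zp_mod_p p) \<Longrightarrow> measure M {\<omega> \<in> space M. y \<omega> \<in> C} \<le> 1 - a"
    using b by (auto simp: balanced_def)
  have yc: "y \<omega> \<in> carrier (Zp p)" if "\<omega> \<in> space M" for \<omega>
    using measurable_space[OF ym that] by (simp add: Zp_borel_space)
  have E: "{\<omega> \<in> space M. y \<omega> l = r} \<in> events" for l r
  proof -
    have "{\<omega> \<in> space M. y \<omega> l = r} = y -` {x \<in> carrier (Zp p). x l = r} \<inter> space M" using yc by auto
    then show ?thesis using measurable_sets[OF ym Zp_residue_set_measurable[of p l r]] by simp
  qed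
  let ?w = "\<lambda>r. measure M {\<omega> \<in> space M. y \<omega> k = r}"
  have rng: "y \<omega> k \<in> {0..<int (p ^ k)}" if "\<omega> \<in> space M" for \<omega> using yc[OF that] by (auto simp: Zp_def)
  have add: "(\<Sum>r\<in>T. ?w r) = measure M {\<omega> \<in> space M. y \<omega> k \<in> T}" if "finite T" for T
  proof -
    have "measure M (\<Union>r\<in>T. {\<omega> \<in> space M. y \<omega> k = r}) = (\<Sum>r\<in>T. ?w r)"
      by (rule finite_measure_finite_Union[OF that]) (use E in \<open>auto simp: disjoint_family_on_def\<close>)
    moreover have "(\<Union>r\<in>T. {\<omega> \<in> space M. y \<omega> k = r}) = {\<omega> \<in> space M. y \<omega> k \<in> T}" by auto
    ultimately show ?thesis by simp
  qed
  have "{\<omega> \<in> space M. y \<omega> k \<in> {0..<int (p ^ k)}} = space M" using rng by auto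
  then have tot: "(\<Sum>r\<in>{0..<int (p ^ k)}. ?w r) = 1" using add[of "{0..<int (p ^ k)}"] prob_space by simp
  have cls: "(\<Sum>r | r \<in> {0..<int (p ^ k)} \<and> r mod int p = s. ?w r) \<le> 1 - a" for s
  proof -
    let ?T = "{r. r \<in> {0..<int (p ^ k)} \<and> r mod int p = s}"
    have eq: "{\<omega> \<in> space M. y \<omega> k \<in> ?T} = {\<omega> \<in> space M. y \<omega> 1 = s}"
      using rng Zp_residue_mod[OF yc, of _ 1 k] k by auto
    have ft: "finite ?T" by (rule finite_subset[of _ "{0..<int (p ^ k)}"]) auto
    show ?thesis
    proof (cases "\<exists>\<omega>\<in>space M. y \<omega> 1 = s")
      case False
      then have empty: "{\<omega> \<in> space M. y \<omega> 1 = s} = {}" by blast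
      have "(\<Sum>r\<in>?T. ?w r) = 0" using add[OF ft] unfolding eq empty by simp
      then show ?thesis using a by simp
    next
      case True
      then obtain \<omega>0 where w0: "\<omega>0 \<in> space M" "y \<omega>0 1 = s" by blast
      let ?C = "{x \<in> carrier (Zp p). x 1 = s}"
      have C: "?C \<in> carrier (Zp_mod_p p)" using Zp_class_in_quotient[OF p0 yc[OF w0(1)]] w0(2) by simp
      have "(\<Sum>r\<in>?T. ?w r) = measure M {\<omega> \<in> space M. y \<omega> 1 = s}" using add[OF ft] unfolding eq .
      also have "{\<omega> \<in> space M. y \<omega> 1 = s} = {\<omega> \<in> space M. y \<omega> \<in> ?C}" using yc by auto
      also have "measure M \<dots> \<le> 1 - a" by (rule bal[OF C])
      finally show ?thesis .
    qed
  qed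
  show ?thesis unfolding balanced_weights_def using tot cls by auto
qed

text \<open>
  The first argument of the result is the column index, so that \<open>residue_matrix k n m B j\<close> is a column.
\<close>

definition residue_matrix :: "nat \<Rightarrow> nat \<Rightarrow> nat \<Rightarrow> (nat \<Rightarrow> nat \<Rightarrow> padic) \<Rightarrow> (nat \<Rightarrow> nat \<Rightarrow> int)" where
  "residue_matrix k n m B = (\<lambda>j\<in>{1..m}. \<lambda>i\<in>{1..n}. B i j k)"

text \<open>
  Only the residues modulo \<open>p\<^sup>k\<close> matter, so every event is a finite union of elementary ones, and the
  probability of an elementary event factors by independence of the entries.
\<close>

lemma residue_matrix_law:
  fixes A :: "'a \<Rightarrow> nat \<Rightarrow> nat \<Rightarrow> padic" and k :: nat
  assumes M: "prob_space M" and p: "p > 0"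
    and ind: "prob_space.indep_vars M (\<lambda>_. Zp_borel p) (\<lambda>(i, j) \<omega>. A \<omega> i j) ({1..n} \<times> {1..m})"
    and nm: "n \<ge> 1" "m \<ge> 1"
  defines "w \<equiv> \<lambda>j i r. measure M {\<omega> \<in> space M. A \<omega> i j k = r}"
  shows "measure M {\<omega> \<in> space M. R (residue_matrix k n m (A \<omega>))}
    = (\<Sum>x | x \<in> PiE {1..m} (\<lambda>_. carrier (vecs (p ^ k) n)) \<and> R x. \<Prod>j=1..m. \<Prod>i\<in>{1..n}. w j i (x j i))"
    and "\<And>\<omega>. \<omega> \<in> space M \<Longrightarrow> residue_matrix k n m (A \<omega>) \<in> PiE {1..m} (\<lambda>_. carrier (vecs (p ^ k) n))"
    and "\<And>\<omega> i j. \<omega> \<in> space M \<Longrightarrow> i \<in> {1..n} \<Longrightarrow> j \<in> {1..m} \<Longrightarrow> A \<omega> i j \<in> carrier (Zp p)"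
proof -
  interpret prob_space M by fact
  let ?I = "{1..n} \<times> {1..m}"
  let ?X = "PiE {1..m} (\<lambda>_. carrier (vecs (p ^ k) n))"
  have pk: "p ^ k > 0" using p by simp
  have Am: "(\<lambda>\<omega>. A \<omega> i j) \<in> measurable M (Zp_borel p)" if "i \<in> {1..n}" "j \<in> {1..m}" for i j
    using ind that unfolding indep_vars_def2 by fastforce
  show Ac: "\<And>\<omega> i j. \<omega> \<in> space M \<Longrightarrow> i \<in> {1..n} \<Longrightarrow> j \<in> {1..m} \<Longrightarrow> A \<omega> i j \<in> carrier (Zp p)"
    using measurable_space[OF Am] by (simp add: Zp_borel_space)
  show Xc: "\<And>\<omega>. \<omega> \<in> space M \<Longrightarrow> residue_matrix k n m (A \<omega>) \<in> ?X"
    using Ac by (auto simp: residue_matrix_def carrier_vecs[OF pk] Zp_def)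
  have pt: "{\<omega> \<in> space M. residue_matrix k n m (A \<omega>) = x} \<in> events \<and>
     measure M {\<omega> \<in> space M. residue_matrix k n m (A \<omega>) = x} = (\<Prod>j=1..m. \<Prod>i\<in>{1..n}. w j i (x j i))"
    if x: "x \<in> ?X" for x
  proof -
    define S where "S ij = {z \<in> carrier (Zp p). z k = x (snd ij) (fst ij)}" for ij :: "nat \<times> nat"
    have S: "S ij \<in> sets (Zp_borel p)" for ij unfolding S_def by (rule Zp_residue_set_measurable)
    have eq: "{\<omega> \<in> space M. residue_matrix k n m (A \<omega>) = x} = (\<Inter>ij\<in>?I. (case ij of (i, j) \<Rightarrow> \<lambda>\<omega>. A \<omega> i j) -` S ij \<inter> space M)"
    proof (intro equalityI subsetI)
      fix \<omega> assume "\<omega> \<in> {\<omega> \<in> space M. residue_matrix k n m (A \<omega>) = x}"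
      then show "\<omega> \<in> (\<Inter>ij\<in>?I. (case ij of (i, j) \<Rightarrow> \<lambda>\<omega>. A \<omega> i j) -` S ij \<inter> space M)"
        using Ac by (auto simp: S_def residue_matrix_def)
    next
      fix \<omega> assume w: "\<omega> \<in> (\<Inter>ij\<in>?I. (case ij of (i, j) \<Rightarrow> \<lambda>\<omega>. A \<omega> i j) -` S ij \<inter> space M)"
      have "(1, 1) \<in> ?I" using nm by simp
      then have sp: "\<omega> \<in> space M" using w by blast
      have en: "A \<omega> i j k = x j i" if "i \<in> {1..n}" "j \<in> {1..m}" for i j
        using w that by (auto simp: S_def)
      have "residue_matrix k n m (A \<omega>) = x"
      proof (rule PiE_ext[OF Xc[OF sp] x])
        fix j assume j: "j \<in> {1..m}"
        have "x j \<in> PiE {1..n} (\<lambda>_. {0..<int (p ^ k)})" using PiE_mem[OF x j] by (simp add: carrier_vecs[OF pk])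
        moreover have "residue_matrix k n m (A \<omega>) j \<in> PiE {1..n} (\<lambda>_. {0..<int (p ^ k)})"
          using PiE_mem[OF Xc[OF sp] j] by (simp add: carrier_vecs[OF pk])
        ultimately show "residue_matrix k n m (A \<omega>) j = x j"
          using en[OF _ j] j by (intro PiE_ext) (auto simp: residue_matrix_def)
      qed
      then show "\<omega> \<in> {\<omega> \<in> space M. residue_matrix k n m (A \<omega>) = x}" using sp by simp
    qed
    have "measure M (\<Inter>ij\<in>?I. (case ij of (i, j) \<Rightarrow> \<lambda>\<omega>. A \<omega> i j) -` S ij \<inter> space M)
       = (\<Prod>ij\<in>?I. measure M ((case ij of (i, j) \<Rightarrow> \<lambda>\<omega>. A \<omega> i j) -` S ij \<inter> space M))"
      using nm S by (intro indep_varsD[OF ind]) auto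
    also have "\<dots> = (\<Prod>(i, j)\<in>?I. w j i (x j i))"
    proof (rule prod.cong[OF refl])
      fix ij assume "ij \<in> ?I"
      moreover obtain i j where ij: "ij = (i, j)" by fastforce
      ultimately have "(case ij of (i, j) \<Rightarrow> \<lambda>\<omega>. A \<omega> i j) -` S ij \<inter> space M = {\<omega> \<in> space M. A \<omega> i j k = x j i}"
        using Ac by (auto simp: S_def)
      then show "measure M ((case ij of (i, j) \<Rightarrow> \<lambda>\<omega>. A \<omega> i j) -` S ij \<inter> space M) = (case ij of (i, j) \<Rightarrow> w j i (x j i))"
        by (simp add: ij w_def)
    qed
    also have "\<dots> = (\<Prod>i\<in>{1..n}. \<Prod>j=1..m. w j i (x j i))" by (rule prod.cartesian_product[symmetric])
    also have "\<dots> = (\<Prod>j=1..m. \<Prod>i\<in>{1..n}. w j i (x j i))" by (rule prod.swap)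
    finally have P: "measure M {\<omega> \<in> space M. residue_matrix k n m (A \<omega>) = x} = (\<Prod>j=1..m. \<Prod>i\<in>{1..n}. w j i (x j i))"
      unfolding eq .
    have "(\<Inter>ij\<in>?I. (case ij of (i, j) \<Rightarrow> \<lambda>\<omega>. A \<omega> i j) -` S ij \<inter> space M) \<in> events"
    proof (rule sets.finite_INT)
      fix ij assume "ij \<in> ?I"
      then show "(case ij of (i, j) \<Rightarrow> \<lambda>\<omega>. A \<omega> i j) -` S ij \<inter> space M \<in> events"
        using Am S by (cases ij) (auto intro: measurable_sets)
    qed (use nm in auto)
    then show ?thesis using P eq by simp
  qed
  let ?Y = "{x. x \<in> ?X \<and> R x}"
  have fX: "finite ?X" using finite_vecs[OF pk] by (intro finite_PiE) auto
  have "{\<omega> \<in> space M. R (residue_matrix k n m (A \<omega>))} = (\<Union>x\<in>?Y. {\<omega> \<in> space M. residue_matrix k n m (A \<omega>) = x})"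
    using Xc by auto
  then have "measure M {\<omega> \<in> space M. R (residue_matrix k n m (A \<omega>))}
     = (\<Sum>x\<in>?Y. measure M {\<omega> \<in> space M. residue_matrix k n m (A \<omega>) = x})"
    using fX pt by (simp only:) (intro finite_measure_finite_Union; auto simp: disjoint_family_on_def)
  also have "\<dots> = (\<Sum>x\<in>?Y. \<Prod>j=1..m. \<Prod>i\<in>{1..n}. w j i (x j i))"
    using pt by (intro sum.cong refl) auto
  finally show "measure M {\<omega> \<in> space M. R (residue_matrix k n m (A \<omega>))} = (\<Sum>x\<in>?Y. \<Prod>j=1..m. \<Prod>i\<in>{1..n}. w j i (x j i))" .
qed

section \<open>Cokernels and reduction modulo a power of p\<close>

lemma Zp_add_at: "(a \<oplus>\<^bsub>Zp p\<^esub> b) l = (a l + b l) mod int p ^ l" by (simp add: Zp_def)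
lemma Zp_mult_at: "(a \<otimes>\<^bsub>Zp p\<^esub> b) l = (a l * b l) mod int p ^ l" by (simp add: Zp_def)
lemma Zp_zero_at: "\<zero>\<^bsub>Zp p\<^esub> l = 0" by (simp add: Zp_def)

lemma Zp_finsum_at:
  assumes p: "p > 0" and S: "finite S" and f: "\<And>j. j \<in> S \<Longrightarrow> f j \<in> carrier (Zp p)"
  shows "(\<Oplus>\<^bsub>Zp p\<^esub>j\<in>S. f j) l = (\<Sum>j\<in>S. f j l) mod int p ^ l"
proof -
  interpret R: cring "Zp p" by (rule Zp_cring[OF p])
  show ?thesis using S f
  proof (induction S rule: finite_induct)
    case empty
    then show ?case by (simp add: Zp_zero_at)
  next
    case (insert j S)
    then have "(\<Oplus>\<^bsub>Zp p\<^esub>j\<in>insert j S. f j) = f j \<oplus>\<^bsub>Zp p\<^esub> (\<Oplus>\<^bsub>Zp p\<^esub>j\<in>S. f j)"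
      by (intro R.finsum_insert) auto
    then show ?case using insert by (simp add: Zp_add_at mod_simps)
  qed
qed

lemma carrier_Zp_vec: "carrier (Zp_vec p n) = PiE {1..n} (\<lambda>_. carrier (Zp p))"
  by (simp add: Zp_vec_def)

lemma group_Zp_vec: "p > 0 \<Longrightarrow> group (Zp_vec p n)"
  unfolding Zp_vec_def
  by (intro product_group abelian_group.a_group ring.is_abelian_group cring.axioms(1) Zp_cring)

lemma mult_Zp_vec: "x \<otimes>\<^bsub>Zp_vec p n\<^esub> y = (\<lambda>i\<in>{1..n}. x i \<oplus>\<^bsub>Zp p\<^esub> y i)"
  by (simp add: Zp_vec_def)

lemma one_Zp_vec: "\<one>\<^bsub>Zp_vec p n\<^esub> = (\<lambda>i\<in>{1..n}. \<zero>\<^bsub>Zp p\<^esub>)"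
  by (simp add: Zp_vec_def)

lemma comm_group_Zp_vec:
  assumes p: "p > 0" shows "comm_group (Zp_vec p n)"
proof -
  interpret R: cring "Zp p" by (rule Zp_cring[OF p])
  show ?thesis
    by (rule group.group_comm_groupI[OF group_Zp_vec[OF p]])
       (auto simp: mult_Zp_vec carrier_Zp_vec PiE_iff R.a_comm intro!: restrict_ext)
qed

lemma Zp_vec_eqI:
  assumes "x \<in> carrier (Zp_vec p n)" "y \<in> carrier (Zp_vec p n)" "\<And>i l. i \<in> {1..n} \<Longrightarrow> x i l = y i l"
  shows "x = y"
  using assms unfolding carrier_Zp_vec by (intro PiE_ext[of x _ _ y]) auto

lemma Zp_vec_mem: "x \<in> carrier (Zp_vec p n) \<Longrightarrow> i \<in> {1..n} \<Longrightarrow> x i \<in> carrier (Zp p)"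
  by (auto simp: carrier_Zp_vec)

lemma Zp_vec_pow_at:
  assumes p: "p > 0" and x: "x \<in> carrier (Zp_vec p n)" and i: "i \<in> {1..n}"
  shows "(x [^]\<^bsub>Zp_vec p n\<^esub> (a::nat)) i l = (int a * x i l) mod int p ^ l"
proof (induction a)
  interpret V: comm_group "Zp_vec p n" by (rule comm_group_Zp_vec[OF p])
  {
    case 0
    have "x [^]\<^bsub>Zp_vec p n\<^esub> (0::nat) = \<one>\<^bsub>Zp_vec p n\<^esub>" by simp
    then show ?case using i by (simp only: one_Zp_vec) (simp add: Zp_zero_at)
  next
    case (Suc a)
    have "x [^]\<^bsub>Zp_vec p n\<^esub> Suc a = x [^]\<^bsub>Zp_vec p n\<^esub> a \<otimes>\<^bsub>Zp_vec p n\<^esub> x" by simp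
    then have "(x [^]\<^bsub>Zp_vec p n\<^esub> Suc a) i l = ((x [^]\<^bsub>Zp_vec p n\<^esub> a) i l + x i l) mod int p ^ l"
      using i by (simp only: mult_Zp_vec) (simp add: Zp_add_at)
    then show ?case unfolding Suc by (simp add: mod_simps algebra_simps)
  }
qed

lemma mat_apply_in:
  assumes p: "p > 0" and B: "\<forall>i\<in>{1..n}. \<forall>j\<in>{1..m}. B i j \<in> carrier (Zp p)"
    and y: "y \<in> carrier (Zp_vec p m)"
  shows "mat_apply p n m B y \<in> carrier (Zp_vec p n)"
proof -
  interpret R: cring "Zp p" by (rule Zp_cring[OF p])
  show ?thesis unfolding mat_apply_def carrier_Zp_vec
    using B Zp_vec_mem[OF y] by (intro restrict_PiE_iff[THEN iffD2] ballI R.finsum_closed) auto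
qed

lemma mat_apply_at:
  assumes p: "p > 0" and B: "\<forall>i\<in>{1..n}. \<forall>j\<in>{1..m}. B i j \<in> carrier (Zp p)"
    and y: "y \<in> carrier (Zp_vec p m)" and i: "i \<in> {1..n}"
  shows "mat_apply p n m B y i l = (\<Sum>j=1..m. B i j l * y j l) mod int p ^ l"
proof -
  interpret R: cring "Zp p" by (rule Zp_cring[OF p])
  have "mat_apply p n m B y i l = (\<Sum>j=1..m. (B i j \<otimes>\<^bsub>Zp p\<^esub> y j) l) mod int p ^ l"
  proof -
    have "(\<Oplus>\<^bsub>Zp p\<^esub>j\<in>{1..m}. B i j \<otimes>\<^bsub>Zp p\<^esub> y j) l = (\<Sum>j=1..m. (B i j \<otimes>\<^bsub>Zp p\<^esub> y j) l) mod int p ^ l"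
      using B i Zp_vec_mem[OF y] by (intro Zp_finsum_at[OF p]) auto
    then show ?thesis unfolding mat_apply_def using i by simp
  qed
  also have "\<dots> = (\<Sum>j=1..m. (B i j l * y j l) mod int p ^ l) mod int p ^ l" by (simp add: Zp_mult_at)
  also have "\<dots> = (\<Sum>j=1..m. B i j l * y j l) mod int p ^ l" by (rule mod_sum_eq)
  finally show ?thesis .
qed

lemma mat_apply_hom:
  assumes p: "p > 0" and B: "\<forall>i\<in>{1..n}. \<forall>j\<in>{1..m}. B i j \<in> carrier (Zp p)"
  shows "mat_apply p n m B \<in> hom (Zp_vec p m) (Zp_vec p n)"
proof (rule homI)
  fix x y assume x: "x \<in> carrier (Zp_vec p m)" and y: "y \<in> carrier (Zp_vec p m)"
  interpret V: comm_group "Zp_vec p n" by (rule comm_group_Zp_vec[OF p])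
  interpret W: comm_group "Zp_vec p m" by (rule comm_group_Zp_vec[OF p])
  show "mat_apply p n m B (x \<otimes>\<^bsub>Zp_vec p m\<^esub> y) = mat_apply p n m B x \<otimes>\<^bsub>Zp_vec p n\<^esub> mat_apply p n m B y"
  proof (rule Zp_vec_eqI[where p = p and n = n])
    fix i l assume i: "i \<in> {1..n}"
    have "mat_apply p n m B (x \<otimes>\<^bsub>Zp_vec p m\<^esub> y) i l = (\<Sum>j=1..m. B i j l * ((x j l + y j l) mod int p ^ l)) mod int p ^ l"
      unfolding mat_apply_at[OF p B W.m_closed[OF x y] i] by (simp add: mult_Zp_vec Zp_add_at)
    also have "\<dots> = (\<Sum>j=1..m. (B i j l * ((x j l + y j l) mod int p ^ l)) mod int p ^ l) mod int p ^ l" by (rule mod_sum_eq[symmetric])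
    also have "\<dots> = (\<Sum>j=1..m. (B i j l * x j l + B i j l * y j l) mod int p ^ l) mod int p ^ l" by (simp add: mod_simps ring_distribs)
    also have "\<dots> = (\<Sum>j=1..m. B i j l * x j l + B i j l * y j l) mod int p ^ l" by (rule mod_sum_eq)
    also have "\<dots> = (mat_apply p n m B x \<otimes>\<^bsub>Zp_vec p n\<^esub> mat_apply p n m B y) i l"
      using i by (simp add: mult_Zp_vec Zp_add_at mat_apply_at[OF p B x i] mat_apply_at[OF p B y i] sum.distrib mod_simps)
    finally show "mat_apply p n m B (x \<otimes>\<^bsub>Zp_vec p m\<^esub> y) i l = (mat_apply p n m B x \<otimes>\<^bsub>Zp_vec p n\<^esub> mat_apply p n m B y) i l" .
  qed (use x y mat_apply_in[OF p B] in simp_all)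
qed (rule mat_apply_in[OF p B])

definition reduce :: "nat \<Rightarrow> nat \<Rightarrow> (nat \<Rightarrow> padic) \<Rightarrow> (nat \<Rightarrow> int)" where
  "reduce k n x = (\<lambda>i\<in>{1..n}. x i k)"

definition lift :: "nat \<Rightarrow> nat \<Rightarrow> (nat \<Rightarrow> int) \<Rightarrow> (nat \<Rightarrow> padic)" where
  "lift p n v = (\<lambda>i\<in>{1..n}. \<lambda>l. v i mod int p ^ l)"

lemma reduce_hom:
  assumes p: "p > 0" shows "reduce k n \<in> hom (Zp_vec p n) (vecs (p ^ k) n)"
proof (rule homI)
  have pk: "p ^ k > 0" using p by simp
  fix x assume x: "x \<in> carrier (Zp_vec p n)"
  show "reduce k n x \<in> carrier (vecs (p ^ k) n)"
    unfolding carrier_vecs[OF pk] reduce_def using Zp_range[OF Zp_vec_mem[OF x], of _ k]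
    by (intro restrict_PiE_iff[THEN iffD2]) simp
  fix y
  show "reduce k n (x \<otimes>\<^bsub>Zp_vec p n\<^esub> y) = reduce k n x \<otimes>\<^bsub>vecs (p ^ k) n\<^esub> reduce k n y"
    by (auto simp: reduce_def mult_Zp_vec mult_vecs Zp_add_at intro!: restrict_ext)
qed

lemma lift_in:
  assumes p: "p > 0" shows "lift p n v \<in> carrier (Zp_vec p n)"
proof -
  have "(\<lambda>l. v i mod int p ^ l) \<in> carrier (Zp p)" for i
  proof (rule Zp_memI)
    fix l
    show "0 \<le> v i mod int p ^ l \<and> v i mod int p ^ l < int p ^ l" using p by simp
    show "v i mod int p ^ Suc l mod int p ^ l = v i mod int p ^ l" by (simp add: mod_mod_cancel)
  qed
  then show ?thesis unfolding lift_def carrier_Zp_vec by (intro restrict_PiE_iff[THEN iffD2]) simp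
qed

lemma reduce_lift:
  assumes p: "p > 0" and v: "v \<in> carrier (vecs (p ^ k) n)" shows "reduce k n (lift p n v) = v"
proof -
  have pk: "p ^ k > 0" using p by simp
  have vP: "v \<in> PiE {1..n} (\<lambda>_. {0..<int p ^ k})" using v by (simp add: carrier_vecs[OF pk])
  show ?thesis
  proof
    fix i
    show "reduce k n (lift p n v) i = v i"
      using PiE_mem[OF vP, of i] PiE_arb[OF vP, of i] by (cases "i \<in> {1..n}") (auto simp: reduce_def lift_def)
  qed
qed

text \<open>
  Modulo \<open>p\<^sup>k\<close> the coefficients of a linear combination of the columns are nonnegative integers, hence
  the reduction of the image is the subgroup generated by the reduced columns.
\<close>

lemma reduce_image:
  assumes p: "p > 0" and B: "\<forall>i\<in>{1..n}. \<forall>j\<in>{1..m}. B i j \<in> carrier (Zp p)"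
  shows "reduce k n ` mat_apply p n m B ` carrier (Zp_vec p m) = generate (vecs (p ^ k) n) (residue_matrix k n m B ` {1..m})"
proof
  have pk: "p ^ k > 0" using p by simp
  interpret Z: comm_group "Zp_vec p n" by (rule comm_group_Zp_vec[OF p])
  interpret W: comm_group "Zp_vec p m" by (rule comm_group_Zp_vec[OF p])
  interpret V: comm_group "vecs (p ^ k) n" by (rule comm_group_vecs)
  interpret f: group_hom "Zp_vec p m" "Zp_vec p n" "mat_apply p n m B" by unfold_locales (rule mat_apply_hom[OF p B])
  interpret r: group_hom "Zp_vec p n" "vecs (p ^ k) n" "reduce k n" by unfold_locales (rule reduce_hom[OF p])
  let ?X = "residue_matrix k n m B"
  have Xc: "?X j \<in> carrier (vecs (p ^ k) n)" if "j \<in> {1..m}" for j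
    unfolding carrier_vecs[OF pk] residue_matrix_def using that Zp_range[OF B[rule_format, OF _ that], of _ k]
    by (simp add: restrict_PiE_iff)
  then have XV: "?X ` {1..m} \<subseteq> carrier (vecs (p ^ k) n)" by auto
  note G = V.generate_is_subgroup[OF XV]
  show "generate (vecs (p ^ k) n) (?X ` {1..m}) \<subseteq> reduce k n ` mat_apply p n m B ` carrier (Zp_vec p m)"
  proof (rule V.generate_subgroup_incl)
    show "subgroup (reduce k n ` mat_apply p n m B ` carrier (Zp_vec p m)) (vecs (p ^ k) n)"
      by (rule r.subgroup_img_is_subgroup[OF f.img_is_subgroup])
    show "?X ` {1..m} \<subseteq> reduce k n ` mat_apply p n m B ` carrier (Zp_vec p m)"
    proof
      fix v assume "v \<in> ?X ` {1..m}"
      then obtain j where j: "j \<in> {1..m}" "v = ?X j" by blast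
      let ?e = "lift p m (\<lambda>j'. if j' = j then 1 else 0)"
      have e: "?e \<in> carrier (Zp_vec p m)" by (rule lift_in[OF p])
      have "reduce k n (mat_apply p n m B ?e) i = v i" for i
      proof (cases "i \<in> {1..n}")
        case True
        have "reduce k n (mat_apply p n m B ?e) i = (\<Sum>j'=1..m. B i j' k * ?e j' k) mod int p ^ k"
          using True mat_apply_at[OF p B e True, of k] by (simp add: reduce_def)
        also have "(\<Sum>j'=1..m. B i j' k * ?e j' k) = (\<Sum>j'=1..m. if j = j' then B i j k * (1 mod int p ^ k) else 0)"
          by (intro sum.cong refl) (auto simp: lift_def)
        also have "\<dots> = B i j k * (1 mod int p ^ k)" using j by (simp add: sum.delta)
        also have "\<dots> mod int p ^ k = B i j k" using Zp_range[OF B[rule_format, OF True j(1)], of k] by (simp add: mod_simps)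
        finally show ?thesis using True j by (simp add: residue_matrix_def)
      next
        case False
        then show ?thesis using j by (auto simp: reduce_def residue_matrix_def)
      qed
      then have "v = reduce k n (mat_apply p n m B ?e)" by (intro ext) simp
      then show "v \<in> reduce k n ` mat_apply p n m B ` carrier (Zp_vec p m)" using e by blast
    qed
  qed
  show "reduce k n ` mat_apply p n m B ` carrier (Zp_vec p m) \<subseteq> generate (vecs (p ^ k) n) (?X ` {1..m})"
  proof clarify
    fix y assume y: "y \<in> carrier (Zp_vec p m)"
    have part: "(\<lambda>i\<in>{1..n}. (\<Sum>j\<in>S. B i j k * y j k) mod int (p ^ k)) \<in> generate (vecs (p ^ k) n) (?X ` {1..m})"
      if "finite S" "S \<subseteq> {1..m}" for S
      using that
    proof (induction S rule: finite_induct)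
      case empty
      have "(\<lambda>i\<in>{1..n}. (\<Sum>j\<in>{}. B i j k * y j k) mod int (p ^ k)) = \<one>\<^bsub>vecs (p ^ k) n\<^esub>" by (simp add: one_vecs)
      then show ?case using subgroup.one_closed[OF G] by simp
    next
      case (insert j S)
      have j: "j \<in> {1..m}" using insert by simp
      have yj: "y j k \<ge> 0" using Zp_range[OF Zp_vec_mem[OF y j], of k] by simp
      let ?s = "\<lambda>i\<in>{1..n}. (\<Sum>j\<in>S. B i j k * y j k) mod int (p ^ k)"
      have eq1: "(\<lambda>i\<in>{1..n}. (\<Sum>j\<in>insert j S. B i j k * y j k) mod int (p ^ k))
         = ?X j [^]\<^bsub>vecs (p ^ k) n\<^esub> nat (y j k) \<otimes>\<^bsub>vecs (p ^ k) n\<^esub> ?s"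
        unfolding pow_vecs[OF Xc[OF j]] mult_vecs
      proof (rule restrict_ext)
        fix i assume i: "i \<in> {1..n}"
        have "?X j i = B i j k" using i j by (simp add: residue_matrix_def)
        then show "(\<Sum>j\<in>insert j S. B i j k * y j k) mod int (p ^ k)
          = ((\<lambda>i\<in>{1..n}. int (nat (y j k)) * ?X j i mod int (p ^ k)) i + ?s i) mod int (p ^ k)"
          using insert.hyps i yj by (simp add: mod_simps mult.commute)
      qed
      have mem1: "?X j [^]\<^bsub>vecs (p ^ k) n\<^esub> nat (y j k) \<in> generate (vecs (p ^ k) n) (?X ` {1..m})"
      proof -
        have "?X j [^]\<^bsub>vecs (p ^ k) n\<^esub> int (nat (y j k)) \<in> generate (vecs (p ^ k) n) (?X ` {1..m})"
          using j by (intro V.int_pow_in_subgroup[OF G] generate.incl) blast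
        then show ?thesis by (simp only: int_pow_int)
      qed
      have sS: "?s \<in> generate (vecs (p ^ k) n) (?X ` {1..m})" by (rule insert.IH) (use insert.prems in blast)
      show ?case unfolding eq1 by (rule subgroup.m_closed[OF G mem1 sS])
    qed
    have "reduce k n (mat_apply p n m B y) = (\<lambda>i\<in>{1..n}. (\<Sum>j\<in>{1..m}. B i j k * y j k) mod int (p ^ k))"
      unfolding reduce_def using mat_apply_at[OF p B y] by (intro restrict_ext) simp
    then show "reduce k n (mat_apply p n m B y) \<in> generate (vecs (p ^ k) n) (?X ` {1..m})" using part[of "{1..m}"] by simp
  qed
qed

lemma reduce_zero_imp_power:
  assumes p: "p > 0" and x: "x \<in> carrier (Zp_vec p n)" and 0: "\<And>i. i \<in> {1..n} \<Longrightarrow> x i k = 0"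
  shows "\<exists>z\<in>carrier (Zp_vec p n). (\<forall>i\<in>{1..n}. \<forall>l. int p ^ k * z i l = x i (l + k)) \<and> x = z [^]\<^bsub>Zp_vec p n\<^esub> (p ^ k)"
proof -
  interpret Z: comm_group "Zp_vec p n" by (rule comm_group_Zp_vec[OF p])
  have "\<forall>i\<in>{1..n}. \<exists>z. z \<in> carrier (Zp p) \<and> (\<forall>l. int p ^ k * z l = x i (l + k))"
    using Zp_divide_power[OF p Zp_vec_mem[OF x] 0] by blast
  then obtain f where f: "\<And>i. i \<in> {1..n} \<Longrightarrow> f i \<in> carrier (Zp p) \<and> (\<forall>l. int p ^ k * f i l = x i (l + k))" by metis
  define z where "z = restrict f {1..n}"
  have z: "z \<in> carrier (Zp_vec p n)" unfolding z_def carrier_Zp_vec using f by (simp add: restrict_PiE_iff)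
  have zl: "\<forall>i\<in>{1..n}. \<forall>l. int p ^ k * z i l = x i (l + k)" using f by (simp add: z_def)
  have "x = z [^]\<^bsub>Zp_vec p n\<^esub> (p ^ k)"
  proof (rule Zp_vec_eqI[OF x Z.nat_pow_closed[OF z]])
    fix i l assume i: "i \<in> {1..n}"
    show "x i l = (z [^]\<^bsub>Zp_vec p n\<^esub> (p ^ k)) i l"
      unfolding Zp_vec_pow_at[OF p z i] using zl i Zp_residue_mod[OF Zp_vec_mem[OF x i], of l "l + k"] by simp
  qed
  then show ?thesis using z zl by blast
qed


lemma reduce_eq_imp_difference:
  assumes p: "p > 0" and x: "x \<in> carrier (Zp_vec p n)" and b: "b \<in> carrier (Zp_vec p n)"
    and eq: "reduce k n x = reduce k n b"
  obtains d where "d \<in> carrier (Zp_vec p n)" "x = d \<otimes>\<^bsub>Zp_vec p n\<^esub> b" "\<And>i. i \<in> {1..n} \<Longrightarrow> d i k = 0"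
proof
  interpret Z: comm_group "Zp_vec p n" by (rule comm_group_Zp_vec[OF p])
  interpret V: group "vecs (p ^ k) n" by (rule group_vecs)
  interpret r: group_hom "Zp_vec p n" "vecs (p ^ k) n" "reduce k n" by unfold_locales (rule reduce_hom[OF p])
  let ?d = "x \<otimes>\<^bsub>Zp_vec p n\<^esub> inv\<^bsub>Zp_vec p n\<^esub> b"
  show "?d \<in> carrier (Zp_vec p n)" using x b by simp
  show "x = ?d \<otimes>\<^bsub>Zp_vec p n\<^esub> b" using x b by (simp add: Z.m_assoc)
  have "reduce k n ?d = reduce k n b \<otimes>\<^bsub>vecs (p ^ k) n\<^esub> inv\<^bsub>vecs (p ^ k) n\<^esub> reduce k n b" using x b eq by simp
  then have d: "reduce k n ?d = \<one>\<^bsub>vecs (p ^ k) n\<^esub>" using V.r_inv[OF r.hom_closed[OF b]] by simp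
  fix i assume "i \<in> {1..n}"
  then show "?d i k = 0" using fun_cong[OF d[unfolded reduce_def one_vecs], of i] by simp
qed

text \<open>
  If every element of \<open>N\<close> lies in the image up to \<open>p\<close> times another element of \<open>N\<close>, iteration produces
  vectors \<open>y\<^sub>t\<close> with \<open>x = B (\<Sum>\<^sub>t\<^sub><\<^sub>l p\<^sup>t y\<^sub>t) + p\<^sup>l x\<^sub>l\<close>. The series converges \<open>p\<close>-adically: modulo \<open>p\<^sup>l\<close> only its first
  \<open>l\<close> terms remain.
\<close>

lemma nakayama_successive_approximation:
  assumes p: "p > 0" and B: "\<forall>i\<in>{1..n}. \<forall>j\<in>{1..m}. B i j \<in> carrier (Zp p)"
    and step: "\<And>x. x \<in> N \<Longrightarrow> \<exists>y\<in>carrier (Zp_vec p m). \<exists>x'\<in>N.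
        \<forall>i\<in>{1..n}. \<forall>l. int p ^ l dvd x i l - mat_apply p n m B y i l - int p * x' i l"
    and N: "N \<subseteq> carrier (Zp_vec p n)" and x: "x \<in> N"
  shows "x \<in> mat_apply p n m B ` carrier (Zp_vec p m)"
proof -
  have "\<forall>x\<in>N. \<exists>z. fst z \<in> carrier (Zp_vec p m) \<and> snd z \<in> N \<and>
        (\<forall>i\<in>{1..n}. \<forall>l. int p ^ l dvd x i l - mat_apply p n m B (fst z) i l - int p * snd z i l)"
  proof
    fix x assume "x \<in> N"
    then obtain y x' where "y \<in> carrier (Zp_vec p m)" "x' \<in> N"
      "\<forall>i\<in>{1..n}. \<forall>l. int p ^ l dvd x i l - mat_apply p n m B y i l - int p * x' i l"
      using step by blast
    then show "\<exists>z. fst z \<in> carrier (Zp_vec p m) \<and> snd z \<in> N \<and>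
        (\<forall>i\<in>{1..n}. \<forall>l. int p ^ l dvd x i l - mat_apply p n m B (fst z) i l - int p * snd z i l)"
      by (intro exI[of _ "(y, x')"]) simp
  qed
  from bchoice[OF this] obtain f where f: "\<forall>x\<in>N. fst (f x) \<in> carrier (Zp_vec p m) \<and> snd (f x) \<in> N \<and>
        (\<forall>i\<in>{1..n}. \<forall>l. int p ^ l dvd x i l - mat_apply p n m B (fst (f x)) i l - int p * snd (f x) i l)" by blast
  define xs where "xs = rec_nat x (\<lambda>_ z. snd (f z))"
  have xs0: "xs 0 = x" and xsS: "xs (Suc t) = snd (f (xs t))" for t by (simp_all add: xs_def)
  have xN: "xs t \<in> N" for t
  proof (induction t)
    case 0
    show ?case unfolding xs0 by (rule x)
  next
    case (Suc t)
    then show ?case unfolding xsS using f by blast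
  qed
  define ys where "ys t = fst (f (xs t))" for t
  have yc: "ys t \<in> carrier (Zp_vec p m)" for t using f xN by (simp add: ys_def)
  have dv: "int p ^ l dvd xs t i l - mat_apply p n m B (ys t) i l - int p * xs (Suc t) i l" if "i \<in> {1..n}" for t i l
    using f xN[of t] that by (simp add: ys_def xsS)
  \<comment> \<open>the terms with \<open>t \<ge> l\<close> vanish modulo \<open>p\<^sup>l\<close>\<close>
  define Y where "Y = (\<lambda>j\<in>{1..m}. \<lambda>l. (\<Sum>t<l. int p ^ t * ys t j l) mod int p ^ l)"
  have Yc: "Y \<in> carrier (Zp_vec p m)"
    unfolding carrier_Zp_vec Y_def
  proof (rule restrict_PiE_iff[THEN iffD2], rule ballI, rule Zp_memI)
    fix j l assume j: "j \<in> {1..m}"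
    show "0 \<le> (\<Sum>t<l. int p ^ t * ys t j l) mod int p ^ l \<and> (\<Sum>t<l. int p ^ t * ys t j l) mod int p ^ l < int p ^ l"
      using p by simp
    have c: "ys t j (Suc l) mod int p ^ l = ys t j l" for t
      using Zp_residue_mod[OF Zp_vec_mem[OF yc j], of l "Suc l"] by simp
    have "(\<Sum>t<Suc l. int p ^ t * ys t j (Suc l)) mod int p ^ Suc l mod int p ^ l = (\<Sum>t<Suc l. int p ^ t * ys t j (Suc l)) mod int p ^ l"
      by (simp add: mod_mod_cancel)
    also have "\<dots> = (\<Sum>t<l. int p ^ t * ys t j (Suc l)) mod int p ^ l" by simp
    also have "\<dots> = (\<Sum>t<l. (int p ^ t * ys t j (Suc l)) mod int p ^ l) mod int p ^ l" by (rule mod_sum_eq[symmetric])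
    also have "\<dots> = (\<Sum>t<l. (int p ^ t * (ys t j (Suc l) mod int p ^ l)) mod int p ^ l) mod int p ^ l" by (simp only: mod_mult_right_eq)
    also have "\<dots> = (\<Sum>t<l. int p ^ t * ys t j l) mod int p ^ l" unfolding c by (rule mod_sum_eq)
    finally show "(\<Sum>t<Suc l. int p ^ t * ys t j (Suc l)) mod int p ^ Suc l mod int p ^ l = (\<Sum>t<l. int p ^ t * ys t j l) mod int p ^ l" .
  qed
  have "mat_apply p n m B Y = x"
  proof (rule Zp_vec_eqI[OF mat_apply_in[OF p B Yc]])
    show "x \<in> carrier (Zp_vec p n)" using x N by blast
    fix i l assume i: "i \<in> {1..n}"
    let ?P = "int p ^ l"
    have "mat_apply p n m B Y i l = (\<Sum>j=1..m. B i j l * ((\<Sum>t<l. int p ^ t * ys t j l) mod ?P)) mod ?P"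
      unfolding mat_apply_at[OF p B Yc i] by (simp add: Y_def)
    also have "\<dots> = (\<Sum>j=1..m. (B i j l * ((\<Sum>t<l. int p ^ t * ys t j l) mod ?P)) mod ?P) mod ?P" by (rule mod_sum_eq[symmetric])
    also have "\<dots> = (\<Sum>j=1..m. (B i j l * (\<Sum>t<l. int p ^ t * ys t j l)) mod ?P) mod ?P" by (simp only: mod_mult_right_eq)
    also have "\<dots> = (\<Sum>j=1..m. B i j l * (\<Sum>t<l. int p ^ t * ys t j l)) mod ?P" by (rule mod_sum_eq)
    also have "(\<Sum>j=1..m. B i j l * (\<Sum>t<l. int p ^ t * ys t j l)) = (\<Sum>t<l. int p ^ t * (\<Sum>j=1..m. B i j l * ys t j l))"
      unfolding sum_distrib_left by (subst sum.swap) (simp only: mult_ac)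
    also have "\<dots> mod ?P = (\<Sum>t<l. (int p ^ t * (\<Sum>j=1..m. B i j l * ys t j l)) mod ?P) mod ?P" by (rule mod_sum_eq[symmetric])
    also have "\<dots> = (\<Sum>t<l. (int p ^ t * mat_apply p n m B (ys t) i l) mod ?P) mod ?P"
      unfolding mat_apply_at[OF p B yc i] by (simp only: mod_mult_right_eq)
    also have "\<dots> = (\<Sum>t<l. int p ^ t * mat_apply p n m B (ys t) i l) mod ?P" by (rule mod_sum_eq)
    finally have 1: "mat_apply p n m B Y i l = (\<Sum>t<l. int p ^ t * mat_apply p n m B (ys t) i l) mod ?P" .
    have "?P dvd (\<Sum>t<l. int p ^ t * (xs t i l - mat_apply p n m B (ys t) i l - int p * xs (Suc t) i l))"
      using dv[OF i] by (intro dvd_sum dvd_mult) auto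
    also have "(\<Sum>t<l. int p ^ t * (xs t i l - mat_apply p n m B (ys t) i l - int p * xs (Suc t) i l))
        = (\<Sum>t<l. int p ^ t * xs t i l - int p ^ Suc t * xs (Suc t) i l) - (\<Sum>t<l. int p ^ t * mat_apply p n m B (ys t) i l)"
      unfolding sum_subtractf[symmetric] by (intro sum.cong refl) (simp add: algebra_simps)
    also have "(\<Sum>t<l. int p ^ t * xs t i l - int p ^ Suc t * xs (Suc t) i l) = x i l - ?P * xs l i l"
      using sum_lessThan_telescope'[of "\<lambda>t. int p ^ t * xs t i l" l] xs0 by simp
    finally have "?P dvd (x i l - (\<Sum>t<l. int p ^ t * mat_apply p n m B (ys t) i l)) - ?P * xs l i l"
      by (simp add: algebra_simps)
    then have "?P dvd x i l - (\<Sum>t<l. int p ^ t * mat_apply p n m B (ys t) i l)"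
      using dvd_add[OF _ dvd_triv_left[of ?P "xs l i l"]] by fastforce
    then have "x i l mod ?P = mat_apply p n m B Y i l" unfolding 1 by (rule mod_eq_dvd_iff[THEN iffD2])
    then show "mat_apply p n m B Y i l = x i l"
      using Zp_range[OF Zp_vec_mem[of x p n i], of l] x N i by auto
  qed
  then show ?thesis using Yc by blast
qed

context finite_p_exponent_group
begin

lemma p_pos: "p > 0" using p by (simp add: prime_gt_0_nat)

text \<open>
  A cokernel isomorphic to \<open>G\<close> is annihilated by \<open>q\<close>, so the surjection onto it factors through
  reduction modulo \<open>q\<close>.
\<close>

lemma cok_iso_imp_relations:
  assumes B: "\<forall>i\<in>{1..n}. \<forall>j\<in>{1..m}. B i j \<in> carrier (Zp p)" and iso: "cok p n m B \<cong> G"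
  shows "\<exists>g\<in>gens n. reduce k n ` mat_apply p n m B ` carrier (Zp_vec p m) = relations n g"
proof -
  let ?Z = "Zp_vec p n"
  let ?I = "mat_apply p n m B ` carrier (Zp_vec p m)"
  let ?\<rho> = "reduce k n"
  interpret Z: comm_group ?Z by (rule comm_group_Zp_vec[OF p_pos])
  interpret W: comm_group "Zp_vec p m" by (rule comm_group_Zp_vec[OF p_pos])
  interpret V: comm_group "vecs q n" by (rule comm_group_vecs)
  interpret f: group_hom "Zp_vec p m" ?Z "mat_apply p n m B" by unfold_locales (rule mat_apply_hom[OF p_pos B])
  have \<rho>h: "?\<rho> \<in> hom ?Z (vecs q n)" unfolding q by (rule reduce_hom[OF p_pos])
  interpret r: group_hom ?Z "vecs q n" ?\<rho> by unfold_locales (rule \<rho>h)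
  have I: "subgroup ?I ?Z" by (rule f.img_is_subgroup)
  obtain \<psi> where \<psi>: "\<psi> \<in> iso (?Z Mod ?I) G" using iso unfolding cok_def is_iso_def by blast
  obtain \<Psi> where \<Psi>h: "\<Psi> \<in> hom ?Z G" and surj: "\<Psi> ` carrier ?Z = carrier G"
    and ker: "\<And>x. x \<in> carrier ?Z \<Longrightarrow> \<Psi> x = \<one> \<longleftrightarrow> x \<in> ?I"
    using quotient_iso_as_hom[OF Z.comm_group_axioms I is_group \<psi>] by blast
  interpret P: group_hom ?Z G \<Psi> by unfold_locales (rule \<Psi>h)
  have wd: "\<Psi> x = \<Psi> y" if x: "x \<in> carrier ?Z" and y: "y \<in> carrier ?Z" and eq: "?\<rho> x = ?\<rho> y" for x y
  proof -
    obtain d where d: "d \<in> carrier ?Z" "x = d \<otimes>\<^bsub>?Z\<^esub> y" "\<And>i. i \<in> {1..n} \<Longrightarrow> d i k = 0"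
      using reduce_eq_imp_difference[OF p_pos x y eq] by blast
    obtain z where z: "z \<in> carrier ?Z" "d = z [^]\<^bsub>?Z\<^esub> (p ^ k)"
      using reduce_zero_imp_power[OF p_pos d(1,3)] by blast
    have "\<Psi> d = \<Psi> z [^] q" unfolding z(2) q by (rule P.hom_nat_pow[OF z(1)])
    then have "\<Psi> d = \<one>" using e[OF P.hom_closed[OF z(1)]] by simp
    then show ?thesis using d(1) y unfolding d(2) by simp
  qed
  define \<Phi> where "\<Phi> v = \<Psi> (lift p n v)" for v
  have lc: "lift p n v \<in> carrier ?Z" for v by (rule lift_in[OF p_pos])
  have rl: "?\<rho> (lift p n v) = v" if "v \<in> carrier (vecs q n)" for v
    using reduce_lift[OF p_pos, of v k n] that unfolding q by simp
  have \<Phi>\<rho>: "\<Phi> (?\<rho> x) = \<Psi> x" if x: "x \<in> carrier ?Z" for x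
    unfolding \<Phi>_def using x rl[OF r.hom_closed[OF x]] by (intro wd lc) auto
  have \<Phi>h: "\<Phi> \<in> hom (vecs q n) G"
  proof (rule homI)
    fix v w assume v: "v \<in> carrier (vecs q n)" and w: "w \<in> carrier (vecs q n)"
    show "\<Phi> v \<in> carrier G" unfolding \<Phi>_def by (rule P.hom_closed[OF lc])
    have "?\<rho> (lift p n v \<otimes>\<^bsub>?Z\<^esub> lift p n w) = v \<otimes>\<^bsub>vecs q n\<^esub> w"
      using r.hom_mult[OF lc lc] rl[OF v] rl[OF w] by simp
    then have "\<Phi> (v \<otimes>\<^bsub>vecs q n\<^esub> w) = \<Psi> (lift p n v \<otimes>\<^bsub>?Z\<^esub> lift p n w)"
      using \<Phi>\<rho>[OF Z.m_closed[OF lc lc], of v w] by simp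
    then show "\<Phi> (v \<otimes>\<^bsub>vecs q n\<^esub> w) = \<Phi> v \<otimes> \<Phi> w" unfolding \<Phi>_def using P.hom_mult[OF lc lc] by simp
  qed
  have "\<Phi> ` carrier (vecs q n) = carrier G"
  proof
    show "\<Phi> ` carrier (vecs q n) \<subseteq> carrier G" using \<Phi>h by (auto simp: hom_def)
    show "carrier G \<subseteq> \<Phi> ` carrier (vecs q n)"
      unfolding surj[symmetric] using \<Phi>\<rho> r.hom_closed by (metis image_eqI image_subsetI)
  qed
  from surjection_presentation[OF \<Phi>h this]
  obtain g where g: "g \<in> gens n" "relations n g = {v \<in> carrier (vecs q n). \<Phi> v = \<one>}" by blast
  have "?\<rho> ` ?I = relations n g" unfolding g(2)
  proof (intro equalityI subsetI)
    fix v assume "v \<in> ?\<rho> ` ?I"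
    then obtain x where x: "x \<in> ?I" "v = ?\<rho> x" by blast
    have xZ: "x \<in> carrier ?Z" using x(1) subgroup.mem_carrier[OF I] by blast
    then show "v \<in> {v \<in> carrier (vecs q n). \<Phi> v = \<one>}" using \<Phi>\<rho>[OF xZ] ker[OF xZ] x by simp
  next
    fix v assume "v \<in> {v \<in> carrier (vecs q n). \<Phi> v = \<one>}"
    then have v: "v \<in> carrier (vecs q n)" "lift p n v \<in> ?I" using ker[OF lc] by (auto simp: \<Phi>_def)
    then show "v \<in> ?\<rho> ` ?I" using rl[OF v(1)] by (metis imageI)
  qed
  then show ?thesis using g(1) by blast
qed

text \<open>
  Let \<open>\<Psi>\<close> be the surjection onto \<open>G\<close> given by \<open>g\<close>. Its kernel is the image of the matrix up to vectors
  divisible by \<open>q\<close>. Since \<open>p\<^sup>k\<^sup>-\<^sup>1\<close> already annihilates \<open>G\<close>, the set \<open>N\<close> of vectors divisible by \<open>p\<^sup>k\<^sup>-\<^sup>1\<close> lies in the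
  kernel, hence in the image plus \<open>p N\<close>; successive approximation puts \<open>N\<close> into the image.
\<close>

lemma relations_imp_cok_iso:
  assumes B: "\<forall>i\<in>{1..n}. \<forall>j\<in>{1..m}. B i j \<in> carrier (Zp p)"
    and e': "\<And>h. h \<in> carrier G \<Longrightarrow> h [^] (p ^ (k - 1)) = \<one>"
    and g: "g \<in> gens n" and eq: "reduce k n ` mat_apply p n m B ` carrier (Zp_vec p m) = relations n g"
  shows "cok p n m B \<cong> G"
proof -
  let ?Z = "Zp_vec p n"
  let ?I = "mat_apply p n m B ` carrier (Zp_vec p m)"
  let ?\<rho> = "reduce k n"
  interpret Z: comm_group ?Z by (rule comm_group_Zp_vec[OF p_pos])
  interpret W: comm_group "Zp_vec p m" by (rule comm_group_Zp_vec[OF p_pos])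
  interpret V: comm_group "vecs q n" by (rule comm_group_vecs)
  interpret f: group_hom "Zp_vec p m" ?Z "mat_apply p n m B" by unfold_locales (rule mat_apply_hom[OF p_pos B])
  have \<rho>h: "?\<rho> \<in> hom ?Z (vecs q n)" unfolding q by (rule reduce_hom[OF p_pos])
  interpret r: group_hom ?Z "vecs q n" ?\<rho> by unfold_locales (rule \<rho>h)
  have I: "subgroup ?I ?Z" by (rule f.img_is_subgroup)
  note gf = gens_funcset[OF g]
  interpret l: group_hom "vecs q n" G "lincomb G n g" by unfold_locales (rule lincomb_hom[OF gf])
  define \<Psi> where "\<Psi> x = lincomb G n g (?\<rho> x)" for x
  have \<Psi>h: "\<Psi> \<in> hom ?Z G"
    unfolding \<Psi>_def[abs_def] by (rule homI) simp_all
  interpret P: group_hom ?Z G \<Psi> by unfold_locales (rule \<Psi>h)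
  have surj: "\<Psi> ` carrier ?Z = carrier G"
  proof
    show "\<Psi> ` carrier ?Z \<subseteq> carrier G" using P.hom_closed by blast
    show "carrier G \<subseteq> \<Psi> ` carrier ?Z"
    proof
      fix a assume "a \<in> carrier G"
      then obtain v where v: "v \<in> carrier (vecs q n)" "a = lincomb G n g v" using lincomb_image_gens[OF g] by blast
      have "a = \<Psi> (lift p n v)" unfolding \<Psi>_def using reduce_lift[OF p_pos, of v k n] v unfolding q by simp
      then show "a \<in> \<Psi> ` carrier ?Z" using lift_in[OF p_pos] by blast
    qed
  qed
  define N where "N = {x \<in> carrier ?Z. \<forall>i\<in>{1..n}. x i (k - 1) = 0}"
  have NI: "x \<in> ?I" if x: "x \<in> N" for x
  proof (rule nakayama_successive_approximation[OF p_pos B _ _ x])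
    show "N \<subseteq> carrier ?Z" by (auto simp: N_def)
    fix x assume "x \<in> N"
    then have xZ: "x \<in> carrier ?Z" and x0: "\<And>i. i \<in> {1..n} \<Longrightarrow> x i (k - 1) = 0" by (auto simp: N_def)
    have "lincomb G n g (?\<rho> x) = (\<Otimes>i\<in>{1..n}. \<one>)"
      unfolding lincomb_def
    proof (rule finprod_cong')
      fix i assume i: "i \<in> {1..n}"
      have gi: "g i \<in> carrier G" using gf i by auto
      have "x i k mod int p ^ (k - 1) = 0" using Zp_residue_mod[OF Zp_vec_mem[OF xZ i], of "k - 1" k] x0[OF i] by simp
      then have "int (p ^ (k - 1)) dvd x i k - 0" by (simp add: dvd_eq_mod_eq_0)
      then have "g i [^] x i k = g i [^] (0::int)" by (rule int_pow_cong[OF gi e'[OF gi]])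
      then show "g i [^] ?\<rho> x i = \<one>" using i by (simp add: reduce_def)
    qed auto
    then have "?\<rho> x \<in> relations n g" unfolding relations_def using r.hom_closed[OF xZ] by simp
    then obtain y where y: "y \<in> carrier (Zp_vec p m)" "?\<rho> x = ?\<rho> (mat_apply p n m B y)" unfolding eq[symmetric] by blast
    let ?b = "mat_apply p n m B y"
    have bZ: "?b \<in> carrier ?Z" by (rule f.hom_closed[OF y(1)])
    obtain d where dZ: "d \<in> carrier ?Z" and xdb: "x = d \<otimes>\<^bsub>?Z\<^esub> ?b" and dk: "\<And>i. i \<in> {1..n} \<Longrightarrow> d i k = 0"
      using reduce_eq_imp_difference[OF p_pos xZ bZ y(2)] by blast
    have d1: "d i 1 = 0" if "i \<in> {1..n}" for i
      using Zp_residue_mod[OF Zp_vec_mem[OF dZ that], of 1 k] dk[OF that] k by simp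
    obtain x' where x': "x' \<in> carrier ?Z" "\<forall>i\<in>{1..n}. \<forall>l. int p ^ 1 * x' i l = d i (l + 1)"
      using reduce_zero_imp_power[OF p_pos dZ d1] by blast
    have "int p * x' i (k - 1) = 0" if "i \<in> {1..n}" for i using x'(2) that dk[OF that] k by simp
    then have "x' \<in> N" using x'(1) p_pos by (simp add: N_def)
    moreover have "int p ^ l dvd x i l - ?b i l - int p * x' i l" if i: "i \<in> {1..n}" for i l
    proof -
      have "x i l = (d i l + ?b i l) mod int p ^ l" unfolding xdb using i by (simp add: mult_Zp_vec Zp_add_at)
      moreover have "d i l = (int p * x' i l) mod int p ^ l"
        using x'(2) i Zp_residue_mod[OF Zp_vec_mem[OF dZ i], of l "l + 1"] by simp
      ultimately have "x i l mod int p ^ l = (int p * x' i l + ?b i l) mod int p ^ l" by (simp add: mod_simps)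
      then have "int p ^ l dvd x i l - (int p * x' i l + ?b i l)" by (rule mod_eq_dvd_iff[THEN iffD1])
      then show ?thesis by (simp add: algebra_simps)
    qed
    ultimately show "\<exists>y\<in>carrier (Zp_vec p m). \<exists>x'\<in>N.
        \<forall>i\<in>{1..n}. \<forall>l. int p ^ l dvd x i l - mat_apply p n m B y i l - int p * x' i l" using y(1) by blast
  qed
  have "kernel ?Z G \<Psi> = ?I"
  proof (intro equalityI subsetI)
    fix x assume "x \<in> kernel ?Z G \<Psi>"
    then have x: "x \<in> carrier ?Z" "lincomb G n g (?\<rho> x) = \<one>" by (auto simp: kernel_def \<Psi>_def)
    then have "?\<rho> x \<in> ?\<rho> ` ?I" unfolding eq relations_def using r.hom_closed[OF x(1)] by simp
    then obtain b where b: "b \<in> ?I" "?\<rho> x = ?\<rho> b" by blast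
    have bZ: "b \<in> carrier ?Z" using b(1) subgroup.mem_carrier[OF I] by blast
    obtain d where dZ: "d \<in> carrier ?Z" and xdb: "x = d \<otimes>\<^bsub>?Z\<^esub> b" and dk: "\<And>i. i \<in> {1..n} \<Longrightarrow> d i k = 0"
      using reduce_eq_imp_difference[OF p_pos x(1) bZ b(2)] by blast
    have "d i (k - 1) = 0" if "i \<in> {1..n}" for i
      using Zp_residue_mod[OF Zp_vec_mem[OF dZ that], of "k - 1" k] dk[OF that] by simp
    then have "d \<in> ?I" using dZ by (intro NI) (simp add: N_def)
    then show "x \<in> ?I" unfolding xdb using subgroup.m_closed[OF I] b(1) by blast
  next
    fix x assume x: "x \<in> ?I"
    then have "?\<rho> x \<in> relations n g" unfolding eq[symmetric] by blast
    then show "x \<in> kernel ?Z G \<Psi>" using subgroup.mem_carrier[OF I x] by (simp add: kernel_def \<Psi>_def relations_def)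
  qed
  then show ?thesis using P.FactGroup_iso[OF surj] unfolding cok_def by simp
qed

theorem cok_iso_iff:
  assumes B: "\<forall>i\<in>{1..n}. \<forall>j\<in>{1..m}. B i j \<in> carrier (Zp p)"
    and e': "\<And>h. h \<in> carrier G \<Longrightarrow> h [^] (p ^ (k - 1)) = \<one>"
  shows "cok p n m B \<cong> G \<longleftrightarrow> generate (vecs q n) (residue_matrix k n m B ` {1..m}) \<in> relations n ` gens n"
  using cok_iso_imp_relations[OF B] relations_imp_cok_iso[OF B e'] unfolding reduce_image[OF p_pos B] q by blast

end

section \<open>The limiting distribution\<close>

text \<open>
  An overgroup of \<open>L\<close> is a union of cosets of \<open>L\<close>, and there are \<open>N\<close> cosets.
\<close>

lemma card_overgroups_le:
  assumes q: "q > 0" and L: "L \<in> lattices q n N"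
  shows "card {K. subgroup K (vecs q n) \<and> L \<subseteq> K} \<le> 2 ^ N"
proof -
  interpret V: comm_group "vecs q n" by (rule comm_group_vecs)
  have LV: "subgroup L (vecs q n)" and c: "card (carrier (vecs q n)) = N * card L" using L by (auto simp: lattices_def)
  note fV = finite_vecs[OF q, of n]
  have L0: "card L > 0"
    using fV subgroup.subset[OF LV] subgroup.one_closed[OF LV] finite_subset by (auto simp: card_gt_0_iff)
  have "card (rcosets\<^bsub>vecs q n\<^esub> L) * card L = N * card L" using V.lagrange[OF LV] c by (simp add: order_def)
  then have cR: "card (rcosets\<^bsub>vecs q n\<^esub> L) = N" using L0 by simp
  have fR: "finite (rcosets\<^bsub>vecs q n\<^esub> L)" using fV by (simp add: RCOSETS_def)
  let ?f = "\<lambda>K. (\<lambda>x. L #>\<^bsub>vecs q n\<^esub> x) ` K"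
  let ?KK = "{K. subgroup K (vecs q n) \<and> L \<subseteq> K}"
  have un: "\<Union>(?f K) = K" if K: "subgroup K (vecs q n)" "L \<subseteq> K" for K
  proof (intro equalityI subsetI)
    fix z assume "z \<in> \<Union>(?f K)"
    then obtain x l where "x \<in> K" "l \<in> L" "z = l \<otimes>\<^bsub>vecs q n\<^esub> x" by (auto simp: r_coset_def)
    then show "z \<in> K" using subgroup.m_closed[OF K(1)] K(2) by blast
  next
    fix z assume z: "z \<in> K"
    then have "z \<in> L #>\<^bsub>vecs q n\<^esub> z" by (intro V.rcos_self LV subgroup.mem_carrier[OF K(1)])
    then show "z \<in> \<Union>(?f K)" using z by blast
  qed
  have "inj_on ?f ?KK"
  proof (rule inj_onI)
    fix K K' assume K: "K \<in> ?KK" "K' \<in> ?KK" and eq: "?f K = ?f K'"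
    have "\<Union>(?f K) = \<Union>(?f K')" using eq by simp
    then show "K = K'" using un K by simp
  qed
  moreover have "?f ` ?KK \<subseteq> Pow (rcosets\<^bsub>vecs q n\<^esub> L)"
    using subgroup.mem_carrier by (fastforce simp: RCOSETS_def)
  ultimately have "card ?KK \<le> card (Pow (rcosets\<^bsub>vecs q n\<^esub> L))"
    using fR by (intro card_inj_on_le[of ?f]) auto
  then show ?thesis using fR cR by (simp add: card_Pow)
qed

text \<open>
  The probability of the event \<open>R\<close> for a random matrix whose \<open>j\<close>-th column has entries with weights \<open>w j\<close>.
\<close>

definition column_mass :: "nat \<Rightarrow> nat \<Rightarrow> nat \<Rightarrow> (nat \<Rightarrow> nat \<Rightarrow> int \<Rightarrow> real) \<Rightarrow> ((nat \<Rightarrow> nat \<Rightarrow> int) \<Rightarrow> bool) \<Rightarrow> real" where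
  "column_mass q n m w R = (\<Sum>x | x \<in> PiE {1..m} (\<lambda>_. carrier (vecs q n)) \<and> R x. \<Prod>j=1..m. \<Prod>i\<in>{1..n}. w j i (x j i))"

context finite_p_exponent_group
begin

definition kernels :: "nat \<Rightarrow> (nat \<Rightarrow> int) set set" where
  "kernels n = relations n ` gens n"

text \<open>
  The expected number of pairs of a kernel \<open>K\<close> and a subspace of codimension \<open>d\<close> of \<open>K / K\<^sup>p\<close> that contains all
  columns.
\<close>

definition hyper_count :: "nat \<Rightarrow> nat \<Rightarrow> (nat \<Rightarrow> nat \<Rightarrow> int \<Rightarrow> real) \<Rightarrow> nat \<Rightarrow> real" where
  "hyper_count n m w d = (\<Sum>K\<in>kernels n. \<Sum>L\<in>comm_group.hyper (vecs q n) p K d. lattice_mass n m w L)"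

lemma kernels_facts:
  assumes "K \<in> kernels n"
  shows "subgroup K (vecs q n)" "finite K" "card (carrier (vecs q n)) = order G * card K"
proof -
  obtain g where g: "g \<in> gens n" "K = relations n g" using assms by (auto simp: kernels_def)
  show s: "subgroup K (vecs q n)" unfolding g by (rule relations_subgroup[OF gens_funcset[OF g(1)]])
  show "finite K" using subgroup.subset[OF s] finite_vecs[OF q_pos] finite_subset by blast
  show "card (carrier (vecs q n)) = order G * card K" unfolding g by (rule card_relations[OF g(1)])
qed

lemma finite_kernels: "finite (kernels n)" unfolding kernels_def using finite_gens by simp

lemma column_mass_bonferroni:
  assumes w: "\<And>j i r. j \<in> {1..m} \<Longrightarrow> i \<in> {1..n} \<Longrightarrow> r \<in> {0..<int q} \<Longrightarrow> w j i r \<ge> 0"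
  defines "P \<equiv> column_mass q n m w (\<lambda>x. generate (vecs q n) (x ` {1..m}) \<in> kernels n)"
    and "S \<equiv> \<lambda>D. \<Sum>d\<le>D. (-1) ^ d * real p ^ (d choose 2) * hyper_count n m w d"
  shows "even D \<Longrightarrow> P \<le> S D" "odd D \<Longrightarrow> S D \<le> P"
proof -
  interpret V: comm_group "vecs q n" by (rule comm_group_vecs)
  let ?X = "PiE {1..m} (\<lambda>_. carrier (vecs q n))"
  let ?W = "\<lambda>x. \<Prod>j=1..m. \<Prod>i\<in>{1..n}. w j i (x j i)"
  let ?g = "\<lambda>x. generate (vecs q n) (x ` {1..m})"
  have fX: "finite ?X" using finite_vecs[OF q_pos] by (intro finite_PiE) auto
  have W0: "?W x \<ge> 0" if "x \<in> ?X" for x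
    using that w by (intro prod_nonneg) (auto simp: PiE_iff carrier_vecs[OF q_pos])
  have sub: "x ` {1..m} \<subseteq> carrier (vecs q n)" if "x \<in> ?X" for x using that by auto
  have gG: "subgroup (?g x) (vecs q n)" if "x \<in> ?X" for x by (rule V.generate_is_subgroup[OF sub[OF that]])
  have ex: "x [^]\<^bsub>vecs q n\<^esub> (p ^ k) = \<one>\<^bsub>vecs q n\<^esub>" if "x \<in> carrier (vecs q n)" for x
    unfolding q[symmetric] pow_vecs[OF that] one_vecs by simp
  define c where "c d = (-1) ^ d * real p ^ (d choose 2)" for d
  define b where "b x K d = real (card {L \<in> V.hyper p K d. ?g x \<subseteq> L})" for x K d
  have B: "even D \<Longrightarrow> (if ?g x = K then 1 else 0) \<le> (\<Sum>d\<le>D. c d * b x K d)"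
     "odd D \<Longrightarrow> (\<Sum>d\<le>D. c d * b x K d) \<le> (if ?g x = K then 1 else 0)"
    if x: "x \<in> ?X" and K: "K \<in> kernels n" for x K
    unfolding c_def b_def
    using V.bonferroni_generation[OF kernels_facts(1,2)[OF K] gG[OF x] p ex, of D] subgroup.mem_carrier[OF kernels_facts(1)[OF K]]
    by auto
  have P: "P = (\<Sum>x\<in>?X. ?W x * (\<Sum>K\<in>kernels n. if ?g x = K then 1 else 0))"
  proof -
    have "P = (\<Sum>x\<in>?X. if ?g x \<in> kernels n then ?W x else 0)"
      unfolding P_def column_mass_def by (rule sum.inter_filter[OF fX])
    also have "\<dots> = (\<Sum>x\<in>?X. ?W x * (\<Sum>K\<in>kernels n. if ?g x = K then 1 else 0))"
      using finite_kernels by (intro sum.cong refl) (simp add: sum.delta)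
    finally show ?thesis .
  qed
  have fh: "finite (V.hyper p K d)" if K: "K \<in> kernels n" for K d
    by (rule finite_subset[of _ "Pow K"]) (use kernels_facts(2)[OF K] in \<open>auto simp: V.hyper_def\<close>)
  have mass: "(\<Sum>x\<in>?X. ?W x * b x K d) = (\<Sum>L\<in>V.hyper p K d. lattice_mass n m w L)" if K: "K \<in> kernels n" for K d
  proof -
    have "(\<Sum>x\<in>?X. ?W x * b x K d) = (\<Sum>x\<in>?X. \<Sum>L\<in>V.hyper p K d. if ?g x \<subseteq> L then ?W x else 0)"
    proof (rule sum.cong[OF refl])
      fix x
      have "b x K d = (\<Sum>L | L \<in> V.hyper p K d \<and> ?g x \<subseteq> L. 1)" by (simp add: b_def)
      also have "\<dots> = (\<Sum>L\<in>V.hyper p K d. if ?g x \<subseteq> L then 1 else 0)" by (rule sum.inter_filter[OF fh[OF K]])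
      finally show "?W x * b x K d = (\<Sum>L\<in>V.hyper p K d. if ?g x \<subseteq> L then ?W x else 0)"
        by (simp add: sum_distrib_left if_distrib cong: if_cong)
    qed
    also have "\<dots> = (\<Sum>L\<in>V.hyper p K d. \<Sum>x\<in>?X. if ?g x \<subseteq> L then ?W x else 0)" by (rule sum.swap)
    also have "\<dots> = (\<Sum>L\<in>V.hyper p K d. lattice_mass n m w L)"
    proof (rule sum.cong[OF refl])
      fix L assume L: "L \<in> V.hyper p K d"
      then have LV: "subgroup L (vecs q n)" by (simp add: V.hyper_def)
      have "(\<Sum>x\<in>?X. if ?g x \<subseteq> L then ?W x else 0) = (\<Sum>x | x \<in> ?X \<and> ?g x \<subseteq> L. ?W x)"
        by (rule sum.inter_filter[OF fX, symmetric])
      also have "{x. x \<in> ?X \<and> ?g x \<subseteq> L} = PiE {1..m} (\<lambda>_. L)"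
      proof (intro equalityI subsetI)
        fix x assume x: "x \<in> {x. x \<in> ?X \<and> ?g x \<subseteq> L}"
        then have "x j \<in> L" if "j \<in> {1..m}" for j using that generate.incl[of "x j" "x ` {1..m}" "vecs q n"] by auto
        then show "x \<in> PiE {1..m} (\<lambda>_. L)" using x by (auto simp: PiE_iff)
      next
        fix x assume x: "x \<in> PiE {1..m} (\<lambda>_. L)"
        then have "?g x \<subseteq> L" by (intro V.generate_subgroup_incl LV) auto
        then show "x \<in> {x. x \<in> ?X \<and> ?g x \<subseteq> L}" using x subgroup.mem_carrier[OF LV] by (auto simp: PiE_iff)
      qed
      also have "(\<Sum>x\<in>PiE {1..m} (\<lambda>_. L). ?W x) = lattice_mass n m w L"
        unfolding lattice_mass_def
        using subgroup.subset[OF LV] finite_vecs[OF q_pos] finite_subset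
        by (subst prod_sum_PiE) auto
      finally show "(\<Sum>x\<in>?X. if ?g x \<subseteq> L then ?W x else 0) = lattice_mass n m w L" .
    qed
    finally show ?thesis .
  qed
  have S: "S D = (\<Sum>x\<in>?X. ?W x * (\<Sum>K\<in>kernels n. \<Sum>d\<le>D. c d * b x K d))" for D
  proof -
    have "S D = (\<Sum>d\<le>D. c d * (\<Sum>K\<in>kernels n. \<Sum>x\<in>?X. ?W x * b x K d))"
      unfolding S_def hyper_count_def c_def using mass by simp
    also have "\<dots> = (\<Sum>d\<le>D. \<Sum>K\<in>kernels n. \<Sum>x\<in>?X. ?W x * (c d * b x K d))"
      unfolding sum_distrib_left by (intro sum.cong refl) simp
    also have "\<dots> = (\<Sum>K\<in>kernels n. \<Sum>d\<le>D. \<Sum>x\<in>?X. ?W x * (c d * b x K d))" by (rule sum.swap)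
    also have "\<dots> = (\<Sum>K\<in>kernels n. \<Sum>x\<in>?X. \<Sum>d\<le>D. ?W x * (c d * b x K d))" by (intro sum.cong refl sum.swap)
    also have "\<dots> = (\<Sum>x\<in>?X. \<Sum>K\<in>kernels n. \<Sum>d\<le>D. ?W x * (c d * b x K d))" by (rule sum.swap)
    finally show ?thesis by (simp only: sum_distrib_left)
  qed
  show "even D \<Longrightarrow> P \<le> S D" unfolding P S using W0 B by (intro sum_mono mult_left_mono) auto
  show "odd D \<Longrightarrow> S D \<le> P" unfolding P S using W0 B by (intro sum_mono mult_left_mono) auto
qed

text \<open>
  With \<open>N = order G * p\<^sup>d\<close>, every lattice in the double sum has index \<open>N\<close> and occurs for at most \<open>2\<^sup>N\<close> kernels, so
  by universality the probabilities may be replaced by \<open>1 / N\<^sup>n\<^sup>+\<^sup>u\<close>. What remains is the number of pairs, a product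
  of the number of kernels and a Gaussian binomial coefficient.
\<close>

lemma hyper_count_tendsto:
  fixes a :: "nat \<Rightarrow> nat \<Rightarrow> real" and w :: "nat \<Rightarrow> nat \<Rightarrow> nat \<Rightarrow> int \<Rightarrow> real"
  assumes a0: "\<And>n j. n \<ge> 1 \<Longrightarrow> j \<in> {1..n+u} \<Longrightarrow> a n j \<ge> 0"
    and lim: "\<And>\<epsilon>::real. \<epsilon> > 0 \<Longrightarrow> (\<lambda>n. \<Sum>j=1..n+u. exp (- \<epsilon> * a n j * real n)) \<longlonglongrightarrow> 0"
    and w: "\<And>n j i. n \<ge> 1 \<Longrightarrow> j \<in> {1..n+u} \<Longrightarrow> i \<in> {1..n} \<Longrightarrow> balanced_weights p q (a n j) (w n j i)"
    and e': "\<And>h. h \<in> carrier G \<Longrightarrow> h [^] (p ^ (k - 1)) = \<one>"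
  shows "(\<lambda>n. hyper_count n (n+u) (w n) d) \<longlonglongrightarrow> 1 / (real (order G) ^ u * real (order (AutoGroup G))) * (1 / real p ^ u) ^ d / frames p d d"
proof -
  define N where "N = order G * p ^ d"
  have p2: "p \<ge> 2" using p by (rule prime_ge_2_nat)
  have o1: "order G \<ge> 1" using order_pos by simp
  have N0: "N > 0" using p2 o1 by (simp add: N_def)
  define f where "f n L = lattice_mass n (n+u) (w n) L" for n L
  define hy where "hy n K = comm_group.hyper (vecs q n) p K d" for n K
  have hyl: "hy n K \<subseteq> lattices q n N" if K: "K \<in> kernels n" for n K
  proof -
    interpret V: comm_group "vecs q n" by (rule comm_group_vecs)
    show ?thesis using kernels_facts(3)[OF K] by (auto simp: hy_def V.hyper_def lattices_def N_def)
  qed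
  have hyK: "K \<in> {K. subgroup K (vecs q n) \<and> L \<subseteq> K}" if K: "K \<in> kernels n" and L: "L \<in> hy n K" for n K L
  proof -
    interpret V: comm_group "vecs q n" by (rule comm_group_vecs)
    show ?thesis using kernels_facts(1)[OF K] L by (auto simp: hy_def V.hyper_def)
  qed
  have fl: "finite (lattices q n N)" for n by (rule finite_lattices[OF q_pos])
  have err: "\<bar>hyper_count n (n+u) (w n) d - (\<Sum>K\<in>kernels n. \<Sum>L\<in>hy n K. 1 / real N ^ (n+u))\<bar>
     \<le> 2 ^ N * (\<Sum>L\<in>lattices q n N. \<bar>f n L - 1 / real N ^ (n+u)\<bar>)" for n
  proof -
    have "\<bar>hyper_count n (n+u) (w n) d - (\<Sum>K\<in>kernels n. \<Sum>L\<in>hy n K. 1 / real N ^ (n+u))\<bar>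
       = \<bar>\<Sum>K\<in>kernels n. \<Sum>L\<in>hy n K. f n L - 1 / real N ^ (n+u)\<bar>"
      by (simp add: hyper_count_def f_def hy_def sum_subtractf)
    also have "\<dots> \<le> (\<Sum>K\<in>kernels n. \<Sum>L\<in>hy n K. \<bar>f n L - 1 / real N ^ (n+u)\<bar>)"
      by (intro order_trans[OF sum_abs] sum_mono sum_abs)
    also have "\<dots> = (\<Sum>K\<in>kernels n. \<Sum>L\<in>lattices q n N. if L \<in> hy n K then \<bar>f n L - 1 / real N ^ (n+u)\<bar> else 0)"
    proof (rule sum.cong[OF refl])
      fix K assume K: "K \<in> kernels n"
      have "hy n K = {L \<in> lattices q n N. L \<in> hy n K}" using hyl[OF K] by blast
      then show "(\<Sum>L\<in>hy n K. \<bar>f n L - 1 / real N ^ (n+u)\<bar>) = (\<Sum>L\<in>lattices q n N. if L \<in> hy n K then \<bar>f n L - 1 / real N ^ (n+u)\<bar> else 0)"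
        using sum.inter_filter[OF fl, of "\<lambda>L. \<bar>f n L - 1 / real N ^ (n+u)\<bar>" n "\<lambda>L. L \<in> hy n K"] by simp
    qed
    also have "\<dots> = (\<Sum>L\<in>lattices q n N. \<Sum>K\<in>kernels n. if L \<in> hy n K then \<bar>f n L - 1 / real N ^ (n+u)\<bar> else 0)"
      by (rule sum.swap)
    also have "\<dots> \<le> (\<Sum>L\<in>lattices q n N. 2 ^ N * \<bar>f n L - 1 / real N ^ (n+u)\<bar>)"
    proof (rule sum_mono)
      fix L assume L: "L \<in> lattices q n N"
      have "(\<Sum>K\<in>kernels n. if L \<in> hy n K then \<bar>f n L - 1 / real N ^ (n+u)\<bar> else 0)
        = (\<Sum>K | K \<in> kernels n \<and> L \<in> hy n K. \<bar>f n L - 1 / real N ^ (n+u)\<bar>)"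
        by (rule sum.inter_filter[OF finite_kernels, symmetric])
      also have "\<dots> = real (card {K. K \<in> kernels n \<and> L \<in> hy n K}) * \<bar>f n L - 1 / real N ^ (n+u)\<bar>" by simp
      also have "\<dots> \<le> 2 ^ N * \<bar>f n L - 1 / real N ^ (n+u)\<bar>"
      proof (rule mult_right_mono)
        have fin: "finite {K. subgroup K (vecs q n) \<and> L \<subseteq> K}"
          by (rule finite_subset[of _ "Pow (carrier (vecs q n))"]) (auto simp: finite_vecs[OF q_pos] dest: subgroup.subset)
        have "card {K. K \<in> kernels n \<and> L \<in> hy n K} \<le> card {K. subgroup K (vecs q n) \<and> L \<subseteq> K}"
          by (rule card_mono[OF fin]) (use hyK in blast)
        also have "\<dots> \<le> 2 ^ N" by (rule card_overgroups_le[OF q_pos L])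
        finally have "real (card {K. K \<in> kernels n \<and> L \<in> hy n K}) \<le> real (2 ^ N)" by (rule of_nat_mono)
        then show "real (card {K. K \<in> kernels n \<and> L \<in> hy n K}) \<le> 2 ^ N" by simp
      qed simp
      finally show "(\<Sum>K\<in>kernels n. if L \<in> hy n K then \<bar>f n L - 1 / real N ^ (n+u)\<bar> else 0) \<le> 2 ^ N * \<bar>f n L - 1 / real N ^ (n+u)\<bar>" .
    qed
    finally show ?thesis by (simp only: sum_distrib_left)
  qed
  have "(\<lambda>n. 2 ^ N * (\<Sum>L\<in>lattices q n N. \<bar>f n L - 1 / real N ^ (n+u)\<bar>)) \<longlonglongrightarrow> 2 ^ N * 0"
    unfolding f_def by (intro tendsto_mult_left lattice_mass_l1_tendsto_0[OF p k q N0 a0 lim w])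
  then have "(\<lambda>n. 2 ^ N * (\<Sum>L\<in>lattices q n N. \<bar>f n L - 1 / real N ^ (n+u)\<bar>)) \<longlonglongrightarrow> 0" by simp
  from Lim_null_comparison[OF _ this, of "\<lambda>n. hyper_count n (n+u) (w n) d - (\<Sum>K\<in>kernels n. \<Sum>L\<in>hy n K. 1 / real N ^ (n+u))"]
  have diff: "(\<lambda>n. hyper_count n (n+u) (w n) d - (\<Sum>K\<in>kernels n. \<Sum>L\<in>hy n K. 1 / real N ^ (n+u))) \<longlonglongrightarrow> 0"
    using err by simp
  have A0: "order (AutoGroup G) > 0"
  proof -
    have "group (AutoGroup G)" by (rule AutoGroup)
    moreover have "finite (carrier (AutoGroup G))"
      unfolding AutoGroup_def auto_def
      by (simp, rule finite_subset[of _ "PiE (carrier G) (\<lambda>_. carrier G)"])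
         (use fin finite_PiE in \<open>auto simp: Bij_def PiE_def hom_def\<close>)
    ultimately show ?thesis by (simp add: monoid.order_gt_0_iff_finite[OF group.is_monoid])
  qed
  have main: "(\<Sum>K\<in>kernels n. \<Sum>L\<in>hy n K. 1 / real N ^ (n+u))
     = (real (card (gens n)) / real (order G) ^ n) * (real (gbinom p n d) / real p ^ (d * n)) * (1 / (real (order G) ^ u * real (order (AutoGroup G))) * (1 / real p ^ u) ^ d)" for n
  proof -
    interpret V: comm_group "vecs q n" by (rule comm_group_vecs)
    have "card (hy n K) = gbinom p n d" if K: "K \<in> kernels n" for K
    proof -
      obtain g where g: "g \<in> gens n" "K = relations n g" using K by (auto simp: kernels_def)
      show ?thesis unfolding hy_def
        using card_relations_power_image[OF e' gens_funcset[OF g(1)]] g(2)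
        by (intro V.card_hyper kernels_facts[OF K] p) auto
    qed
    then have "(\<Sum>K\<in>kernels n. \<Sum>L\<in>hy n K. 1 / real N ^ (n+u)) = real (card (kernels n)) * real (gbinom p n d) / real N ^ (n+u)"
      by simp
    also have "real (card (kernels n)) = real (card (gens n)) / real (order (AutoGroup G))"
      using card_gens_eq[of n] A0 by (simp add: kernels_def)
    also have "real (card (gens n)) / real (order (AutoGroup G)) * real (gbinom p n d) / real N ^ (n+u)
      = (real (card (gens n)) / real (order G) ^ n) * (real (gbinom p n d) / real p ^ (d * n)) * (1 / (real (order G) ^ u * real (order (AutoGroup G))) * (1 / real p ^ u) ^ d)"
    proof -
      have "real N ^ (n+u) = real (order G) ^ n * real (order G) ^ u * (real p ^ (d * n) * (real p ^ u) ^ d)"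
        by (simp add: N_def power_mult_distrib power_add power_mult[symmetric] mult.commute)
      then show ?thesis by (simp add: power_one_over)
    qed
    finally show ?thesis .
  qed
  have "(\<lambda>n. \<Sum>K\<in>kernels n. \<Sum>L\<in>hy n K. 1 / real N ^ (n+u)) \<longlonglongrightarrow> 1 * (1 / frames p d d) * (1 / (real (order G) ^ u * real (order (AutoGroup G))) * (1 / real p ^ u) ^ d)"
    unfolding main by (intro tendsto_mult tendsto_const card_gens_asymptotics gbinom_asymptotics[OF p2])
  from tendsto_add[OF diff this] show ?thesis by (simp add: mult_ac)
qed

theorem column_mass_tendsto:
  fixes a :: "nat \<Rightarrow> nat \<Rightarrow> real" and w :: "nat \<Rightarrow> nat \<Rightarrow> nat \<Rightarrow> int \<Rightarrow> real"
  assumes a0: "\<And>n j. n \<ge> 1 \<Longrightarrow> j \<in> {1..n+u} \<Longrightarrow> a n j \<ge> 0"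
    and lim: "\<And>\<epsilon>::real. \<epsilon> > 0 \<Longrightarrow> (\<lambda>n. \<Sum>j=1..n+u. exp (- \<epsilon> * a n j * real n)) \<longlonglongrightarrow> 0"
    and w: "\<And>n j i. n \<ge> 1 \<Longrightarrow> j \<in> {1..n+u} \<Longrightarrow> i \<in> {1..n} \<Longrightarrow> balanced_weights p q (a n j) (w n j i)"
    and e': "\<And>h. h \<in> carrier G \<Longrightarrow> h [^] (p ^ (k - 1)) = \<one>"
  shows "(\<lambda>n. column_mass q n (n+u) (w n) (\<lambda>x. generate (vecs q n) (x ` {1..n+u}) \<in> kernels n))
    \<longlonglongrightarrow> 1 / (real (order G) ^ u * real (order (AutoGroup G))) * (\<Prod>i. 1 - 1 / real p ^ (Suc i + u))"
proof -
  let ?c = "1 / (real (order G) ^ u * real (order (AutoGroup G)))"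
  have p2: "p \<ge> 2" using p by (rule prime_ge_2_nat)
  have w0: "w n j i r \<ge> 0" if "n \<ge> 1" "j \<in> {1..n+u}" "i \<in> {1..n}" "r \<in> {0..<int q}" for n j i r
    using w[OF that(1-3)] that(4) by (simp add: balanced_weights_def)
  define L where "L D = ?c * (\<Sum>d\<le>D. euler_coeff p d * (1 / real p ^ u) ^ d)" for D
  have "summable (\<lambda>d. euler_coeff p d * (1 / real p ^ u) ^ d)"
    using p2 by (intro summable_euler_powser) auto
  then have "(\<lambda>D. \<Sum>d\<le>D. euler_coeff p d * (1 / real p ^ u) ^ d) \<longlonglongrightarrow> euler_series p (1 / real p ^ u)"
    unfolding euler_series_def by (rule summable_LIMSEQ')
  then have L: "L \<longlonglongrightarrow> ?c * (\<Prod>i. 1 - 1 / real p ^ (Suc i + u))"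
    unfolding L_def[abs_def] euler_product[OF p2] by (rule tendsto_mult_left)
  show ?thesis
  proof (rule alternating_sandwich[OF _ L])
    fix D
    have "(\<lambda>n. \<Sum>d\<le>D. (-1) ^ d * real p ^ (d choose 2) * hyper_count n (n+u) (w n) d)
       \<longlonglongrightarrow> (\<Sum>d\<le>D. (-1) ^ d * real p ^ (d choose 2) * (?c * (1 / real p ^ u) ^ d / frames p d d))"
      by (intro tendsto_sum tendsto_mult_left hyper_count_tendsto[OF a0 lim w e'])
    also have "(\<Sum>d\<le>D. (-1) ^ d * real p ^ (d choose 2) * (?c * (1 / real p ^ u) ^ d / frames p d d)) = L D"
      unfolding L_def sum_distrib_left by (intro sum.cong refl) (simp add: euler_coeff_def)
    finally show "(\<lambda>n. \<Sum>d\<le>D. (-1) ^ d * real p ^ (d choose 2) * hyper_count n (n+u) (w n) d) \<longlonglongrightarrow> L D" .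
    show "even D \<Longrightarrow> eventually (\<lambda>n. column_mass q n (n+u) (w n) (\<lambda>x. generate (vecs q n) (x ` {1..n+u}) \<in> kernels n)
       \<le> (\<Sum>d\<le>D. (-1) ^ d * real p ^ (d choose 2) * hyper_count n (n+u) (w n) d)) sequentially"
      using eventually_ge_at_top[of 1] by eventually_elim (rule column_mass_bonferroni(1)[OF w0])
    show "odd D \<Longrightarrow> eventually (\<lambda>n. (\<Sum>d\<le>D. (-1) ^ d * real p ^ (d choose 2) * hyper_count n (n+u) (w n) d)
       \<le> column_mass q n (n+u) (w n) (\<lambda>x. generate (vecs q n) (x ` {1..n+u}) \<in> kernels n)) sequentially"
      using eventually_ge_at_top[of 1] by eventually_elim (rule column_mass_bonferroni(2)[OF w0])
  qed
qed

end

theorem theorem1p3: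
  fixes p u :: nat
    and \<alpha> :: "nat \<Rightarrow> nat \<Rightarrow> real"
    and M :: "nat \<Rightarrow> 'a measure"
    and A :: "nat \<Rightarrow> 'a \<Rightarrow> nat \<Rightarrow> nat \<Rightarrow> padic"
    and H :: "'h monoid"
  assumes "Factorial_Ring.prime p"
    and "\<And>n i. n \<ge> 1 \<Longrightarrow> i \<in> {1..n + u} \<Longrightarrow> \<alpha> n i \<in> {0<..1/2}"
    and "\<And>\<epsilon>::real. \<epsilon> > 0 \<Longrightarrow>
           (\<lambda>n. \<Sum>i = 1..n + u. exp (- \<epsilon> * \<alpha> n i * real n)) \<longlonglongrightarrow> 0"
    and "\<And>n. n \<ge> 1 \<Longrightarrow> prob_space (M n)"
    and "\<And>n. n \<ge> 1 \<Longrightarrow>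
           prob_space.indep_vars (M n) (\<lambda>_. Zp_borel p) (\<lambda>(i, j) \<omega>. A n \<omega> i j)
             ({1..n} \<times> {1..n + u})"
    and "\<And>n i. n \<ge> 1 \<Longrightarrow> i \<in> {1..n + u} \<Longrightarrow>
           balanced_vector p (M n) (\<alpha> n i) {1..n} (\<lambda>k \<omega>. A n \<omega> k i)"
    and "comm_group H" and "finite (carrier H)" and "\<exists>k. Coset.order H = p ^ k"
  shows "(\<lambda>n. measure (M n) {\<omega> \<in> space (M n). cok p n (n + u) (A n \<omega>) \<cong> H})
           \<longlonglongrightarrow> 1 / (real (Coset.order H) ^ u * real (Coset.order (AutoGroup H)))
               * (\<Prod>i. 1 - 1 / real p ^ (Suc i + u))"
proof -
  interpret H: comm_group H by fact
  obtain e where e: "order H = p ^ e" using assms(9) by blast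
  have p0: "p > 0" using assms(1) by (simp add: prime_gt_0_nat)
  \<comment> \<open>not \<open>e\<close> itself: Nakayama needs \<open>p\<^sup>k\<^sup>-\<^sup>1\<close> to annihilate \<open>H\<close>\<close>
  define k where "k = Suc e"
  define q where "q = p ^ k"
  have ke: "h [^]\<^bsub>H\<^esub> (p ^ (k - 1)) = \<one>\<^bsub>H\<^esub>" if "h \<in> carrier H" for h
    using H.pow_order_eq_1[OF that] by (simp add: k_def e)
  interpret H: finite_p_exponent_group H p k q
  proof unfold_locales
    fix h assume h: "h \<in> carrier H"
    have "h [^]\<^bsub>H\<^esub> q = (h [^]\<^bsub>H\<^esub> (p ^ (k - 1))) [^]\<^bsub>H\<^esub> p"
      using h by (simp add: q_def k_def H.nat_pow_pow mult.commute)
    then show "h [^]\<^bsub>H\<^esub> q = \<one>\<^bsub>H\<^esub>" using ke[OF h] by simp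
  qed (use assms in \<open>auto simp: k_def q_def\<close>)
  define w where "w n j i r = measure (M n) {\<omega> \<in> space (M n). A n \<omega> i j k = r}" for n j i and r :: int
  have a0: "\<alpha> n j \<ge> 0" "\<alpha> n j \<le> 1" if "n \<ge> 1" "j \<in> {1..n+u}" for n j using assms(2)[OF that] by auto
  have w: "balanced_weights p q (\<alpha> n j) (w n j i)" if n: "n \<ge> 1" and j: "j \<in> {1..n+u}" and i: "i \<in> {1..n}" for n j i
  proof -
    have "balanced p (M n) (\<alpha> n j) (\<lambda>\<omega>. A n \<omega> i j)" using assms(6)[OF n j] i by (simp add: balanced_vector_def)
    from balanced_imp_balanced_weights[OF assms(4)[OF n] assms(1) H.k a0(2)[OF n j] this]
    show ?thesis by (simp add: q_def w_def[abs_def])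
  qed
  have "measure (M n) {\<omega> \<in> space (M n). cok p n (n + u) (A n \<omega>) \<cong> H}
     = column_mass q n (n+u) (w n) (\<lambda>x. generate (vecs q n) (x ` {1..n+u}) \<in> H.kernels n)" if n: "n \<ge> 1" for n
  proof -
    let ?R = "\<lambda>x. generate (vecs q n) (x ` {1..n+u}) \<in> H.kernels n"
    have nu: "n + u \<ge> 1" using n by simp
    note law = residue_matrix_law[OF assms(4)[OF n] p0 assms(5)[OF n] n nu]
    have "{\<omega> \<in> space (M n). cok p n (n + u) (A n \<omega>) \<cong> H}
       = {\<omega> \<in> space (M n). ?R (residue_matrix k n (n+u) (A n \<omega>))}"
    proof (rule Collect_cong, rule conj_cong[OF refl])
      fix \<omega> assume "\<omega> \<in> space (M n)"
      then have "\<forall>i\<in>{1..n}. \<forall>j\<in>{1..n+u}. A n \<omega> i j \<in> carrier (Zp p)" using law(3) by blast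
      then show "cok p n (n + u) (A n \<omega>) \<cong> H \<longleftrightarrow> ?R (residue_matrix k n (n+u) (A n \<omega>))"
        unfolding H.kernels_def by (rule H.cok_iso_iff[OF _ ke])
    qed
    then show ?thesis using law(1)[where k = k and R = ?R] by (simp add: column_mass_def w_def q_def)
  qed
  note prob_eq = this
  have "eventually (\<lambda>n. column_mass q n (n+u) (w n) (\<lambda>x. generate (vecs q n) (x ` {1..n+u}) \<in> H.kernels n)
     = measure (M n) {\<omega> \<in> space (M n). cok p n (n + u) (A n \<omega>) \<cong> H}) sequentially"
  proof (rule eventually_mono[OF eventually_ge_at_top[of 1]])
    fix n :: nat assume "1 \<le> n"
    then show "column_mass q n (n+u) (w n) (\<lambda>x. generate (vecs q n) (x ` {1..n+u}) \<in> H.kernels n)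
      = measure (M n) {\<omega> \<in> space (M n). cok p n (n + u) (A n \<omega>) \<cong> H}" by (rule prob_eq[symmetric])
  qed
  with H.column_mass_tendsto[OF a0(1) assms(3) w ke] show ?thesis
    by (rule Lim_transform_eventually)
qed

end
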